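(* Let $a:\mathbf{R}^N\to(0,\infty)$ be a $C^1$ function and let $H$ be the Friedrichs extension in $L^2(\mathbf{R}^N,\mathrm{d}^Nx)$ of the non-negative symmetric operator $H_0f=-\nabla\cdot(a\nabla f)$, $f\in C_c^\infty(\mathbf{R}^N)$. If $\lim_{|x|\to\infty}a(x)=0$, then for every $\alpha>0$ the operator $A=(H+\alpha I)^{-1}$ satisfies $$\lim_{k\to 0}\|V_kAV_{-k}-A\|=0$$ but does not satisfy $$\lim_{s\to0}\|U_sA-A\|=0,\qquad \lim_{s\to0}\|U_sA^*-A^*\|=0.$$ Hence $H$ is affiliated with $\mathcal{D}$ but not with $\mathcal{E}$.
   Context: For $k,s\in\mathbf{R}^N$, $V_k$ and $U_s$ are the unitary operators on $L^2(\mathbf{R}^N)$ given by $(V_kf)(x)=\mathrm{e}^{ik\cdot x}f(x)$ and $(U_sf)(x)=f(x+s)$. Norms are operator norms. $\mathcal{D}$ is the C*-algebra of all bounded operators $A$ on $L^2(\mathbf{R}^N)$ such that $\lim_{k\to0}\|V_kAV_{-k}-A\|=0$. $\mathcal{E}$ is the C*-algebra of all $A\in\mathcal{D}$ such that moreover $\lim_{s\to0}\|U_sA-A\|=0$ and $\lim_{s\to0}\|U_sA^*-A^*\|=0$. The Friedrichs extension $H$ is the non-negative self-adjoint operator associated with the closure of the (closable) quadratic form $Q_0(f)=\int_{\mathbf{R}^N}a(x)|\nabla f(x)|^2\,\mathrm{d}^Nx$ defined on $C_c^\infty(\mathbf{R}^N)$. A self-adjoint operator $H$ is affiliated with a C*-algebra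 $\mathcal{A}$ of operators if $(H-z)^{-1}\in\mathcal{A}$ for some (equivalently all) $z\in\mathbf{C}\setminus\sigma(H)$; for non-negative $H$ this is equivalent to $(H+\alpha I)^{-1}\in\mathcal{A}$ for some (equivalently all) $\alpha>0$. *)

theory Defs
  imports "HOL-Analysis.Analysis"
begin

section \<open>The complex Hilbert space of square-integrable functions\<close>

definition sq_integrable :: "('a::euclidean_space \<Rightarrow> complex) \<Rightarrow> bool" where
  "sq_integrable f \<longleftrightarrow>
     f \<in> borel_measurable lborel \<and> integrable lborel (\<lambda>x. (cmod (f x))\<^sup>2)"

lemma sq_integrable_measurable [measurable_dest]:
  "sq_integrable f \<Longrightarrow> f \<in> borel_measurable lborel"
  by (simp add: sq_integrable_def)

lemma sq_integrable_bound:
  assumes "f \<in> borel_measurable lborel" "integrable lborel g" "\<And>x. (cmod (f x))\<^sup>2 \<le> g x"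
  shows "sq_integrable f"
  unfolding sq_integrable_def
proof
  show "integrable lborel (\<lambda>x. (cmod (f x))\<^sup>2)"
  proof (rule Bochner_Integration.integrable_bound[OF assms(2)])
    show "AE x in lborel. norm ((cmod (f x))\<^sup>2) \<le> norm (g x)"
      using assms(3) by (intro AE_I2) (smt (verit) real_norm_def zero_le_power2)
  qed (use assms(1) in measurable)
qed fact

lemma sq_integrable_zero: "sq_integrable (\<lambda>x. 0)"
  by (simp add: sq_integrable_def)

lemma sq_integrable_cmult: "sq_integrable f \<Longrightarrow> sq_integrable (\<lambda>x. c * f x)"
  by (auto simp: sq_integrable_def norm_mult power_mult_distrib)

lemma sq_integrable_add:
  assumes "sq_integrable f" "sq_integrable g"
  shows "sq_integrable (\<lambda>x. f x + g x)"
proof (rule sq_integrable_bound)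
  show "integrable lborel (\<lambda>x. 2 * (cmod (f x))\<^sup>2 + 2 * (cmod (g x))\<^sup>2)"
    using assms by (auto simp: sq_integrable_def)
  fix x
  have "(cmod (f x + g x))\<^sup>2 \<le> (cmod (f x) + cmod (g x))\<^sup>2"
    by (intro power_mono norm_triangle_ineq) auto
  also have "\<dots> \<le> 2 * (cmod (f x))\<^sup>2 + 2 * (cmod (g x))\<^sup>2"
    using zero_le_power2[of "cmod (f x) - cmod (g x)"]
    by (simp add: power2_eq_square algebra_simps)
  finally show "(cmod (f x + g x))\<^sup>2 \<le> 2 * (cmod (f x))\<^sup>2 + 2 * (cmod (g x))\<^sup>2" .
qed (use assms in measurable)

lemma borel_measurable_cnj [measurable (raw)]:
  "f \<in> borel_measurable M \<Longrightarrow> (\<lambda>x. cnj (f x)) \<in> borel_measurable M"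
  by (rule borel_measurable_continuous_on) (auto intro: continuous_intros)

lemma sq_integrable_mult_cnj:
  assumes "sq_integrable f" "sq_integrable g"
  shows "integrable lborel (\<lambda>x. f x * cnj (g x))"
proof (rule Bochner_Integration.integrable_bound)
  show "integrable lborel (\<lambda>x. (cmod (f x))\<^sup>2 + (cmod (g x))\<^sup>2)"
    using assms by (auto simp: sq_integrable_def)
  show "AE x in lborel. norm (f x * cnj (g x)) \<le> norm ((cmod (f x))\<^sup>2 + (cmod (g x))\<^sup>2)"
  proof (rule AE_I2)
    fix x
    have "2 * (cmod (f x) * cmod (g x)) \<le> (cmod (f x))\<^sup>2 + (cmod (g x))\<^sup>2"
      using sum_squares_bound[of "cmod (f x)" "cmod (g x)"] by simp
    moreover have "0 \<le> cmod (f x) * cmod (g x)" by simp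
    ultimately have "cmod (f x) * cmod (g x) \<le> (cmod (f x))\<^sup>2 + (cmod (g x))\<^sup>2"
      by linarith
    then show "norm (f x * cnj (g x)) \<le> norm ((cmod (f x))\<^sup>2 + (cmod (g x))\<^sup>2)"
      by (simp add: norm_mult)
  qed
qed (use assms in measurable)

lemma AE_lborel_shift:
  fixes s :: "'a::euclidean_space"
  assumes "AE x in lborel. P x"
  shows "AE x in lborel. P (x + s)"
proof -
  obtain N where N: "N \<in> null_sets lborel" "{x. \<not> P x} \<subseteq> N"
    using assms unfolding eventually_ae_filter by auto
  have "AE x in distr lborel borel ((+) s). x \<notin> N"
    using AE_not_in[OF N(1)] by (subst lborel_distr_plus)
  then have "AE x in lborel. s + x \<notin> N"
    using N(1) by (subst (asm) AE_distr_iff) (auto simp: null_sets_def)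
  then show ?thesis
    by (rule eventually_mono) (use N(2) in \<open>auto simp: add.commute\<close>)
qed

lemma sq_integrable_shift:
  fixes s :: "'a::euclidean_space"
  assumes "sq_integrable f"
  shows "sq_integrable (\<lambda>x. f (x + s))"
proof -
  have [measurable]: "f \<in> borel_measurable borel"
    using assms by (simp add: sq_integrable_def)
  have "integrable (distr lborel borel ((+) s)) (\<lambda>x. (cmod (f x))\<^sup>2)"
    using assms by (simp add: lborel_distr_plus sq_integrable_def)
  then show ?thesis
    by (subst (asm) integrable_distr_eq) (auto simp: sq_integrable_def add.commute)
qed

quotient_type (overloaded) 'a L2 = "'a::euclidean_space \<Rightarrow> complex" / partial:
  "\<lambda>f g. sq_integrable f \<and> sq_integrable g \<and> (AE x in lborel. f x = g x)"
proof (rule part_equivpI)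
  show "\<exists>f. sq_integrable f \<and> sq_integrable f \<and> (AE x in lborel. f x = f x)"
    using sq_integrable_zero by auto
  show "symp (\<lambda>f g. sq_integrable f \<and> sq_integrable g \<and> (AE x in lborel. f x = g x))"
    by (auto intro!: sympI elim: AE_mp)
  show "transp (\<lambda>f g. sq_integrable f \<and> sq_integrable g \<and> (AE x in lborel. f x = g x))"
    by (auto intro!: transpI)
qed

text \<open>The inner product is linear in its first argument.\<close>

lift_definition cinner :: "'a::euclidean_space L2 \<Rightarrow> 'a L2 \<Rightarrow> complex"
  is "\<lambda>f g. \<integral>x. f x * cnj (g x) \<partial>lborel"
  by (rule integral_cong_AE)
    (auto intro!: borel_measurable_times borel_measurable_cnj dest: sq_integrable_measurable)

lift_definition cscale :: "complex \<Rightarrow> 'a::euclidean_space L2 \<Rightarrow> 'a L2"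
  is "\<lambda>c f x. c * f x"
  by (auto simp: sq_integrable_cmult)

instantiation L2 :: (euclidean_space) real_inner
begin

lift_definition zero_L2 :: "'a L2" is "\<lambda>x. 0"
  by (simp add: sq_integrable_zero)

lift_definition plus_L2 :: "'a L2 \<Rightarrow> 'a L2 \<Rightarrow> 'a L2" is "\<lambda>f g x. f x + g x"
  by (auto simp: sq_integrable_add)

lift_definition uminus_L2 :: "'a L2 \<Rightarrow> 'a L2" is "\<lambda>f x. - f x"
  by (auto simp: sq_integrable_def)

definition minus_L2 :: "'a L2 \<Rightarrow> 'a L2 \<Rightarrow> 'a L2" where
  "minus_L2 u v = u + (- v)"

definition scaleR_L2 :: "real \<Rightarrow> 'a L2 \<Rightarrow> 'a L2" where
  "scaleR_L2 r u = cscale (of_real r) u"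

lift_definition norm_L2 :: "'a L2 \<Rightarrow> real" is "\<lambda>f. sqrt (\<integral>x. (cmod (f x))\<^sup>2 \<partial>lborel)"
  by (intro arg_cong[where f=sqrt] integral_cong_AE) (auto dest: sq_integrable_measurable)

definition inner_L2 :: "'a L2 \<Rightarrow> 'a L2 \<Rightarrow> real" where
  "inner_L2 u v = Re (cinner u v)"

definition sgn_L2 :: "'a L2 \<Rightarrow> 'a L2" where
  "sgn_L2 u = cscale (of_real (inverse (norm u))) u"

definition dist_L2 :: "'a L2 \<Rightarrow> 'a L2 \<Rightarrow> real" where
  "dist_L2 u v = norm (u - v)"

definition uniformity_L2 :: "('a L2 \<times> 'a L2) filter" where
  "uniformity_L2 = (INF e\<in>{0 <..}. principal {(x, y). dist x y < e})"

definition open_L2 :: "'a L2 set \<Rightarrow> bool" where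
  "open_L2 S = (\<forall>x\<in>S. \<forall>\<^sub>F (x', y) in uniformity. x' = x \<longrightarrow> y \<in> S)"

instance
proof
  fix u v w :: "'a L2" and r s :: real
  show "u + v + w = u + (v + w)" 
    by transfer (auto intro!: sq_integrable_add simp: add.assoc)
  show "u + v = v + u"
    by transfer (auto intro!: sq_integrable_add simp: add.commute)
  show "0 + u = u"
    by transfer auto
  show "- u + u = 0"
    by transfer (auto simp: sq_integrable_zero)
  show "u - v = u + - v"
    by (simp add: minus_L2_def)
  show "r *\<^sub>R (u + v) = r *\<^sub>R u + r *\<^sub>R v"
    unfolding scaleR_L2_def
    by transfer (auto intro!: sq_integrable_add sq_integrable_cmult simp: distrib_left)
  show "(r + s) *\<^sub>R u = r *\<^sub>R u + s *\<^sub>R u"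
    unfolding scaleR_L2_def
    by transfer (auto intro!: sq_integrable_add sq_integrable_cmult simp: distrib_right)
  show "r *\<^sub>R s *\<^sub>R u = (r * s) *\<^sub>R u"
    unfolding scaleR_L2_def
    by transfer (auto intro!: sq_integrable_cmult simp: mult.assoc)
  show "1 *\<^sub>R u = u"
    unfolding scaleR_L2_def by transfer auto
  show "sgn u = inverse (norm u) *\<^sub>R u"
    by (simp add: sgn_L2_def scaleR_L2_def)
  show "dist u v = norm (u - v)"
    by (simp add: dist_L2_def)
  show "uniformity = (INF e\<in>{0 <..}. principal {(x::'a L2, y). dist x y < e})"
    by (simp add: uniformity_L2_def)
  show "open S = (\<forall>x\<in>S. \<forall>\<^sub>F (x', y) in uniformity. x' = x \<longrightarrow> y \<in> S)" for S :: "'a L2 set"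
    by (simp add: open_L2_def)
  have cnj_swap: "cinner v u = cnj (cinner u v)" for u v :: "'a L2"
    by transfer (subst Bochner_Integration.integral_cnj[symmetric], simp add: mult.commute)
  show "u \<bullet> v = v \<bullet> u"
    unfolding inner_L2_def by (subst cnj_swap) simp
  show "(u + v) \<bullet> w = u \<bullet> w + v \<bullet> w"
    unfolding inner_L2_def
    by transfer (simp add: distrib_right sq_integrable_mult_cnj)
  show "r *\<^sub>R u \<bullet> v = r * (u \<bullet> v)"
    unfolding inner_L2_def scaleR_L2_def
    by transfer (simp add: mult.assoc)
  have self: "u \<bullet> u = (norm u)\<^sup>2" 
    unfolding inner_L2_def
    by transfer (simp add: complex_norm_square[symmetric] integral_complex_of_real del: of_real_power)
  show "0 \<le> u \<bullet> u"
    by (simp add: self)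
  have "norm u = 0 \<longleftrightarrow> u = 0"
  proof transfer
    fix f :: "'a \<Rightarrow> complex"
    assume "sq_integrable f \<and> sq_integrable f \<and> (AE x in lborel. f x = f x)"
    then have f: "sq_integrable f" by simp
    have "(\<integral>x. (cmod (f x))\<^sup>2 \<partial>lborel) = 0 \<longleftrightarrow> (AE x in lborel. (cmod (f x))\<^sup>2 = 0)"
      using f by (intro integral_nonneg_eq_0_iff_AE) (auto simp: sq_integrable_def)
    then show "(sqrt (\<integral>x. (cmod (f x))\<^sup>2 \<partial>lborel) = 0) =
        (sq_integrable f \<and> sq_integrable (\<lambda>x. 0 :: complex) \<and> (AE x in lborel. f x = 0))"
      using f by (simp add: sq_integrable_zero)
  qed
  then show "u \<bullet> u = 0 \<longleftrightarrow> u = 0"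
    by (simp add: self)
  have "0 \<le> norm u"
    by transfer simp
  then show "norm u = sqrt (u \<bullet> u)"
    by (simp add: self)
qed

end


section \<open>Bounded and unbounded operators\<close>

definition bounded_op :: "('a::euclidean_space L2 \<Rightarrow> 'a L2) \<Rightarrow> bool" where
  "bounded_op A \<longleftrightarrow> bounded_linear A \<and> (\<forall>c u. A (cscale c u) = cscale c (A u))"

definition adj :: "('a::euclidean_space L2 \<Rightarrow> 'a L2) \<Rightarrow> 'a L2 \<Rightarrow> 'a L2" where
  "adj A = (THE B. bounded_op B \<and> (\<forall>u v. cinner (A u) v = cinner u (B v)))"

text \<open>Unbounded operators are represented by their graphs, so that \<open>plus_scalar T z\<close> is \<open>T + z I\<close>.
  A bounded inverse is an everywhere defined bounded operator whose graph is the converse of \<open>T\<close>.\<close>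

definition plus_scalar ::
    "('a::euclidean_space L2 \<times> 'a L2) set \<Rightarrow> complex \<Rightarrow> ('a L2 \<times> 'a L2) set" where
  "plus_scalar T z = {(u, v + cscale z u) |u v. (u, v) \<in> T}"

definition is_bounded_inverse ::
    "('a::euclidean_space L2 \<times> 'a L2) set \<Rightarrow> ('a L2 \<Rightarrow> 'a L2) \<Rightarrow> bool" where
  "is_bounded_inverse T R \<longleftrightarrow> bounded_op R \<and> T\<inverse> = {(w, R w) |w. True}"

definition bounded_inverse ::
    "('a::euclidean_space L2 \<times> 'a L2) set \<Rightarrow> 'a L2 \<Rightarrow> 'a L2" where
  "bounded_inverse T = (THE R. is_bounded_inverse T R)"

definition spectrum :: "('a::euclidean_space L2 \<times> 'a L2) set \<Rightarrow> complex set" where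
  "spectrum T = {z. \<not> (\<exists>R. is_bounded_inverse (plus_scalar T (- z)) R)}"

definition affiliated ::
    "('a::euclidean_space L2 \<times> 'a L2) set \<Rightarrow> ('a L2 \<Rightarrow> 'a L2) set \<Rightarrow> bool" where
  "affiliated T \<A> \<longleftrightarrow> (\<exists>z. z \<notin> spectrum T \<and> bounded_inverse (plus_scalar T (- z)) \<in> \<A>)"


section \<open>The algebras \<open>\<D>\<close> and \<open>\<E>\<close>\<close>

lift_definition V_op :: "'a::euclidean_space \<Rightarrow> 'a L2 \<Rightarrow> 'a L2"
  is "\<lambda>k f x. exp (\<i> * of_real (k \<bullet> x)) * f x"
  by (auto simp: sq_integrable_def norm_mult)

lift_definition U_op :: "'a::euclidean_space \<Rightarrow> 'a L2 \<Rightarrow> 'a L2"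
  is "\<lambda>s f x. f (x + s)"
  by (intro conjI) (elim conjE; erule sq_integrable_shift AE_lborel_shift)+

definition algebra_D :: "('a::euclidean_space L2 \<Rightarrow> 'a L2) set" where
  "algebra_D = {A. bounded_op A \<and>
     ((\<lambda>k. onorm (\<lambda>u. V_op k (A (V_op (- k) u)) - A u)) \<longlongrightarrow> 0) (at 0)}"

definition algebra_E :: "('a::euclidean_space L2 \<Rightarrow> 'a L2) set" where
  "algebra_E = {A \<in> algebra_D.
     ((\<lambda>s. onorm (\<lambda>u. U_op s (A u) - A u)) \<longlongrightarrow> 0) (at 0) \<and>
     ((\<lambda>s. onorm (\<lambda>u. U_op s (adj A u) - adj A u)) \<longlongrightarrow> 0) (at 0)}"


section \<open>Smooth functions\<close>

definition partial :: "'a::euclidean_space \<Rightarrow> ('a \<Rightarrow> 'b::real_normed_vector) \<Rightarrow> 'a \<Rightarrow> 'b" where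
  "partial b f x = frechet_derivative f (at x) b"

primrec C_k :: "nat \<Rightarrow> ('a::euclidean_space \<Rightarrow> 'b::real_normed_vector) \<Rightarrow> bool" where
  "C_k 0 f \<longleftrightarrow> continuous_on UNIV f"
| "C_k (Suc n) f \<longleftrightarrow> (\<forall>x. f differentiable (at x)) \<and> (\<forall>b\<in>Basis. C_k n (partial b f))"

definition Cc_infinity :: "('a::euclidean_space \<Rightarrow> complex) set" where
  "Cc_infinity = {f. (\<forall>n. C_k n f) \<and> compact (closure {x. f x \<noteq> 0})}"


section \<open>Sesquilinear forms and the Friedrichs extension\<close>

text \<open>A form is given by its domain \<open>D\<close> and a map \<open>q\<close>, linear in its first argument and
  conjugate-linear in its second; the associated quadratic form is \<open>u \<mapsto> q u u\<close>.\<close>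

definition form_converges ::
    "'a::euclidean_space L2 set \<Rightarrow> ('a L2 \<Rightarrow> 'a L2 \<Rightarrow> complex) \<Rightarrow>
     (nat \<Rightarrow> 'a L2) \<Rightarrow> 'a L2 \<Rightarrow> bool" where
  "form_converges D q f u \<longleftrightarrow> range f \<subseteq> D \<and> f \<longlonglongrightarrow> u \<and>
     (\<forall>e>0. \<exists>M. \<forall>m\<ge>M. \<forall>n\<ge>M. cmod (q (f m - f n) (f m - f n)) < e)"

definition closure_domain ::
    "'a::euclidean_space L2 set \<Rightarrow> ('a L2 \<Rightarrow> 'a L2 \<Rightarrow> complex) \<Rightarrow> 'a L2 set" where
  "closure_domain D q = {u. \<exists>f. form_converges D q f u}"

text \<open>The value of the closed form does not depend on the approximating sequences
  exactly because the form is closable.\<close>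

definition closure_form ::
    "'a::euclidean_space L2 set \<Rightarrow> ('a L2 \<Rightarrow> 'a L2 \<Rightarrow> complex) \<Rightarrow>
     'a L2 \<Rightarrow> 'a L2 \<Rightarrow> complex" where
  "closure_form D q u v = (THE c. \<forall>f g. form_converges D q f u \<longrightarrow> form_converges D q g v \<longrightarrow>
     (\<lambda>n. q (f n) (g n)) \<longlonglongrightarrow> c)"

text \<open>The operator of a closed form in the sense of the first representation theorem.\<close>

definition form_operator ::
    "'a::euclidean_space L2 set \<Rightarrow> ('a L2 \<Rightarrow> 'a L2 \<Rightarrow> complex) \<Rightarrow> ('a L2 \<times> 'a L2) set" where
  "form_operator D q = {(u, v). u \<in> D \<and> (\<forall>w\<in>D. q u w = cinner v w)}"

definition test_space :: "'a::euclidean_space L2 set" where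
  "test_space = abs_L2 ` Cc_infinity"

text \<open>A class in \<open>L2\<close> contains at most one continuous function, so the smooth
  representative is unique.\<close>

definition test_rep :: "'a::euclidean_space L2 \<Rightarrow> 'a \<Rightarrow> complex" where
  "test_rep u = (THE f. f \<in> Cc_infinity \<and> abs_L2 f = u)"

text \<open>\<open>Q0 a u u\<close> is the integral of \<open>a |\<nabla>u|\<^sup>2\<close>.\<close>

definition Q0 :: "('a::euclidean_space \<Rightarrow> real) \<Rightarrow> 'a L2 \<Rightarrow> 'a L2 \<Rightarrow> complex" where
  "Q0 a u v = (\<integral>x. of_real (a x) *
     (\<Sum>b\<in>Basis. partial b (test_rep u) x * cnj (partial b (test_rep v) x)) \<partial>lborel)"

definition friedrichs :: "('a::euclidean_space \<Rightarrow> real) \<Rightarrow> ('a L2 \<times> 'a L2) set" where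
  "friedrichs a = form_operator (closure_domain test_space (Q0 a)) (closure_form test_space (Q0 a))"


section \<open>The symmetric operator extended by \<open>friedrichs\<close>\<close>

lemma has_vector_derivative_partial:
  assumes "f differentiable (at x)"
  shows "((\<lambda>t. f (x + t *\<^sub>R b)) has_vector_derivative partial b f x) (at 0)"
proof -
  have 1: "(f has_derivative frechet_derivative f (at x)) (at (x + 0 *\<^sub>R b))"
    using assms by (simp add: frechet_derivative_works)
  have 2: "((\<lambda>t. x + t *\<^sub>R b) has_derivative (\<lambda>t. t *\<^sub>R b)) (at 0)"
    by (auto intro!: derivative_eq_intros)
  have "((\<lambda>t. f (x + t *\<^sub>R b)) has_derivative (\<lambda>t. frechet_derivative f (at x) (t *\<^sub>R b))) (at 0)"
    using diff_chain_at[OF 2 1] by (simp add: o_def)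
  then show ?thesis
    unfolding partial_def has_vector_derivative_def
    by (simp add: linear_scale[OF linear_frechet_derivative[OF assms]])
qed

lemma has_vector_derivative_partial':
  assumes "\<And>x. f differentiable (at x)"
  shows "((\<lambda>t. f (x + t *\<^sub>R b)) has_vector_derivative partial b f (x + t *\<^sub>R b)) (at t)"
proof -
  have "((\<lambda>s. f ((x + t *\<^sub>R b) + s *\<^sub>R b)) has_vector_derivative partial b f (x + t *\<^sub>R b)) (at 0)"
    by (rule has_vector_derivative_partial) (rule assms)
  then have "((\<lambda>s. f ((x + t *\<^sub>R b) + s *\<^sub>R b)) has_vector_derivative partial b f (x + t *\<^sub>R b)) (at (t - t))"
    by simp
  moreover have "((\<lambda>s. s - t) has_real_derivative 1) (at t)"
    by (auto intro!: derivative_eq_intros)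
  ultimately have "((\<lambda>s. f ((x + t *\<^sub>R b) + s *\<^sub>R b)) \<circ> (\<lambda>s. s - t) has_vector_derivative 
      1 *\<^sub>R partial b f (x + t *\<^sub>R b)) (at t)"
    by (intro vector_diff_chain_at) (auto simp: has_real_derivative_iff_has_vector_derivative)
  then show ?thesis
    by (simp add: o_def algebra_simps)
qed

lemma partial_eq:
  assumes "f differentiable (at x)" "((\<lambda>t. f (x + t *\<^sub>R b)) has_vector_derivative D) (at 0)"
  shows "partial b f x = D"
  using has_vector_derivative_partial[OF assms(1)] assms(2) vector_derivative_unique_at by blast

lemma partial_zero_outside:
  fixes h :: "'a::euclidean_space \<Rightarrow> 'b::real_normed_vector"
  assumes "x \<notin> closure {x. h x \<noteq> 0}"
  shows "partial b h x = 0"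
proof -
  let ?S = "- closure {x. h x \<noteq> 0}"
  have "(h has_derivative (\<lambda>_. 0)) (at x)"
  proof (rule has_derivative_transform_within_open[of "\<lambda>_. 0" _ _ _ ?S])
    show "0 = h y" if "y \<in> ?S" for y
      using that closure_subset[of "{x. h x \<noteq> 0}"] by auto
  qed (use assms in auto)
  then show ?thesis
    unfolding partial_def by (metis frechet_derivative_at)
qed

lemma integrable_compact_support:
  fixes h :: "'a::euclidean_space \<Rightarrow> 'b::{banach, second_countable_topology}"
  assumes "continuous_on UNIV h" "compact K" "\<And>x. x \<notin> K \<Longrightarrow> h x = 0"
  shows "integrable lborel h"
proof -
  have "integrable lborel (\<lambda>x. indicator K x *\<^sub>R h x)"
    by (intro borel_integrable_compact continuous_on_subset[OF assms(1)] assms(2)) simp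
  moreover have "(\<lambda>x. indicator K x *\<^sub>R h x) = h"
    using assms(3) by (auto simp: indicator_def fun_eq_iff)
  ultimately show ?thesis by simp
qed

lemma integral_partial_zero:
  fixes h :: "'a::euclidean_space \<Rightarrow> complex"
  assumes diff: "\<And>x. h differentiable (at x)"
    and cont: "continuous_on UNIV (partial b h)"
    and b: "b \<in> Basis"
    and K: "compact (closure {x. h x \<noteq> 0})"
  shows "(\<integral>x. partial b h x \<partial>lborel) = 0"
proof -
  let ?K = "closure {x. h x \<noteq> 0}"
  have hK: "h x = 0" if "x \<notin> ?K" for x
    using that closure_subset[of "{x. h x \<noteq> 0}"] by auto
  have conth: "continuous_on UNIV h"
    using diff by (simp add: continuous_on_eq_continuous_at differentiable_imp_continuous_within)
  obtain R where "\<forall>x\<in>?K. norm x \<le> R"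
    using compact_imp_bounded[OF K] unfolding bounded_iff ..
  then have R: "x \<notin> ?K" if "norm x > R" for x
    using that by (meson not_le)
  have "bounded (partial b h ` ?K)"
    by (intro compact_imp_bounded compact_continuous_image continuous_on_subset[OF cont] K) simp
  then obtain M0 where "\<forall>y\<in>partial b h ` ?K. cmod y \<le> M0"
    unfolding bounded_iff ..
  then have M0: "cmod (partial b h x) \<le> M0" if "x \<in> ?K" for x
    using that by simp
  define M where "M = max 0 M0"
  have M: "cmod (partial b h x) \<le> M" for x
    using M0[of x] partial_zero_outside[of x h b] by (cases "x \<in> ?K") (auto simp: M_def)
  have lip: "cmod (h (x + t *\<^sub>R b) - h x) \<le> M * t" if "t \<ge> 0" for x t
  proof -
    have "norm ((\<lambda>s. h (x + s *\<^sub>R b)) t - (\<lambda>s. h (x + s *\<^sub>R b)) 0) \<le> M * norm (t - 0)"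
    proof (rule differentiable_bound[where S = UNIV])
      show "((\<lambda>s. h (x + s *\<^sub>R b)) has_derivative (\<lambda>r. r *\<^sub>R partial b h (x + s *\<^sub>R b))) (at s within UNIV)"
        for s using has_vector_derivative_partial'[OF diff] by (simp add: has_vector_derivative_def)
      show "onorm (\<lambda>r::real. r *\<^sub>R partial b h (x + s *\<^sub>R b)) \<le> M" for s :: real
        by (rule onorm_le) (use M[of "x + s *\<^sub>R b"] in 
            \<open>simp add: mult.commute[of "abs _"] mult_right_mono\<close>)
    qed auto
    then show ?thesis using that by simp
  qed
  define t where "t n = inverse (real (Suc n))" for n
  define \<phi> where "\<phi> n x = (h (x + t n *\<^sub>R b) - h x) /\<^sub>R t n" for n x
  have t: "t n > 0" "t n \<le> 1" for n by (auto simp: t_def field_simps)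
  have inth: "integrable lborel h"
    by (rule integrable_compact_support[OF conth K hK])
  have shift: "integrable lborel (\<lambda>x. h (x + s))" "(\<integral>x. h (x + s) \<partial>lborel) = (\<integral>x. h x \<partial>lborel)" for s
  proof -
    have [measurable]: "h \<in> borel_measurable borel"
      using conth by (rule borel_measurable_continuous_onI)
    have "integrable (distr lborel borel ((+) s)) h"
      using inth by (subst lborel_distr_plus)
    then show "integrable lborel (\<lambda>x. h (x + s))"
      by (subst (asm) integrable_distr_eq) (auto simp: add.commute)
    have "(\<integral>x. h x \<partial>distr lborel borel ((+) s)) = (\<integral>x. h (x + s) \<partial>lborel)"
      by (subst integral_distr) (auto simp: add.commute)
    then show "(\<integral>x. h (x + s) \<partial>lborel) = (\<integral>x. h x \<partial>lborel)"
      by (subst (asm) lborel_distr_plus) simp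
  qed
  have zero: "(\<integral>x. \<phi> n x \<partial>lborel) = 0" for n
    unfolding \<phi>_def using shift inth by simp
  have "(\<lambda>n. \<integral>x. \<phi> n x \<partial>lborel) \<longlonglongrightarrow> (\<integral>x. partial b h x \<partial>lborel)"
  proof (rule integral_dominated_convergence[where w = "\<lambda>x. M * indicator (cball 0 (R + 1)) x"])
    show "partial b h \<in> borel_measurable lborel"
      using cont by (simp add: borel_measurable_continuous_onI)
    show "\<phi> n \<in> borel_measurable lborel" for n
      unfolding \<phi>_def using shift(1)[of "t n *\<^sub>R b"] inth
      by (intro borel_measurable_scaleR borel_measurable_diff) auto
    show "integrable lborel (\<lambda>x::'a. M * indicator (cball 0 (R + 1)) x :: real)"
      by (intro integrable_mult_right integrable_real_indicator)
        (use emeasure_lborel_cball_finite[of "0::'a" "R + 1"] in \<open>auto simp: infinity_ennreal_def\<close>)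
    show "AE x in lborel. (\<lambda>n. \<phi> n x) \<longlonglongrightarrow> partial b h x"
    proof (rule AE_I2)
      fix x
      have "((\<lambda>s. h (x + s *\<^sub>R b)) has_vector_derivative partial b h x) (at 0)"
        by (rule has_vector_derivative_partial[OF diff])
      then have "((\<lambda>s. (h (x + s *\<^sub>R b) - h x - s *\<^sub>R partial b h x) /\<^sub>R \<bar>s\<bar>) \<longlongrightarrow> 0) (at 0)"
        by (simp add: has_vector_derivative_def has_derivative_def)
      then have "((\<lambda>s. norm ((h (x + s *\<^sub>R b) - h x - s *\<^sub>R partial b h x) /\<^sub>R \<bar>s\<bar>)) \<longlongrightarrow> 0) (at 0)"
        by (rule tendsto_norm_zero)
      moreover have "norm ((h (x + s *\<^sub>R b) - h x - s *\<^sub>R partial b h x) /\<^sub>R \<bar>s\<bar>)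
          = norm ((h (x + s *\<^sub>R b) - h x) /\<^sub>R s - partial b h x)" if "s \<noteq> 0" for s
      proof -
        have "(h (x + s *\<^sub>R b) - h x) /\<^sub>R s - partial b h x
            = (h (x + s *\<^sub>R b) - h x - s *\<^sub>R partial b h x) /\<^sub>R s"
          using that by (simp add: scaleR_diff_right)
        then show ?thesis by simp
      qed
      ultimately have "((\<lambda>s. norm ((h (x + s *\<^sub>R b) - h x) /\<^sub>R s - partial b h x)) \<longlongrightarrow> 0) (at 0)"
        by (elim Lim_transform_eventually) (auto simp: eventually_at_filter)
      then have "((\<lambda>s. (h (x + s *\<^sub>R b) - h x) /\<^sub>R s) \<longlongrightarrow> partial b h x) (at 0)"
        by (rule Lim_null[THEN iffD2, OF tendsto_norm_zero_cancel])
      moreover have "filterlim t (at 0) sequentially"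
      proof (rule filterlim_atI)
        show "t \<longlonglongrightarrow> 0"
          unfolding t_def[abs_def] by (rule LIMSEQ_inverse_real_of_nat)
        show "\<forall>\<^sub>F n in sequentially. t n \<noteq> 0"
          using t(1) by (intro always_eventually allI) (metis less_irrefl)
      qed
      ultimately show "(\<lambda>n. \<phi> n x) \<longlonglongrightarrow> partial b h x"
        unfolding \<phi>_def by (rule filterlim_compose)
    qed
    show "AE x in lborel. norm (\<phi> n x) \<le> M * indicator (cball 0 (R + 1)) x" for n
    proof (rule AE_I2)
      fix x
      show "norm (\<phi> n x) \<le> M * indicator (cball 0 (R + 1)) x"
      proof (cases "x \<in> cball 0 (R + 1)")
        case True
        have "norm (\<phi> n x) = cmod (h (x + t n *\<^sub>R b) - h x) / t n"
          using t(1)[of n] by (simp add: \<phi>_def divide_inverse mult.commute)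
        also have "\<dots> \<le> M"
          using lip[of "t n" x] t(1)[of n] by (simp add: field_simps)
        finally show ?thesis using True by simp
      next
        case False
        then have "norm x > R + 1" by simp
        moreover have "norm (x + t n *\<^sub>R b) \<ge> norm x - t n"
          using norm_triangle_ineq2[of x "- (t n *\<^sub>R b)"] b t(1)[of n] by simp
        ultimately have "norm x > R" "norm (x + t n *\<^sub>R b) > R"
          using t(2)[of n] by linarith+
        then have "h x = 0" "h (x + t n *\<^sub>R b) = 0"
          using hK[OF R] by metis+
        then show ?thesis using False by (simp add: \<phi>_def)
      qed
    qed
  qed
  then have "(\<lambda>n. 0) \<longlonglongrightarrow> (\<integral>x. partial b h x \<partial>lborel)"
    by (simp add: zero)
  then show ?thesis
    by (simp add: LIMSEQ_const_iff)
qed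

lemma Cc_infinityD:
  assumes "f \<in> Cc_infinity"
  shows "f differentiable (at x)" "continuous_on UNIV f" "compact (closure {x. f x \<noteq> 0})"
    "b \<in> Basis \<Longrightarrow> partial b f differentiable (at x)"
    "b \<in> Basis \<Longrightarrow> continuous_on UNIV (partial b f)"
    "b \<in> Basis \<Longrightarrow> b' \<in> Basis \<Longrightarrow> continuous_on UNIV (partial b' (partial b f))"
proof -
  have C: "C_k n f" for n using assms by (simp add: Cc_infinity_def)
  show "f differentiable (at x)" using C[of "Suc 0"] by simp
  show "continuous_on UNIV f" using C[of 0] by simp
  show "compact (closure {x. f x \<noteq> 0})" using assms by (simp add: Cc_infinity_def)
  show "b \<in> Basis \<Longrightarrow> partial b f differentiable (at x)"
    "b \<in> Basis \<Longrightarrow> b' \<in> Basis \<Longrightarrow> continuous_on UNIV (partial b' (partial b f))"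
    using C[of "Suc (Suc 0)"] by auto
  show "b \<in> Basis \<Longrightarrow> continuous_on UNIV (partial b f)"
    using C[of "Suc 0"] by auto
qed

lemma sq_integrable_compact_support:
  assumes "continuous_on UNIV h" "compact K" "\<And>x. x \<notin> K \<Longrightarrow> h x = 0"
  shows "sq_integrable h"
  unfolding sq_integrable_def
proof
  show "h \<in> borel_measurable lborel"
    using assms(1) by (simp add: borel_measurable_continuous_onI)
  show "integrable lborel (\<lambda>x. (cmod (h x))\<^sup>2)"
    by (rule integrable_compact_support[OF _ assms(2)])
      (use assms(3) in \<open>auto intro!: continuous_on_power continuous_on_norm assms(1)\<close>)
qed

lemma Cc_infinity_outside: "x \<notin> closure {x. f x \<noteq> 0} \<Longrightarrow> f x = 0"
  using closure_subset[of "{x. f x \<noteq> 0}"] by auto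

lemma sq_integrable_Cc: "f \<in> Cc_infinity \<Longrightarrow> sq_integrable f"
  by (rule sq_integrable_compact_support[OF Cc_infinityD(2,3) Cc_infinity_outside])

lemma abs_L2_eq_iff:
  assumes "sq_integrable f" "sq_integrable g"
  shows "abs_L2 f = abs_L2 g \<longleftrightarrow> (AE x in lborel. f x = g x)"
  using Quotient_rel[OF Quotient_L2, of f g] assms by auto

lemma cinner_abs_L2:
  assumes "sq_integrable f" "sq_integrable g"
  shows "cinner (abs_L2 f) (abs_L2 g) = (\<integral>x. f x * cnj (g x) \<partial>lborel)"
  by (rule cinner.abs_eq) (use assms in auto)

lemma continuous_AE_eq:
  fixes f g :: "'a::euclidean_space \<Rightarrow> complex"
  assumes "continuous_on UNIV f" "continuous_on UNIV g" "AE x in lborel. f x = g x"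
  shows "f = g"
proof (rule ccontr)
  assume "f \<noteq> g"
  let ?S = "{x. f x \<noteq> g x}"
  have "open ?S"
    using assms by (intro open_Collect_neq)
  moreover have "?S \<noteq> {}" using \<open>f \<noteq> g\<close> by auto
  ultimately have "\<not> negligible ?S" by (rule open_not_negligible)
  moreover have "?S \<in> null_sets lebesgue"
  proof -
    have "AE x in lebesgue. f x = g x"
      using assms(3) by (rule AE_completion)
    then show ?thesis
      by (simp add: completion.AE_iff_null_sets)
  qed
  ultimately show False by (simp add: negligible_iff_null_sets)
qed

lemma test_rep_abs [simp]:
  assumes "f \<in> Cc_infinity"
  shows "test_rep (abs_L2 f) = f"
  unfolding test_rep_def
proof (rule the_equality)
  fix g assume "g \<in> Cc_infinity \<and> abs_L2 g = abs_L2 f"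
  then show "g = f"
    using assms by (auto simp: abs_L2_eq_iff sq_integrable_Cc intro!: continuous_AE_eq Cc_infinityD)
qed (use assms in simp)


lemma partial_mult:
  fixes f g :: "'a::euclidean_space \<Rightarrow> complex"
  assumes "f differentiable (at x)" "g differentiable (at x)"
  shows "partial b (\<lambda>y. f y * g y) x = f x * partial b g x + partial b f x * g x"
proof -
  have "((\<lambda>y. f y * g y) has_derivative
      (\<lambda>h. f x * frechet_derivative g (at x) h + frechet_derivative f (at x) h * g x)) (at x)"
    using assms by (intro has_derivative_mult) (simp_all add: frechet_derivative_works)
  from frechet_derivative_at[OF this, symmetric] show ?thesis
    by (simp add: partial_def)
qed

lemma partial_bounded_linear:
  assumes "bounded_linear L" "f differentiable (at x)"
  shows "partial b (\<lambda>y. L (f y)) x = L (partial b f x)"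
    and "(\<lambda>y. L (f y)) differentiable (at x)"
proof -
  have *: "((\<lambda>y. L (f y)) has_derivative (\<lambda>h. L (frechet_derivative f (at x) h))) (at x)"
    using assms(2) by (intro bounded_linear.has_derivative[OF assms(1)]) (simp add: frechet_derivative_works)
  from frechet_derivative_at[OF this, symmetric] show "partial b (\<lambda>y. L (f y)) x = L (partial b f x)"
    by (simp add: partial_def)
  from * show "(\<lambda>y. L (f y)) differentiable (at x)"
    by (rule differentiableI)
qed

text \<open>The symmetric operator \<open>H\<^sub>0 f = -\<nabla>\<sqdot>(a \<nabla>f)\<close> on test functions. By the identity below, \<open>Q0 a\<close>
  is its form, so \<open>friedrichs a\<close> is the Friedrichs extension of \<open>H\<^sub>0\<close>.\<close>

definition H0 :: "('a::euclidean_space \<Rightarrow> real) \<Rightarrow> ('a \<Rightarrow> complex) \<Rightarrow> 'a \<Rightarrow> complex" where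
  "H0 a f x = - (\<Sum>b\<in>Basis. partial b (\<lambda>y. of_real (a y) * partial b f y) x)"

lemma Q0_eq_H0:
  assumes a: "C_k 1 a" and f: "f \<in> Cc_infinity" and g: "g \<in> Cc_infinity"
  shows "sq_integrable (H0 a f)"
    and "Q0 a (abs_L2 f) (abs_L2 g) = cinner (abs_L2 (H0 a f)) (abs_L2 g)"
proof -
  define F where "F b y = complex_of_real (a y) * partial b f y" for b y
  have a_diff: "a differentiable (at x)" for x
    using a by simp
  have a_cont: "continuous_on UNIV a"
    using a_diff by (simp add: continuous_on_eq_continuous_at differentiable_imp_continuous_within)
  have a_cont': "continuous_on UNIV (partial b a)" if "b \<in> Basis" for b
    using a that by simp
  note ca = partial_bounded_linear[OF bounded_linear_of_real[where 'a=complex] a_diff]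
  note cg = partial_bounded_linear[OF bounded_linear_cnj Cc_infinityD(1)[OF g]]
  note fD = Cc_infinityD[OF f] and gD = Cc_infinityD[OF g]
  have F_diff: "F b differentiable (at x)" if "b \<in> Basis" for b x
    unfolding F_def using that by (intro differentiable_mult ca(2) fD(4))
  have F_cont: "continuous_on UNIV (F b)" if "b \<in> Basis" for b
    unfolding F_def using that by (intro continuous_intros a_cont fD(5))
  have F_partial: "partial b' (F b) x =
      of_real (a x) * partial b' (partial b f) x + of_real (partial b' a x) * partial b f x"
    if "b \<in> Basis" for b b' x
    unfolding F_def using that by (subst partial_mult) (auto intro: ca(2) fD(4) simp: ca(1))
  have F_cont': "continuous_on UNIV (partial b (F b))" if "b \<in> Basis" for b
  proof -
    have "partial b (F b) = (\<lambda>x. of_real (a x) * partial b (partial b f) x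
        + of_real (partial b a x) * partial b f x)"
      using F_partial[OF that] by (intro ext)
    then show ?thesis
      using that by (auto intro!: continuous_on_add continuous_on_mult continuous_on_of_real
          a_cont a_cont' fD(5,6))
  qed
  have H0_F: "H0 a f x = - (\<Sum>b\<in>Basis. partial b (F b) x)" for x
    by (simp add: H0_def F_def[abs_def])
  let ?K = "closure {x. f x \<noteq> 0}" and ?L = "closure {x. g x \<noteq> 0}"
  have F_0: "F b x = 0" if "x \<notin> ?K" for b x
    using partial_zero_outside[OF that] by (simp add: F_def)
  have F'_0: "partial b (F b) x = 0" if "x \<notin> ?K" for b x
  proof (rule partial_zero_outside)
    have "{x. F b x \<noteq> 0} \<subseteq> ?K"
      using F_0 by auto
    then have "closure {x. F b x \<noteq> 0} \<subseteq> ?K"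
      by (rule closure_minimal) simp
    then show "x \<notin> closure {x. F b x \<noteq> 0}"
      using that by auto
  qed
  show sq: "sq_integrable (H0 a f)"
  proof (rule sq_integrable_compact_support)
    show "continuous_on UNIV (H0 a f)"
      unfolding H0_F by (intro continuous_on_minus continuous_on_sum F_cont')
    show "H0 a f x = 0" if "x \<notin> ?K" for x
      using F'_0[OF that] by (simp add: H0_F)
  qed (rule fD(3))
  have int1: "integrable lborel (\<lambda>x. F b x * cnj (partial b g x))" if "b \<in> Basis" for b
    by (rule integrable_compact_support[OF _ fD(3)])
      (auto intro!: continuous_on_mult continuous_on_cnj F_cont gD(5) that simp: F_0)
  have int2: "integrable lborel (\<lambda>x. partial b (F b) x * cnj (g x))" if "b \<in> Basis" for b
    by (rule integrable_compact_support[OF _ fD(3)])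
      (auto intro!: continuous_on_mult continuous_on_cnj F_cont' gD(2) that simp: F'_0)
  have parts: "(\<integral>x. F b x * cnj (partial b g x) \<partial>lborel)
      = - (\<integral>x. partial b (F b) x * cnj (g x) \<partial>lborel)" if b: "b \<in> Basis" for b
  proof -
    let ?h = "\<lambda>x. F b x * cnj (g x)"
    have eq: "partial b ?h x = F b x * cnj (partial b g x) + partial b (F b) x * cnj (g x)" for x
      by (subst partial_mult) (auto intro: F_diff[OF b] cg(2) simp: cg(1))
    have "(\<integral>x. partial b ?h x \<partial>lborel) = 0"
    proof (rule integral_partial_zero[OF _ _ b])
      show "?h differentiable (at x)" for x
        by (intro differentiable_mult F_diff[OF b] cg(2))
      show "continuous_on UNIV (partial b ?h)"
        unfolding eq[abs_def] using b
        by (intro continuous_on_add continuous_on_mult continuous_on_cnj F_cont F_cont' gD(2,5))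
      have "closure {x. ?h x \<noteq> 0} \<subseteq> ?L"
        by (rule closure_mono) auto
      then show "compact (closure {x. ?h x \<noteq> 0})"
        using compact_Int_closed[OF gD(3) closed_closure[of "{x. ?h x \<noteq> 0}"]]
        by (simp only: Int_absorb1)
    qed
    then show ?thesis
      unfolding eq using int1[OF b] int2[OF b] by (simp add: add_eq_0_iff2)
  qed
  have "Q0 a (abs_L2 f) (abs_L2 g) =
      (\<integral>x. (\<Sum>b\<in>Basis. F b x * cnj (partial b g x)) \<partial>lborel)"
    by (simp add: Q0_def f g F_def sum_distrib_left mult.assoc)
  also have "\<dots> = (\<Sum>b\<in>Basis. \<integral>x. F b x * cnj (partial b g x) \<partial>lborel)"
    by (rule Bochner_Integration.integral_sum) (rule int1)
  also have "\<dots> = - (\<Sum>b\<in>Basis. \<integral>x. partial b (F b) x * cnj (g x) \<partial>lborel)"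
    by (simp add: parts sum_negf)
  also have "\<dots> = - (\<integral>x. (\<Sum>b\<in>Basis. partial b (F b) x * cnj (g x)) \<partial>lborel)"
    by (subst Bochner_Integration.integral_sum) (auto intro: int2)
  also have "\<dots> = cinner (abs_L2 (H0 a f)) (abs_L2 g)"
    by (subst cinner_abs_L2[OF sq sq_integrable_Cc[OF g]]) (simp add: H0_F sum_distrib_right)
  finally show "Q0 a (abs_L2 f) (abs_L2 g) = cinner (abs_L2 (H0 a f)) (abs_L2 g)" .
qed

end

theory Submission
  imports Defs "HOL-Computational_Algebra.Polynomial"
begin

text \<open>Write \<open>Q\<close> for the form with density \<open>a |\<nabla>u|\<^sup>2\<close> on test functions, \<open>E(u)\<^sup>2 = Q(u) + \<alpha> \<parallel>u\<parallel>\<^sup>2\<close>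
  for the shifted energy, and \<open>R\<close> for the inverse of \<open>H + \<alpha>\<close>.

  The tool that carries both halves of the theorem is the notion of an \<^emph>\<open>approximate solution\<close>:
  a test function \<open>f\<close> such that \<open>|Q(f,g) + \<alpha> \<langle>f,g\<rangle> - \<langle>w,g\<rangle>| \<le> \<epsilon> E(g)\<close> for all test functions \<open>g\<close>.
  An almost-minimiser of \<open>E(f)\<^sup>2 - 2 Re \<langle>w,f\<rangle>\<close> is one (\<open>approx_solution_exists\<close>), two of them differ
  by at most the sum of their errors in the energy norm (\<open>approx_solution_close\<close>), and since
  square-integrable functions form a complete space they converge to the solution of the closed
  problem as the errors tend to 0 (\<open>solution_exists\<close>). This constructs \<open>R\<close> and shows
  \<open>\<parallel>R w - f\<parallel> \<le> \<epsilon> / \<surd>\<alpha>\<close> (\<open>resolvent_approx\<close>), so that \<open>R\<close> can be estimated by computing with test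
  functions alone, without any description of the domain of \<open>H\<close>.

  \<^emph>\<open>Modulations.\<close> The gradient of \<open>e\<^sup>i\<^sup>k\<^sup>x f\<close> is \<open>e\<^sup>i\<^sup>k\<^sup>x (\<nabla>f + i k f)\<close>. As \<open>a\<close> is bounded,
  \<open>Q(V\<^sub>k f, V\<^sub>k g)\<close> differs from \<open>Q(f,g)\<close> by at most a multiple of \<open>|k| E(f) E(g)\<close>
  (\<open>form_modulation\<close>). Hence \<open>V\<^sub>k\<close> takes approximate solutions for \<open>V\<^sub>-\<^sub>k w\<close> to approximate solutions
  for \<open>w\<close> with an additional error of order \<open>|k|\<close>, which bounds the norm of \<open>V\<^sub>k R V\<^sub>-\<^sub>k - R\<close>.

  \<^emph>\<open>Translations.\<close> Where \<open>a\<close> is small, \<open>H\<close> is negligible and \<open>R\<close> acts like multiplication by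
  \<open>1/\<alpha>\<close>: indeed \<open>u/\<alpha>\<close> is an approximate solution for \<open>u\<close> with error \<open>\<surd>Q(u) / \<alpha>\<close>
  (\<open>approx_solution_rescaled\<close>), and this tends to 0 when a fixed test function is moved to infinity
  (\<open>energy_translate_tendsto\<close>). For given \<open>s \<noteq> 0\<close> a suitably oscillating test function \<open>\<psi>\<close> has
  \<open>\<parallel>U\<^sub>s \<psi> - \<psi>\<parallel> \<ge> \<parallel>\<psi>\<parallel>\<close> (\<open>translation_separating\<close>); applying \<open>U\<^sub>s R - R\<close> to \<open>\<psi>\<close> moved to infinity
  yields \<open>\<parallel>U\<^sub>s R - R\<parallel> \<ge> 1/\<alpha>\<close> for every \<open>s \<noteq> 0\<close> (\<open>onorm_translation_ge\<close>).

  The adjoint adds nothing, because \<open>R\<close> is self-adjoint. Finally, for an arbitrary point \<open>z\<close> of the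
  resolvent set, \<open>R\<close> factors as the resolvent at \<open>z\<close> followed on the right by a bounded operator
  (\<open>resolvent_factorization\<close>), so that no resolvent of \<open>H\<close> can lie in the smaller algebra.\<close>

section \<open>Positive Hermitian forms on complex subspaces\<close>

lemma cinner_add_left: "cinner (u + v) w = cinner u w + cinner v w"
  by transfer (simp add: distrib_right sq_integrable_mult_cnj)

lemma cinner_cscale_left: "cinner (cscale c u) w = c * cinner u w"
  by transfer (simp add: mult.assoc)

lemma cinner_commute: "cinner v u = cnj (cinner u v)"
  by transfer (subst Bochner_Integration.integral_cnj[symmetric], simp add: mult.commute)

lemma cinner_self: "cinner u u = of_real ((norm u)\<^sup>2)"
proof (rule complex_eqI)
  show "Re (cinner u u) = Re (of_real ((norm u)\<^sup>2))"
    using power2_norm_eq_inner[of u] by (simp add: inner_L2_def)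
  show "Im (cinner u u) = Im (of_real ((norm u)\<^sup>2))"
    using arg_cong[OF cinner_commute[of u u], of Im] by simp
qed

lemma cscale_add_right: "cscale c (u + v) = cscale c u + cscale c v"
  by transfer (auto intro!: sq_integrable_add sq_integrable_cmult simp: distrib_left)

lemma cscale_cscale: "cscale c (cscale d u) = cscale (c * d) u"
  by transfer (auto intro!: sq_integrable_cmult simp: mult.assoc)

lemma cscale_add_left: "cscale (c + d) u = cscale c u + cscale d u"
  by transfer (auto intro!: sq_integrable_add sq_integrable_cmult simp: distrib_right)

lemma cscale_one: "cscale 1 u = u"
  by transfer auto

lemma cscale_of_real: "cscale (of_real r) u = r *\<^sub>R u"
  by (simp add: scaleR_L2_def)

lemma cscale_zero_left: "cscale 0 u = 0"
  using cscale_of_real[of 0 u] by simp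

lemma cscale_minus_one: "cscale (- 1) u = - u"
  using cscale_of_real[of "- 1" u] by simp

lemma norm_cscale: "norm (cscale c u) = cmod c * norm u"
  by transfer (simp add: norm_mult power_mult_distrib real_sqrt_mult)

lemma bounded_linear_cscale: "bounded_linear (cscale c)"
proof (rule bounded_linear_intro[where K = "cmod c"])
  show "cscale c (u + v) = cscale c u + cscale c v" for u v
    by (rule cscale_add_right)
  show "cscale c (r *\<^sub>R u) = r *\<^sub>R cscale c u" for r u
    by (simp add: cscale_cscale mult.commute flip: cscale_of_real)
qed (simp add: norm_cscale mult.commute)

text \<open>The discriminant argument behind the Cauchy-Schwarz inequality. It is used a second time to pass
  from almost-minimality of a quadratic functional to a small first variation.\<close>

lemma quadratic_bound:
  fixes x a e :: real
  assumes *: "\<And>t. 2 * t * x\<^sup>2 \<le> a + t\<^sup>2 * x\<^sup>2 * e\<^sup>2"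
  shows "x\<^sup>2 \<le> a * e\<^sup>2"
proof (cases "e = 0")
  case True
  have "x = 0"
  proof (rule ccontr)
    assume "x \<noteq> 0"
    then have "2 * ((a + 1) / (2 * x\<^sup>2)) * x\<^sup>2 = a + 1"
      by simp
    with *[of "(a + 1) / (2 * x\<^sup>2)"] show False
      unfolding True by simp
  qed
  then show ?thesis using True by simp
next
  case False
  define t where "t = 1 / e\<^sup>2"
  have t: "t * e\<^sup>2 = 1"
    using False by (simp add: t_def)
  have "t\<^sup>2 * x\<^sup>2 * e\<^sup>2 = t * x\<^sup>2 * (t * e\<^sup>2)"
    by (simp only: power2_eq_square mult_ac)
  also have "\<dots> = t * x\<^sup>2"
    unfolding t by simp
  finally have "t * x\<^sup>2 \<le> a"
    using *[of t] by linarith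
  then show ?thesis
    using False by (simp add: t_def pos_divide_le_eq)
qed

text \<open>The laws are only required on the domain, as the forms of interest are given by integrals that
  are meaningless elsewhere. The same laws hold for the closure of a form and for a form shifted by
  a multiple of the inner product, so that all three share their elementary theory.\<close>

locale positive_form =
  fixes D :: "'a::euclidean_space L2 set" and q :: "'a L2 \<Rightarrow> 'a L2 \<Rightarrow> complex"
  assumes zero_mem [simp, intro]: "0 \<in> D"
    and add_mem [intro]: "u \<in> D \<Longrightarrow> v \<in> D \<Longrightarrow> u + v \<in> D"
    and cscale_mem [intro]: "u \<in> D \<Longrightarrow> cscale c u \<in> D"
    and add_left: "u \<in> D \<Longrightarrow> v \<in> D \<Longrightarrow> w \<in> D \<Longrightarrow> q (u + v) w = q u w + q v w"
    and cscale_left: "u \<in> D \<Longrightarrow> w \<in> D \<Longrightarrow> q (cscale c u) w = c * q u w"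
    and hermitian: "u \<in> D \<Longrightarrow> v \<in> D \<Longrightarrow> q v u = cnj (q u v)"
    and nonneg: "u \<in> D \<Longrightarrow> 0 \<le> Re (q u u)"
begin

definition energy :: "'a L2 \<Rightarrow> real" where
  "energy u = sqrt (Re (q u u))"

lemma minus_mem [intro]: "u \<in> D \<Longrightarrow> - u \<in> D"
  using cscale_mem[of u "- 1"] by (simp add: cscale_minus_one)

lemma diff_mem [intro]: "u \<in> D \<Longrightarrow> v \<in> D \<Longrightarrow> u - v \<in> D"
  using add_mem[of u "- v"] by auto

lemma add_right: "u \<in> D \<Longrightarrow> v \<in> D \<Longrightarrow> w \<in> D \<Longrightarrow> q w (u + v) = q w u + q w v"
  by (simp add: hermitian[of _ w] add_left add_mem)

lemma cscale_right: "u \<in> D \<Longrightarrow> w \<in> D \<Longrightarrow> q w (cscale c u) = cnj c * q w u"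
  by (simp add: hermitian[of _ w] cscale_left cscale_mem)

lemma minus_left: "u \<in> D \<Longrightarrow> w \<in> D \<Longrightarrow> q (- u) w = - q u w"
  using cscale_left[of u w "- 1"] by (simp add: cscale_minus_one)

lemma minus_right: "u \<in> D \<Longrightarrow> w \<in> D \<Longrightarrow> q w (- u) = - q w u"
  using cscale_right[of u w "- 1"] by (simp add: cscale_minus_one)

lemma diff_left: "u \<in> D \<Longrightarrow> v \<in> D \<Longrightarrow> w \<in> D \<Longrightarrow> q (u - v) w = q u w - q v w"
  using add_left[of u "- v" w] by (simp add: minus_left minus_mem)

lemma diff_right: "u \<in> D \<Longrightarrow> v \<in> D \<Longrightarrow> w \<in> D \<Longrightarrow> q w (u - v) = q w u - q w v"
  using add_right[of u "- v" w] by (simp add: minus_right minus_mem)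

lemma self_eq_energy: "u \<in> D \<Longrightarrow> q u u = of_real ((energy u)\<^sup>2)"
  using arg_cong[OF hermitian[of u u], of Im] nonneg[of u]
  by (intro complex_eqI) (auto simp: energy_def)

lemma energy_nonneg: "u \<in> D \<Longrightarrow> 0 \<le> energy u"
  using nonneg by (simp add: energy_def)

lemma energy_cscale: 
  assumes "u \<in> D"
  shows "energy (cscale c u) = cmod c * energy u"
proof -
  have "q (cscale c u) (cscale c u) = of_real ((cmod c)\<^sup>2) * q u u"
    using assms by (simp add: cscale_left cscale_right cscale_mem complex_norm_square mult.assoc del: of_real_power)
  then show ?thesis
    by (simp add: energy_def real_sqrt_mult)
qed

lemma expand_square:
  assumes "u \<in> D" "v \<in> D"
  shows "(energy (u + cscale c v))\<^sup>2
    = (energy u)\<^sup>2 + 2 * Re (cnj c * q u v) + (cmod c)\<^sup>2 * (energy v)\<^sup>2"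
proof -
  have m: "cscale c v \<in> D" "u + cscale c v \<in> D" using assms by auto
  have "complex_of_real ((energy (u + cscale c v))\<^sup>2) = q (u + cscale c v) (u + cscale c v)"
    using m self_eq_energy by simp
  also have "\<dots> = q u u + (cnj c * q u v + cnj (cnj c * q u v)) + of_real ((cmod c)\<^sup>2) * q v v"
    using assms m
    by (simp add: add_left add_right cscale_left cscale_right hermitian[of u v] complex_norm_square
        distrib_left algebra_simps del: of_real_power)
  also have "\<dots> = of_real ((energy u)\<^sup>2 + 2 * Re (cnj c * q u v) + (cmod c)\<^sup>2 * (energy v)\<^sup>2)"
    using assms by (simp only: self_eq_energy complex_add_cnj of_real_add of_real_mult)
  finally show ?thesis by (simp only: of_real_eq_iff)
qed

lemma Cauchy_Schwarz:
  assumes "u \<in> D" "v \<in> D"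
  shows "cmod (q u v) \<le> energy u * energy v"
proof -
  let ?z = "q u v"
  \<comment> \<open>Expand the energy of \<open>u - t z v\<close>, with the phase of \<open>z = q u v\<close> making the cross term real.\<close>
  have *: "2 * t * (cmod ?z)\<^sup>2 \<le> (energy u)\<^sup>2 + t\<^sup>2 * (cmod ?z)\<^sup>2 * (energy v)\<^sup>2" for t
  proof -
    have "Re (cnj (- of_real t * ?z) * ?z) = - (t * (cmod ?z)\<^sup>2)"
      unfolding cmod_power2 by (simp add: power2_eq_square algebra_simps)
    then have "(energy (u + cscale (- of_real t * ?z) v))\<^sup>2
        = (energy u)\<^sup>2 + 2 * (- (t * (cmod ?z)\<^sup>2)) + t\<^sup>2 * (cmod ?z)\<^sup>2 * (energy v)\<^sup>2"
      unfolding expand_square[OF assms] by (simp add: norm_mult power_mult_distrib)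
    then show ?thesis
      using zero_le_power2[of "energy (u + cscale (- of_real t * ?z) v)"] by linarith
  qed
  have "(cmod ?z)\<^sup>2 \<le> (energy u)\<^sup>2 * (energy v)\<^sup>2"
    by (rule quadratic_bound) (rule *)
  then have "(cmod ?z)\<^sup>2 \<le> (energy u * energy v)\<^sup>2"
    by (simp only: power_mult_distrib)
  then show ?thesis
    by (rule power2_le_imp_le) (intro mult_nonneg_nonneg energy_nonneg assms)
qed

lemma energy_triangle:
  assumes "u \<in> D" "v \<in> D"
  shows "energy (u + v) \<le> energy u + energy v"
proof (rule power2_le_imp_le)
  have "(energy (u + v))\<^sup>2 = (energy u)\<^sup>2 + 2 * Re (q u v) + (energy v)\<^sup>2"
    using expand_square[OF assms, of 1] by (simp add: cscale_one)
  moreover have "Re (q u v) \<le> energy u * energy v"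
    using Cauchy_Schwarz[OF assms] complex_Re_le_cmod[of "q u v"] by linarith
  ultimately show "(energy (u + v))\<^sup>2 \<le> (energy u + energy v)\<^sup>2"
    by (simp add: power2_sum)
qed (use assms energy_nonneg in auto)

end

interpretation L2: positive_form UNIV cinner
  by unfold_locales
    (auto simp: cinner_add_left cinner_cscale_left cinner_self intro: cinner_commute)

lemma cinner_Cauchy_Schwarz: "cmod (cinner u v) \<le> norm u * norm v"
  using L2.Cauchy_Schwarz[of u v] by (simp add: L2.energy_def cinner_self)

lemma tendsto_cinner:
  fixes f g :: "'b \<Rightarrow> 'a::euclidean_space L2"
  assumes "(f \<longlongrightarrow> u) F" "(g \<longlongrightarrow> v) F"
  shows "((\<lambda>n. cinner (f n) (g n)) \<longlongrightarrow> cinner u v) F"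
proof -
  have "bounded_bilinear (cinner :: 'a L2 \<Rightarrow> 'a L2 \<Rightarrow> complex)"
  proof
    show "cinner u (r *\<^sub>R v) = r *\<^sub>R cinner u v" for u v :: "'a L2" and r
      using L2.cscale_right[of v u "of_real r"] by (simp add: cscale_of_real scaleR_conv_of_real)
    show "cinner (r *\<^sub>R u) v = r *\<^sub>R cinner u v" for u v :: "'a L2" and r
      using L2.cscale_left[of u v "of_real r"] by (simp add: cscale_of_real scaleR_conv_of_real)
    show "\<exists>K. \<forall>u v :: 'a L2. cmod (cinner u v) \<le> norm u * norm v * K"
      by (rule exI[of _ 1]) (simp add: cinner_Cauchy_Schwarz)
  qed (simp_all add: L2.add_left L2.add_right)
  from bounded_bilinear.tendsto[OF this assms] show ?thesis .
qed

lemma cinner_eq_zero_cancel: "(\<And>w. cinner u w = cinner v w) \<Longrightarrow> u = v"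
  using cinner_self[of "u - v"] L2.diff_left[of u v "u - v"] by simp


section \<open>Completeness of the space of square-integrable functions\<close>

lemma L2_cases:
  obtains f where "sq_integrable f" "u = abs_L2 f"
  using Quotient_rep_reflp[OF Quotient_L2, of u] Quotient_abs_rep[OF Quotient_L2, of u] by metis

lemma abs_L2_add: "sq_integrable f \<Longrightarrow> sq_integrable g \<Longrightarrow> abs_L2 f + abs_L2 g = abs_L2 (\<lambda>x. f x + g x)"
  by (rule plus_L2.abs_eq) auto

lemma cscale_abs_L2: "sq_integrable f \<Longrightarrow> cscale c (abs_L2 f) = abs_L2 (\<lambda>x. c * f x)"
  by (rule cscale.abs_eq) auto

lemma abs_L2_diff:
  assumes "sq_integrable f" "sq_integrable g"
  shows "abs_L2 f - abs_L2 g = abs_L2 (\<lambda>x. f x - g x)"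
proof -
  have "abs_L2 f - abs_L2 g = abs_L2 f + cscale (- 1) (abs_L2 g)"
    by (simp add: cscale_minus_one)
  also have "\<dots> = abs_L2 (\<lambda>x. f x + - 1 * g x)"
    by (simp only: assms cscale_abs_L2 abs_L2_add sq_integrable_cmult)
  finally show ?thesis by simp
qed

lemma sq_integrable_diff: "sq_integrable f \<Longrightarrow> sq_integrable g \<Longrightarrow> sq_integrable (\<lambda>x. f x - g x)"
  using sq_integrable_add[of f "\<lambda>x. - 1 * g x"] sq_integrable_cmult[of g "- 1"] by simp

lemma norm_abs_L2: "sq_integrable f \<Longrightarrow> (norm (abs_L2 f))\<^sup>2 = (\<integral>x. (cmod (f x))\<^sup>2 \<partial>lborel)"
  by (subst norm_L2.abs_eq) auto

lemma nn_integral_eq_norm_L2: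
  assumes "sq_integrable f"
  shows "(\<integral>\<^sup>+x. ennreal ((cmod (f x))\<^sup>2) \<partial>lborel) = ennreal ((norm (abs_L2 f))\<^sup>2)"
  using assms by (subst norm_abs_L2) (auto simp: sq_integrable_def nn_integral_eq_integral)

lemma sq_integrableI_nn:
  assumes [measurable]: "f \<in> borel_measurable lborel"
    and "(\<integral>\<^sup>+x. ennreal ((cmod (f x))\<^sup>2) \<partial>lborel) \<le> ennreal B"
  shows "sq_integrable f"
  unfolding sq_integrable_def
  using assms by (auto intro!: integrableI_bounded simp: le_less_trans[OF _ ennreal_less_top])

text \<open>The Riesz-Fischer argument. A subsequence with steps of norm at most \<open>2\<^sup>-\<^sup>k\<close> converges almost
  everywhere, and by Fatou its pointwise limit is also its limit in the mean.\<close>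

lemma L2_Cauchy_convergent:
  fixes X :: "nat \<Rightarrow> 'a::euclidean_space L2"
  assumes X: "Cauchy X"
  shows "convergent X"
proof -
  have "\<exists>N. \<forall>m\<ge>N. \<forall>n\<ge>N. dist (X m) (X n) < (1/2)^k" for k :: nat
    using X by (simp add: Cauchy_def)
  then obtain N where N: "dist (X m) (X n) < (1/2)^k" if "m \<ge> N k" "n \<ge> N k" for k :: nat and m n
    by metis
  define r where "r k = (\<Sum>i\<le>k. N i) + k" for k
  have r: "strict_mono r"
    by (auto simp: strict_mono_Suc_iff r_def)
  have rN: "N k \<le> r j" if "k \<le> j" for j k
  proof -
    have "N k \<le> (\<Sum>i\<le>j. N i)" using that by (intro member_le_sum) auto
    then show ?thesis by (simp add: r_def)
  qed
  have close: "norm (X (r j) - X (r k)) \<le> (1/2)^k" if "k \<le> j" for j k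
    using N[OF rN[OF that] rN[OF order_refl]] by (simp add: dist_norm)
  have "\<exists>f. sq_integrable f \<and> X (r k) = abs_L2 f" for k
    by (rule L2_cases[of "X (r k)"]) auto
  then obtain F where F: "sq_integrable (F k)" "X (r k) = abs_L2 (F k)" for k
    by metis
  have [measurable]: "F k \<in> borel_measurable borel" for k
    using F(1)[of k] by (simp add: sq_integrable_def)
  have int: "(\<integral>\<^sup>+x. ennreal ((cmod (F j x - F k x))\<^sup>2) \<partial>lborel) \<le> ennreal (((1/2)^k)\<^sup>2)"
    if "k \<le> j" for j k
  proof -
    have "(\<integral>\<^sup>+x. ennreal ((cmod (F j x - F k x))\<^sup>2) \<partial>lborel) = ennreal ((norm (X (r j) - X (r k)))\<^sup>2)"
      by (simp add: F abs_L2_diff nn_integral_eq_norm_L2 sq_integrable_diff)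
    also have "\<dots> \<le> ennreal (((1/2)^k)\<^sup>2)"
      using close[OF that] by (intro ennreal_leI power_mono) auto
    finally show ?thesis .
  qed
  define G where "G k x = F (Suc k) x - F k x" for k x
  \<comment> \<open>The weights \<open>2\<^sup>k\<close> leave the sum of the integrals finite, and by
    \<open>|G| \<le> 2\<^sup>k |G|\<^sup>2 + 2\<^sup>-\<^sup>k\<close> finiteness of the sum at a point forces absolute summability there.\<close>
  have "(\<integral>\<^sup>+x. (\<Sum>k. ennreal (2^k * (cmod (G k x))\<^sup>2)) \<partial>lborel)
      = (\<Sum>k. \<integral>\<^sup>+x. ennreal (2^k) * ennreal ((cmod (G k x))\<^sup>2) \<partial>lborel)"
    unfolding G_def by (subst nn_integral_suminf) (auto simp: ennreal_mult)
  also have "\<dots> \<le> (\<Sum>k. ennreal (2^k) * ennreal (((1/2)^k)\<^sup>2))"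
    unfolding G_def by (intro suminf_le, subst nn_integral_cmult) (auto intro!: mult_left_mono int)
  also have "\<dots> = (\<Sum>k. ennreal ((1/2)^k))"
    by (simp add: ennreal_mult[symmetric] power2_eq_square power_one_over)
  also have "\<dots> = ennreal (\<Sum>k. (1/2)^k)"
    by (rule suminf_ennreal2) auto
  finally have fin: "(\<integral>\<^sup>+x. (\<Sum>k. ennreal (2^k * (cmod (G k x))\<^sup>2)) \<partial>lborel) \<noteq> \<infinity>"
    by (auto simp: top_unique)
  have "AE x in lborel. (\<Sum>k. ennreal (2^k * (cmod (G k x))\<^sup>2)) \<noteq> \<infinity>"
    by (rule nn_integral_PInf_AE[OF _ fin]) (simp add: G_def)
  then have conv: "AE x in lborel. convergent (\<lambda>k. F k x)"
  proof (rule eventually_mono)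
    fix x assume "(\<Sum>k. ennreal (2^k * (cmod (G k x))\<^sup>2)) \<noteq> \<infinity>"
    then have s: "summable (\<lambda>k. 2^k * (cmod (G k x))\<^sup>2)"
      by (intro summable_suminf_not_top) auto
    have "summable (\<lambda>k. G k x)"
    proof (rule summable_comparison_test'[where N = 0])
      show "summable (\<lambda>k. 2^k * (cmod (G k x))\<^sup>2 + (1/2)^k)"
        using s by (intro summable_add) auto
      fix k :: nat
      define y where "y = cmod (G k x)"
      have "y \<le> 2^k * y\<^sup>2 + (1/2)^k"
      proof -
        have "0 \<le> (2^k * y - 1)\<^sup>2 + 2^k * y" by (simp add: y_def)
        then have "2^k * y \<le> 2^k * (2^k * y\<^sup>2 + (1/2)^k)"
          by (simp add: power2_eq_square algebra_simps power_one_over)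
        then show ?thesis by simp
      qed
      then show "norm (G k x) \<le> 2^k * (cmod (G k x))\<^sup>2 + (1/2)^k"
        by (simp add: y_def)
    qed
    then have "convergent (\<lambda>n. F 0 x + (\<Sum>k<n. G k x))"
      by (intro convergent_add convergent_const) (simp add: summable_iff_convergent)
    moreover have "F 0 x + (\<Sum>k<n. G k x) = F n x" for n
      unfolding G_def by (subst sum_lessThan_telescope) simp
    ultimately show "convergent (\<lambda>k. F k x)" by simp
  qed
  define f where "f x = lim (\<lambda>k. F k x)" for x
  have [measurable]: "f \<in> borel_measurable lborel"
    unfolding f_def[abs_def] by measurable
  have lim: "AE x in lborel. (\<lambda>k. F k x) \<longlonglongrightarrow> f x"
    using conv by (rule eventually_mono) (simp add: f_def convergent_LIMSEQ_iff)
  have bound: "(\<integral>\<^sup>+x. ennreal ((cmod (f x - F k x))\<^sup>2) \<partial>lborel) \<le> ennreal (((1/2)^k)\<^sup>2)" for k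
  proof -
    have "(\<integral>\<^sup>+x. ennreal ((cmod (f x - F k x))\<^sup>2) \<partial>lborel)
        = (\<integral>\<^sup>+x. liminf (\<lambda>j. ennreal ((cmod (F j x - F k x))\<^sup>2)) \<partial>lborel)"
    proof (rule nn_integral_cong_AE, use lim in \<open>rule eventually_mono\<close>)
      fix x assume "(\<lambda>j. F j x) \<longlonglongrightarrow> f x"
      then have "(\<lambda>j. ennreal ((cmod (F j x - F k x))\<^sup>2)) \<longlonglongrightarrow> ennreal ((cmod (f x - F k x))\<^sup>2)"
        by (intro tendsto_intros)
      then show "ennreal ((cmod (f x - F k x))\<^sup>2) = liminf (\<lambda>j. ennreal ((cmod (F j x - F k x))\<^sup>2))"
        using lim_imp_Liminf[OF sequentially_bot] by metis
    qed
    also have "\<dots> \<le> liminf (\<lambda>j. \<integral>\<^sup>+x. ennreal ((cmod (F j x - F k x))\<^sup>2) \<partial>lborel)"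
      by (rule nn_integral_liminf) simp
    also have "\<dots> \<le> limsup (\<lambda>j. \<integral>\<^sup>+x. ennreal ((cmod (F j x - F k x))\<^sup>2) \<partial>lborel)"
      by (rule Liminf_le_Limsup) simp
    also have "\<dots> \<le> ennreal (((1/2)^k)\<^sup>2)"
      by (rule Limsup_bounded) (auto simp: eventually_sequentially intro!: exI[of _ k] int)
    finally show ?thesis .
  qed
  have fF: "sq_integrable (\<lambda>x. f x - F k x)" for k
    by (rule sq_integrableI_nn[OF _ bound]) simp
  have f: "sq_integrable f"
    using sq_integrable_add[OF fF[of 0] F(1)[of 0]] by simp
  have "norm (abs_L2 f - X (r k)) \<le> (1/2)^k" for k
  proof (rule power2_le_imp_le)
    show "(norm (abs_L2 f - X (r k)))\<^sup>2 \<le> ((1/2)^k)\<^sup>2"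
      using bound[of k] f fF F by (simp add: abs_L2_diff nn_integral_eq_norm_L2)
  qed simp
  then have "(\<lambda>k. norm (X (r k) - abs_L2 f)) \<longlonglongrightarrow> 0"
    by (intro tendsto_sandwich[OF _ _ tendsto_const LIMSEQ_realpow_zero[of "1/2"]])
      (auto simp: norm_minus_commute)
  then have "(X \<circ> r) \<longlonglongrightarrow> abs_L2 f"
    by (simp add: o_def tendsto_norm_zero_iff LIM_zero_iff)
  then show ?thesis
    using LIMSEQ_subseq_LIMSEQ Cauchy_converges_subseq[OF X r] convergent_def by blast
qed

section \<open>Closing a form\<close>

context positive_form
begin

text \<open>For a positive form, convergence in the form sense is convergence in norm together with the
  Cauchy property for the energy seminorm; the latter is the version that interacts with the
  triangle inequality.\<close>

lemma form_converges_iff: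
  "form_converges D q f u \<longleftrightarrow> (\<forall>n. f n \<in> D) \<and> f \<longlonglongrightarrow> u \<and>
     (\<forall>e>0. \<exists>M. \<forall>m\<ge>M. \<forall>n\<ge>M. energy (f m - f n) < e)"
proof -
  have "(\<forall>e>0. \<exists>M. \<forall>m\<ge>M. \<forall>n\<ge>M. cmod (q (f m - f n) (f m - f n)) < e) \<longleftrightarrow>
      (\<forall>e>0. \<exists>M. \<forall>m\<ge>M. \<forall>n\<ge>M. energy (f m - f n) < e)" (is "?L \<longleftrightarrow> ?R") if f: "\<forall>n. f n \<in> D"
  proof -
    have eq: "cmod (q (f m - f n) (f m - f n)) = (energy (f m - f n))\<^sup>2" for m n
      using f by (subst self_eq_energy) (auto simp: norm_power)
    have pos: "0 \<le> energy (f m - f n)" for m n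
      using f by (intro energy_nonneg) auto
    show ?thesis
    proof
      assume L: ?L
      show ?R
      proof safe
        fix e :: real assume "e > 0"
        then obtain M where "\<forall>m\<ge>M. \<forall>n\<ge>M. (energy (f m - f n))\<^sup>2 < e\<^sup>2"
          using L[rule_format, of "e\<^sup>2"] by (auto simp: eq)
        then show "\<exists>M. \<forall>m\<ge>M. \<forall>n\<ge>M. energy (f m - f n) < e"
          using \<open>e > 0\<close> by (intro exI[of _ M]) (auto intro: power2_less_imp_less)
      qed
    next
      assume R: ?R
      show ?L
      proof safe
        fix e :: real assume "e > 0"
        then obtain M where "\<forall>m\<ge>M. \<forall>n\<ge>M. energy (f m - f n) < sqrt e"
          using R[rule_format, of "sqrt e"] by auto
        then have "\<forall>m\<ge>M. \<forall>n\<ge>M. (energy (f m - f n))\<^sup>2 < (sqrt e)\<^sup>2"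
          using pos by (auto intro!: power_strict_mono)
        then show "\<exists>M. \<forall>m\<ge>M. \<forall>n\<ge>M. cmod (q (f m - f n) (f m - f n)) < e"
          using \<open>e > 0\<close> by (auto simp: eq)
      qed
    qed
  qed
  then show ?thesis
    unfolding form_converges_def by (auto simp: image_subset_iff)
qed

lemma form_converges_mem: "form_converges D q f u \<Longrightarrow> f n \<in> D"
  by (simp add: form_converges_iff)

lemma form_converges_const: "u \<in> D \<Longrightarrow> form_converges D q (\<lambda>_. u) u"
  using self_eq_energy[of 0] cscale_left[of 0 0 0]
  by (simp add: form_converges_iff cscale_zero_left)

lemma form_converges_add:
  assumes "form_converges D q f u" "form_converges D q g v"
  shows "form_converges D q (\<lambda>n. f n + g n) (u + v)"
  unfolding form_converges_iff
proof (intro conjI allI impI)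
  show "f n + g n \<in> D" for n using assms form_converges_mem by blast
  show "(\<lambda>n. f n + g n) \<longlonglongrightarrow> u + v"
    using assms by (intro tendsto_add) (auto simp: form_converges_iff)
  fix e :: real assume e: "e > 0"
  obtain M M' where M: "\<And>m n. m \<ge> M \<Longrightarrow> n \<ge> M \<Longrightarrow> energy (f m - f n) < e / 2"
    and M': "\<And>m n. m \<ge> M' \<Longrightarrow> n \<ge> M' \<Longrightarrow> energy (g m - g n) < e / 2"
    using assms e unfolding form_converges_iff by (meson half_gt_zero)
  show "\<exists>M. \<forall>m\<ge>M. \<forall>n\<ge>M. energy (f m + g m - (f n + g n)) < e"
  proof (intro exI[of _ "max M M'"] allI impI)
    fix m n assume "m \<ge> max M M'" "n \<ge> max M M'"
    then have "energy (f m - f n) + energy (g m - g n) < e"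
      using M[of m n] M'[of m n] by simp
    moreover have "energy ((f m - f n) + (g m - g n)) \<le> energy (f m - f n) + energy (g m - g n)"
      using assms by (intro energy_triangle diff_mem form_converges_mem)
    ultimately show "energy (f m + g m - (f n + g n)) < e"
      by (simp add: algebra_simps)
  qed
qed

lemma form_converges_cscale:
  assumes "form_converges D q f u"
  shows "form_converges D q (\<lambda>n. cscale c (f n)) (cscale c u)"
  unfolding form_converges_iff
proof (intro conjI allI impI)
  have mem: "f n \<in> D" for n using assms form_converges_mem by blast
  then show "cscale c (f n) \<in> D" for n by blast
  show "(\<lambda>n. cscale c (f n)) \<longlonglongrightarrow> cscale c u"
    using assms by (intro bounded_linear.tendsto[OF bounded_linear_cscale]) (auto simp: form_converges_iff)
  fix e :: real assume e: "e > 0"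
  obtain M where M: "\<And>m n. m \<ge> M \<Longrightarrow> n \<ge> M \<Longrightarrow> energy (f m - f n) < e / (cmod c + 1)"
    using assms e unfolding form_converges_iff
    by (metis add_nonneg_pos norm_ge_zero zero_less_divide_iff zero_less_one)
  show "\<exists>M. \<forall>m\<ge>M. \<forall>n\<ge>M. energy (cscale c (f m) - cscale c (f n)) < e"
  proof (intro exI[of _ M] allI impI)
    fix m n assume mn: "m \<ge> M" "n \<ge> M"
    have "energy (cscale c (f m) - cscale c (f n)) = cmod c * energy (f m - f n)"
      using mem by (simp add: diff_mem energy_cscale
          flip: linear_diff[OF bounded_linear.linear[OF bounded_linear_cscale]])
    also have "\<dots> \<le> (cmod c + 1) * energy (f m - f n)"
      using mem by (intro mult_right_mono energy_nonneg) auto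
    also have "\<dots> < e"
      using M[OF mn] by (simp add: field_simps add_pos_nonneg)
    finally show "energy (cscale c (f m) - cscale c (f n)) < e" .
  qed
qed

lemma form_converges_diff:
  assumes "form_converges D q f u" "form_converges D q g v"
  shows "form_converges D q (\<lambda>n. f n - g n) (u - v)"
  using form_converges_add[OF assms(1) form_converges_cscale[OF assms(2), of "- 1"]]
  by (simp add: cscale_minus_one)

lemma energy_convergent:
  assumes f: "form_converges D q f u"
  shows "convergent (\<lambda>n. energy (f n))"
proof (rule Cauchy_convergent, rule metric_CauchyI)
  fix e :: real assume "e > 0"
  then obtain M where M: "\<And>m n. m \<ge> M \<Longrightarrow> n \<ge> M \<Longrightarrow> energy (f m - f n) < e"
    using f unfolding form_converges_iff by meson
  have mem: "f n \<in> D" for n using f form_converges_mem by blast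
  have le: "energy (f m) \<le> energy (f m - f n) + energy (f n)" for m n
    using energy_triangle[of "f m - f n" "f n"] mem by auto
  have "\<bar>energy (f m) - energy (f n)\<bar> < e" if "m \<ge> M" "n \<ge> M" for m n
    using M[OF that] M[OF that(2,1)] le[of m n] le[of n m] by linarith
  then show "\<exists>M. \<forall>m\<ge>M. \<forall>n\<ge>M. dist (energy (f m)) (energy (f n)) < e"
    by (auto simp: dist_real_def)
qed

text \<open>By polarisation this follows from the convergence of the energies of \<open>f n + c * g n\<close> for
  \<open>c = 1\<close> and \<open>c = \<i>\<close>.\<close>

lemma form_value_convergent:
  assumes f: "form_converges D q f u" and g: "form_converges D q g v"
  shows "convergent (\<lambda>n. q (f n) (g n))"
proof -
  have mem: "f n \<in> D" "g n \<in> D" for n using f g form_converges_mem by blast+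
  note en = energy_convergent[OF f] energy_convergent[OF g]
  have sq: "convergent (\<lambda>n. ((energy (f n + cscale c (g n)))\<^sup>2 - (energy (f n))\<^sup>2
      - (cmod c)\<^sup>2 * (energy (g n))\<^sup>2) * (1/2))" for c
    unfolding power2_eq_square
    by (intro convergent_diff convergent_mult convergent_const en
        energy_convergent[OF form_converges_add[OF f form_converges_cscale[OF g]]])
  have eq: "((energy (f n + cscale c (g n)))\<^sup>2 - (energy (f n))\<^sup>2
      - (cmod c)\<^sup>2 * (energy (g n))\<^sup>2) * (1/2) = Re (cnj c * q (f n) (g n))" for c n
    using expand_square[OF mem] by simp
  have "convergent (\<lambda>n. Re (q (f n) (g n)))" "convergent (\<lambda>n. Im (q (f n) (g n)))"
    using sq[of 1] sq[of \<i>] unfolding eq by simp_all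
  then obtain x y where "(\<lambda>n. Re (q (f n) (g n))) \<longlonglongrightarrow> x" "(\<lambda>n. Im (q (f n) (g n))) \<longlonglongrightarrow> y"
    by (auto simp: convergent_def)
  then have "(\<lambda>n. q (f n) (g n)) \<longlonglongrightarrow> Complex x y"
    by (simp add: tendsto_complex_iff)
  then show ?thesis by (auto simp: convergent_def)
qed

text \<open>The standard criterion for closability: forms of symmetric operators are closable. Here
  \<open>h\<close> is the image of \<open>u\<close> under the operator. In \<open>q (f n) (f n) = q (f n) (f n - f M) + q (f n) (f M)\<close>
  the first term is small by the Cauchy property, and the second is an inner product of \<open>f n\<close> with a
  fixed vector, so that it vanishes in the limit.\<close>

lemma operator_form_closable:
  assumes op: "\<And>u. u \<in> D \<Longrightarrow> \<exists>h. \<forall>v\<in>D. q v u = cinner v h"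
    and f: "form_converges D q f 0"
  shows "(\<lambda>n. energy (f n)) \<longlonglongrightarrow> 0"
proof -
  have mem: "f n \<in> D" for n using f form_converges_mem by blast
  obtain c where c: "(\<lambda>n. energy (f n)) \<longlonglongrightarrow> c"
    using energy_convergent[OF f] by (auto simp: convergent_def)
  have "0 \<le> c"
    by (rule LIMSEQ_le_const[OF c]) (use mem energy_nonneg in blast)
  have le: "c * c \<le> c * e" if "e > 0" for e
  proof -
    obtain M where M: "\<And>m n. m \<ge> M \<Longrightarrow> n \<ge> M \<Longrightarrow> energy (f m - f n) < e"
      using f \<open>e > 0\<close> unfolding form_converges_iff by meson
    obtain h where h: "\<And>v. v \<in> D \<Longrightarrow> q v (f M) = cinner v h"
      using op[OF mem[of M]] by blast
    have "energy (f n) * energy (f n) \<le> energy (f n) * e + cmod (cinner (f n) h)" if "n \<ge> M" for n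
    proof -
      have "energy (f n) * energy (f n) = cmod (q (f n) (f n))"
        by (subst self_eq_energy[OF mem]) (simp add: norm_mult power2_eq_square)
      also have "q (f n) (f n) = q (f n) (f n - f M) + cinner (f n) h"
        using mem by (simp add: diff_right h)
      also have "cmod \<dots> \<le> energy (f n) * energy (f n - f M) + cmod (cinner (f n) h)"
        by (intro order_trans[OF norm_triangle_ineq] add_right_mono Cauchy_Schwarz diff_mem mem)
      also have "\<dots> \<le> energy (f n) * e + cmod (cinner (f n) h)"
        using M[OF that order_refl] by (intro add_right_mono mult_left_mono energy_nonneg mem) simp
      finally show ?thesis .
    qed
    then have ev: "\<exists>N. \<forall>n\<ge>N. energy (f n) * energy (f n) \<le> energy (f n) * e + cmod (cinner (f n) h)"
      by blast
    have "(\<lambda>n. cinner (f n) h) \<longlonglongrightarrow> cinner 0 h"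
      using f by (intro tendsto_cinner tendsto_const) (simp add: form_converges_iff)
    then have "(\<lambda>n. cmod (cinner (f n) h)) \<longlonglongrightarrow> 0"
      using L2.cscale_left[of 0 h 0] by (simp add: cscale_zero_left tendsto_norm_zero)
    from tendsto_add[OF tendsto_mult[OF c tendsto_const[of e]] this]
    have "(\<lambda>n. energy (f n) * e + cmod (cinner (f n) h)) \<longlonglongrightarrow> c * e"
      by simp
    from LIMSEQ_le[OF tendsto_mult[OF c c] this ev] show ?thesis .
  qed
  have "c = 0"
    using le[of "c / 2"] \<open>0 \<le> c\<close> by (cases "c = 0") auto
  then show ?thesis using c by simp
qed

end

locale closable_form = positive_form +
  assumes closable: "form_converges D q f 0 \<Longrightarrow> (\<lambda>n. energy (f n)) \<longlonglongrightarrow> 0"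
begin

lemma form_value_null:
  assumes f: "form_converges D q f 0" and g: "form_converges D q g v"
  shows "(\<lambda>n. q (f n) (g n)) \<longlonglongrightarrow> 0"
proof (rule Lim_null_comparison)
  obtain c where "(\<lambda>n. energy (g n)) \<longlonglongrightarrow> c"
    using energy_convergent[OF g] by (auto simp: convergent_def)
  from tendsto_mult[OF closable[OF f] this]
  show "(\<lambda>n. energy (f n) * energy (g n)) \<longlonglongrightarrow> 0" by simp
  show "\<forall>\<^sub>F n in sequentially. cmod (q (f n) (g n)) \<le> energy (f n) * energy (g n)"
    using f g by (intro always_eventually allI Cauchy_Schwarz form_converges_mem)
qed

lemma form_value_unique:
  assumes f: "form_converges D q f u" "form_converges D q f' u"
    and g: "form_converges D q g v" "form_converges D q g' v"
    and c: "(\<lambda>n. q (f n) (g n)) \<longlonglongrightarrow> c"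
  shows "(\<lambda>n. q (f' n) (g' n)) \<longlonglongrightarrow> c"
proof -
  have mem: "f n \<in> D" "g n \<in> D" "f' n \<in> D" "g' n \<in> D" for n
    using f g form_converges_mem by blast+
  have 1: "(\<lambda>n. q (f' n - f n) (g n)) \<longlonglongrightarrow> 0"
    using form_converges_diff[OF f(2,1)] g by (intro form_value_null) auto
  have "(\<lambda>n. q (g' n - g n) (f' n)) \<longlonglongrightarrow> 0"
    using form_converges_diff[OF g(2,1)] f by (intro form_value_null) auto
  from tendsto_cnj[OF this] have 2: "(\<lambda>n. q (f' n) (g' n - g n)) \<longlonglongrightarrow> 0"
    using mem by (simp add: diff_mem flip: hermitian)
  from tendsto_add[OF tendsto_add[OF c 1] 2] show ?thesis
    using mem by (simp add: diff_left diff_right diff_mem)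
qed

abbreviation "D_closed \<equiv> closure_domain D q"
abbreviation "q_closed \<equiv> closure_form D q"

text \<open>Closability makes the limit independent of the approximating sequences, so that the definite
  description in \<open>closure_form\<close> denotes it.\<close>

lemma closure_form_limit:
  assumes f: "form_converges D q f u" and g: "form_converges D q g v"
  shows "(\<lambda>n. q (f n) (g n)) \<longlonglongrightarrow> q_closed u v"
proof -
  obtain c where c: "(\<lambda>n. q (f n) (g n)) \<longlonglongrightarrow> c"
    using form_value_convergent[OF f g] by (auto simp: convergent_def)
  have "q_closed u v = c"
    unfolding closure_form_def
  proof (rule the_equality)
    show "\<forall>f g. form_converges D q f u \<longrightarrow> form_converges D q g v \<longrightarrow> (\<lambda>n. q (f n) (g n)) \<longlonglongrightarrow> c"
      using form_value_unique[OF f _ g _ c] by blast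
    show "c' = c" if "\<forall>f g. form_converges D q f u \<longrightarrow> form_converges D q g v \<longrightarrow>
        (\<lambda>n. q (f n) (g n)) \<longlonglongrightarrow> c'" for c'
      using that f g c LIMSEQ_unique by blast
  qed
  then show ?thesis using c by simp
qed

lemma D_closed_cases:
  assumes "u \<in> D_closed"
  obtains f where "form_converges D q f u"
  using assms by (auto simp: closure_domain_def)

lemma D_closedI: "form_converges D q f u \<Longrightarrow> u \<in> D_closed"
  by (auto simp: closure_domain_def)

lemma subset_D_closed: "u \<in> D \<Longrightarrow> u \<in> D_closed"
  by (rule D_closedI[OF form_converges_const])

sublocale closed: positive_form D_closed q_closed
proof
  show "0 \<in> D_closed" by (simp add: subset_D_closed)
  show "u + v \<in> D_closed" if "u \<in> D_closed" "v \<in> D_closed" for u v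
    using that by (metis D_closed_cases D_closedI form_converges_add)
  show "cscale c u \<in> D_closed" if "u \<in> D_closed" for c u
    using that by (metis D_closed_cases D_closedI form_converges_cscale)
  show "q_closed (u + v) w = q_closed u w + q_closed v w"
    if u: "u \<in> D_closed" and v: "v \<in> D_closed" and w: "w \<in> D_closed" for u v w
  proof -
    obtain f g h where fgh: "form_converges D q f u" "form_converges D q g v" "form_converges D q h w"
      using u v w by (metis D_closed_cases)
    have "q (f n + g n) (h n) = q (f n) (h n) + q (g n) (h n)" for n
      using fgh by (intro add_left form_converges_mem)
    then show ?thesis
      using closure_form_limit[OF form_converges_add[OF fgh(1,2)] fgh(3)]
        tendsto_add[OF closure_form_limit[OF fgh(1,3)] closure_form_limit[OF fgh(2,3)]]
      by (simp add: LIMSEQ_unique)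
  qed
  show "q_closed (cscale c u) w = c * q_closed u w"
    if u: "u \<in> D_closed" and w: "w \<in> D_closed" for c u w
  proof -
    obtain f h where fh: "form_converges D q f u" "form_converges D q h w"
      using u w by (metis D_closed_cases)
    have "q (cscale c (f n)) (h n) = c * q (f n) (h n)" for n
      using fh by (intro cscale_left form_converges_mem)
    then show ?thesis
      using closure_form_limit[OF form_converges_cscale[OF fh(1), of c] fh(2)]
        tendsto_mult[OF tendsto_const[of c] closure_form_limit[OF fh]]
      by (simp add: LIMSEQ_unique)
  qed
  show "q_closed v u = cnj (q_closed u v)" if u: "u \<in> D_closed" and v: "v \<in> D_closed" for u v
  proof -
    obtain f g where fg: "form_converges D q f u" "form_converges D q g v"
      using u v by (metis D_closed_cases)
    have "q (g n) (f n) = cnj (q (f n) (g n))" for n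
      using fg by (intro hermitian form_converges_mem)
    then show ?thesis
      using closure_form_limit[OF fg(2,1)] tendsto_cnj[OF closure_form_limit[OF fg]]
      by (simp add: LIMSEQ_unique)
  qed
  show "0 \<le> Re (q_closed u u)" if u: "u \<in> D_closed" for u
  proof -
    obtain f where f: "form_converges D q f u"
      using u by (metis D_closed_cases)
    show ?thesis
      using tendsto_Re[OF closure_form_limit[OF f f]]
      by (rule LIMSEQ_le_const) (use f in \<open>auto intro: nonneg form_converges_mem\<close>)
  qed
qed

end

section \<open>The resolvent of the operator of a closable form\<close>

locale shifted_form = closable_form +
  fixes \<alpha> :: real
  assumes \<alpha>_pos: "0 < \<alpha>"
begin

sublocale sh: positive_form D "\<lambda>u v. q u v + of_real \<alpha> * cinner u v"
proof
  show "0 \<le> Re (q u u + of_real \<alpha> * cinner u u)" if "u \<in> D" for u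
    using nonneg[OF that] \<alpha>_pos by (simp add: cinner_self)
  show "q v u + of_real \<alpha> * cinner v u = cnj (q u v + of_real \<alpha> * cinner u v)"
    if "u \<in> D" "v \<in> D" for u v
    using that by (simp add: hermitian[of u v] cinner_commute[of v u])
qed (auto simp: add_left cscale_left cinner_add_left cinner_cscale_left algebra_simps)

lemma energy_shifted: "u \<in> D \<Longrightarrow> (sh.energy u)\<^sup>2 = (energy u)\<^sup>2 + \<alpha> * (norm u)\<^sup>2"
  using nonneg[of u] \<alpha>_pos by (simp add: sh.energy_def energy_def cinner_self)

lemma norm_le_energy:
  assumes "u \<in> D"
  shows "sqrt \<alpha> * norm u \<le> sh.energy u"
  by (rule power2_le_imp_le)
    (use assms \<alpha>_pos in \<open>auto simp: energy_shifted power_mult_distrib sh.energy_nonneg\<close>)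

lemma energy_le_shifted:
  assumes "u \<in> D"
  shows "energy u \<le> sh.energy u"
  by (rule power2_le_imp_le)
    (use assms \<alpha>_pos in \<open>auto simp: energy_shifted sh.energy_nonneg\<close>)

text \<open>Weak solutions of \<open>(H + \<alpha>) f = w\<close> within the original domain, up to an error that is measured
  in the norm dual to the shifted energy.\<close>

definition approx_solution :: "'a L2 \<Rightarrow> real \<Rightarrow> 'a L2 \<Rightarrow> bool" where
  "approx_solution w \<epsilon> f \<longleftrightarrow> f \<in> D \<and>
     (\<forall>g\<in>D. cmod (q f g + of_real \<alpha> * cinner f g - cinner w g) \<le> \<epsilon> * sh.energy g)"

text \<open>The functional \<open>J\<close> is bounded below, and its first variation at \<open>f\<close> in direction \<open>g\<close> is the
  residual of \<open>f\<close> against \<open>g\<close>. At a point within \<open>\<epsilon>\<^sup>2\<close> of the infimum the variation cannot exceed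
  \<open>\<epsilon>\<close> times the energy of \<open>g\<close>.\<close>

lemma approx_solution_exists:
  assumes "\<epsilon> > 0"
  obtains f where "approx_solution w \<epsilon> f"
proof -
  define J where "J f = (sh.energy f)\<^sup>2 - 2 * Re (cinner w f)" for f
  have below: "- ((norm w)\<^sup>2 / \<alpha>) \<le> J f" if "f \<in> D" for f
  proof -
    have "Re (cinner w f) \<le> norm w * norm f"
      using cinner_Cauchy_Schwarz[of w f] complex_Re_le_cmod[of "cinner w f"] by linarith
    moreover have "\<alpha> * (norm f)\<^sup>2 \<le> (sh.energy f)\<^sup>2"
      using that by (simp add: energy_shifted)
    moreover have "- ((norm w)\<^sup>2 / \<alpha>) \<le> \<alpha> * (norm f)\<^sup>2 - 2 * (norm w * norm f)"
    proof -
      have "0 \<le> (\<alpha> * norm f - norm w)\<^sup>2 / \<alpha>" using \<alpha>_pos by simp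
      also have "\<dots> = \<alpha> * (norm f)\<^sup>2 - 2 * (norm w * norm f) + (norm w)\<^sup>2 / \<alpha>"
        using \<alpha>_pos by (simp add: power2_eq_square field_simps)
      finally show ?thesis by linarith
    qed
    ultimately show ?thesis unfolding J_def by linarith
  qed
  then have bdd: "bdd_below (J ` D)" by (rule bdd_belowI2)
  have "Inf (J ` D) < Inf (J ` D) + \<epsilon>\<^sup>2" using assms by simp
  then obtain f where f: "f \<in> D" "J f < Inf (J ` D) + \<epsilon>\<^sup>2"
    using zero_mem by (subst (asm) cInf_less_iff[OF _ bdd]) auto
  have min: "J f \<le> J g + \<epsilon>\<^sup>2" if "g \<in> D" for g
    using cInf_lower[OF _ bdd, of "J g"] f(2) that by auto
  have "cmod (q f g + of_real \<alpha> * cinner f g - cinner w g) \<le> \<epsilon> * sh.energy g" if g: "g \<in> D" for g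
  proof -
    define r where "r = q f g + of_real \<alpha> * cinner f g - cinner w g"
    have "(cmod r)\<^sup>2 \<le> \<epsilon>\<^sup>2 * (sh.energy g)\<^sup>2"
    proof (rule quadratic_bound)
      fix t :: real
      let ?c = "- of_real t * r"
      have "J (f + cscale ?c g) = J f + 2 * Re (cnj ?c * r) + (cmod ?c)\<^sup>2 * (sh.energy g)\<^sup>2"
        unfolding J_def sh.expand_square[OF f(1) g] r_def
        by (simp add: L2.add_right L2.cscale_right algebra_simps)
      moreover have "Re (cnj ?c * r) = - (t * (cmod r)\<^sup>2)"
        unfolding cmod_power2 by (simp add: power2_eq_square algebra_simps)
      moreover have "(cmod ?c)\<^sup>2 = t\<^sup>2 * (cmod r)\<^sup>2"
        by (simp add: norm_mult power_mult_distrib)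
      moreover have "J f \<le> J (f + cscale ?c g) + \<epsilon>\<^sup>2"
        using f g by (intro min) auto
      ultimately show "2 * t * (cmod r)\<^sup>2 \<le> \<epsilon>\<^sup>2 + t\<^sup>2 * (cmod r)\<^sup>2 * (sh.energy g)\<^sup>2"
        by simp
    qed
    then have "(cmod r)\<^sup>2 \<le> (\<epsilon> * sh.energy g)\<^sup>2"
      by (simp only: power_mult_distrib)
    then show ?thesis
      unfolding r_def[symmetric]
      by (rule power2_le_imp_le) (use assms g sh.energy_nonneg in simp)
  qed
  then have "approx_solution w \<epsilon> f"
    using f by (simp add: approx_solution_def)
  then show thesis by (rule that)
qed

text \<open>Test the difference of the two residuals with \<open>f - f'\<close>.\<close>

lemma approx_solution_close:
  assumes f: "approx_solution w \<epsilon> f" and f': "approx_solution w \<epsilon>' f'" and pos: "0 \<le> \<epsilon> + \<epsilon>'"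
  shows "sh.energy (f - f') \<le> \<epsilon> + \<epsilon>'"
proof -
  let ?d = "f - f'"
  have mem: "f \<in> D" "f' \<in> D" "?d \<in> D"
    using f f' by (auto simp: approx_solution_def)
  define E where "E = sh.energy ?d"
  have "E\<^sup>2 = cmod (q ?d ?d + of_real \<alpha> * cinner ?d ?d)"
    unfolding E_def by (subst sh.self_eq_energy[OF mem(3)]) (simp add: norm_power)
  also have "q ?d ?d + of_real \<alpha> * cinner ?d ?d
      = (q f ?d + of_real \<alpha> * cinner f ?d - cinner w ?d)
        - (q f' ?d + of_real \<alpha> * cinner f' ?d - cinner w ?d)"
    using mem by (subst sh.diff_left) auto
  also have "cmod \<dots> \<le> \<epsilon> * E + \<epsilon>' * E"
    unfolding E_def
    using f f' mem(3) by (intro order_trans[OF norm_triangle_ineq4 add_mono]) (auto simp: approx_solution_def)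
  finally have "E * E \<le> (\<epsilon> + \<epsilon>') * E"
    by (simp add: power2_eq_square algebra_simps)
  moreover have "0 \<le> E" unfolding E_def by (rule sh.energy_nonneg[OF mem(3)])
  ultimately have "E \<le> \<epsilon> + \<epsilon>'"
    using pos by (cases "E = 0") auto
  then show ?thesis by (simp add: E_def)
qed

text \<open>On vectors of small energy the operator is negligible against \<open>\<alpha>\<close>, and the resolvent is close
  to multiplication by \<open>1/\<alpha>\<close>.\<close>

lemma approx_solution_rescaled:
  assumes "u \<in> D"
  shows "approx_solution u (energy u / \<alpha>) (cscale (of_real (1 / \<alpha>)) u)"
  unfolding approx_solution_def
proof (intro conjI ballI cscale_mem assms)
  fix g assume g: "g \<in> D"
  have "q (cscale (of_real (1 / \<alpha>)) u) g + of_real \<alpha> * cinner (cscale (of_real (1 / \<alpha>)) u) g - cinner u g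
      = of_real (1 / \<alpha>) * q u g"
    using assms g \<alpha>_pos by (simp add: cscale_left L2.cscale_left)
  also have "cmod \<dots> \<le> 1 / \<alpha> * (energy u * sh.energy g)"
    unfolding norm_mult norm_of_real
    using \<alpha>_pos Cauchy_Schwarz[OF assms g] mult_left_mono[OF energy_le_shifted[OF g] energy_nonneg[OF assms]]
    by (intro mult_mono) auto
  finally show "cmod (q (cscale (of_real (1 / \<alpha>)) u) g + of_real \<alpha> * cinner (cscale (of_real (1 / \<alpha>)) u) g
      - cinner u g) \<le> energy u / \<alpha> * sh.energy g"
    by simp
qed

lemma approx_solution_energy:
  assumes f: "approx_solution w \<epsilon> f" and "0 \<le> \<epsilon>"
  shows "sh.energy f \<le> norm w / sqrt \<alpha> + \<epsilon>"
proof -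
  have mem: "f \<in> D" using f by (simp add: approx_solution_def)
  define E where "E = sh.energy f"
  have "E\<^sup>2 = cmod (q f f + of_real \<alpha> * cinner f f)"
    unfolding E_def by (subst sh.self_eq_energy[OF mem]) (simp add: norm_power)
  also have "q f f + of_real \<alpha> * cinner f f
      = (q f f + of_real \<alpha> * cinner f f - cinner w f) + cinner w f"
    by simp
  also have "cmod \<dots> \<le> \<epsilon> * E + norm w * norm f"
    unfolding E_def
    using f mem by (intro order_trans[OF norm_triangle_ineq add_mono[OF _ cinner_Cauchy_Schwarz]])
      (auto simp: approx_solution_def)
  also have "norm w * norm f \<le> norm w * (E / sqrt \<alpha>)"
    unfolding E_def using norm_le_energy[OF mem] \<alpha>_pos
    by (intro mult_left_mono) (auto simp: pos_le_divide_eq mult.commute)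
  finally have "E * E \<le> (norm w / sqrt \<alpha> + \<epsilon>) * E"
    by (simp add: power2_eq_square algebra_simps)
  moreover have "0 \<le> E" unfolding E_def by (rule sh.energy_nonneg[OF mem])
  moreover have "0 \<le> norm w / sqrt \<alpha> + \<epsilon>" using assms \<alpha>_pos by simp
  ultimately have "E \<le> norm w / sqrt \<alpha> + \<epsilon>"
    by (cases "E = 0") auto
  then show ?thesis by (simp add: E_def)
qed

text \<open>The exact weak formulation, in terms of the closed form.\<close>

definition solves :: "'a L2 \<Rightarrow> 'a L2 \<Rightarrow> bool" where
  "solves w u \<longleftrightarrow> u \<in> D_closed \<and> (\<forall>v\<in>D_closed. q_closed u v + of_real \<alpha> * cinner u v = cinner w v)"

lemma solves_unique:
  assumes "solves w u" "solves w u'"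
  shows "u = u'"
proof -
  have mem: "u \<in> D_closed" "u' \<in> D_closed" "u - u' \<in> D_closed"
    using assms by (auto simp: solves_def)
  have "q_closed u (u - u') + of_real \<alpha> * cinner u (u - u')
      = q_closed u' (u - u') + of_real \<alpha> * cinner u' (u - u')"
    using assms mem by (simp add: solves_def)
  then have "q_closed (u - u') (u - u') + of_real \<alpha> * cinner (u - u') (u - u') = 0"
    using mem by (simp add: closed.diff_left L2.diff_left algebra_simps)
  then have "Re (q_closed (u - u') (u - u')) + \<alpha> * (norm (u - u'))\<^sup>2 = 0"
    by (simp add: cinner_self complex_eq_iff)
  then have "\<alpha> * (norm (u - u'))\<^sup>2 \<le> 0"
    using closed.nonneg[OF mem(3)] by linarith
  then show ?thesis
    using \<alpha>_pos by (simp add: mult_le_0_iff)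
qed

text \<open>Approximate solutions with errors \<open>\<delta> n \<longlonglongrightarrow> 0\<close> form a Cauchy sequence in the energy norm, hence
  converge in the form sense; the residual bound passes to the limit. The second assertion compares
  an arbitrary approximate solution with this sequence.\<close>

lemma solution_exists:
  obtains u where "solves w u"
    "\<And>f \<epsilon>. 0 \<le> \<epsilon> \<Longrightarrow> approx_solution w \<epsilon> f \<Longrightarrow> sqrt \<alpha> * norm (u - f) \<le> \<epsilon>"
proof -
  define \<delta> where "\<delta> n = 1 / real (Suc n)" for n
  have \<delta>: "\<delta> n > 0" for n by (simp add: \<delta>_def)
  have \<delta>0: "\<delta> \<longlonglongrightarrow> 0"
    unfolding \<delta>_def[abs_def] by (rule LIMSEQ_inverse_real_of_nat[unfolded inverse_eq_divide])
  have "\<exists>f. approx_solution w (\<delta> n) f" for n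
    using approx_solution_exists[OF \<delta>[of n]] by metis
  then obtain F where F: "approx_solution w (\<delta> n) (F n)" for n
    by metis
  have FD: "F n \<in> D" for n using F[of n] by (simp add: approx_solution_def)
  have small: "\<exists>M. \<forall>m\<ge>M. \<forall>n\<ge>M. sh.energy (F m - F n) < e" if e: "e > 0" for e
  proof -
    have "0 < e / 2" using e by simp
    then obtain M where M: "\<And>n. n \<ge> M \<Longrightarrow> \<delta> n < e / 2"
      using order_tendstoD(2)[OF \<delta>0] unfolding eventually_sequentially by blast
    have "sh.energy (F m - F n) < e" if "m \<ge> M" "n \<ge> M" for m n
    proof -
      have "sh.energy (F m - F n) \<le> \<delta> m + \<delta> n"
        using \<delta>[of m] \<delta>[of n] by (intro approx_solution_close[OF F F]) simp
      then show ?thesis using M[OF that(1)] M[OF that(2)] by linarith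
    qed
    then show ?thesis by blast
  qed
  have "Cauchy F"
  proof (rule metric_CauchyI)
    fix e :: real assume "e > 0"
    then obtain M where M: "\<And>m n. m \<ge> M \<Longrightarrow> n \<ge> M \<Longrightarrow> sh.energy (F m - F n) < sqrt \<alpha> * e"
      using small[of "sqrt \<alpha> * e"] \<alpha>_pos by auto
    have "norm (F m - F n) < e" if "m \<ge> M" "n \<ge> M" for m n
    proof -
      have "sqrt \<alpha> * norm (F m - F n) < sqrt \<alpha> * e"
        using M[OF that] FD by (intro le_less_trans[OF norm_le_energy]) auto
      then show ?thesis using \<alpha>_pos by simp
    qed
    then show "\<exists>M. \<forall>m\<ge>M. \<forall>n\<ge>M. dist (F m) (F n) < e"
      by (auto simp: dist_norm)
  qed
  then obtain u where u: "F \<longlonglongrightarrow> u"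
    using L2_Cauchy_convergent by (auto simp: convergent_def)
  have Fu: "form_converges D q F u"
    unfolding form_converges_iff
  proof (intro conjI allI impI FD u)
    fix e :: real assume "e > 0"
    then obtain M where M: "\<And>m n. m \<ge> M \<Longrightarrow> n \<ge> M \<Longrightarrow> sh.energy (F m - F n) < e"
      using small by meson
    have "energy (F m - F n) < e" if "m \<ge> M" "n \<ge> M" for m n
      using M[OF that] FD by (intro le_less_trans[OF energy_le_shifted]) auto
    then show "\<exists>M. \<forall>m\<ge>M. \<forall>n\<ge>M. energy (F m - F n) < e" by blast
  qed
  have "solves w u"
    unfolding solves_def
  proof (intro conjI ballI)
    show "u \<in> D_closed" by (rule D_closedI[OF Fu])
    fix v assume "v \<in> D_closed"
    then obtain g where g: "form_converges D q g v" by (rule D_closed_cases)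
    have gD: "g n \<in> D" and gv: "g \<longlonglongrightarrow> v" for n using g by (auto simp: form_converges_iff)
    have lim: "(\<lambda>n. q (F n) (g n) + of_real \<alpha> * cinner (F n) (g n) - cinner w (g n))
        \<longlonglongrightarrow> q_closed u v + of_real \<alpha> * cinner u v - cinner w v"
      by (intro tendsto_intros closure_form_limit Fu g tendsto_cinner u gv)
    have "convergent (\<lambda>n. sqrt ((energy (g n))\<^sup>2 + \<alpha> * (norm (g n))\<^sup>2))"
    proof -
      obtain c where "(\<lambda>n. energy (g n)) \<longlonglongrightarrow> c"
        using energy_convergent[OF g] by (auto simp: convergent_def)
      then have "(\<lambda>n. sqrt ((energy (g n))\<^sup>2 + \<alpha> * (norm (g n))\<^sup>2)) \<longlonglongrightarrow> sqrt (c\<^sup>2 + \<alpha> * (norm v)\<^sup>2)"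
        by (intro tendsto_intros gv)
      then show ?thesis by (auto simp: convergent_def)
    qed
    moreover have "sqrt ((energy (g n))\<^sup>2 + \<alpha> * (norm (g n))\<^sup>2) = sh.energy (g n)" for n
      using gD sh.energy_nonneg[OF gD] by (simp flip: energy_shifted)
    ultimately obtain c where "(\<lambda>n. sh.energy (g n)) \<longlonglongrightarrow> c"
      by (auto simp: convergent_def)
    from tendsto_mult[OF \<delta>0 this] have "(\<lambda>n. \<delta> n * sh.energy (g n)) \<longlonglongrightarrow> 0"
      by simp
    then have "(\<lambda>n. q (F n) (g n) + of_real \<alpha> * cinner (F n) (g n) - cinner w (g n)) \<longlonglongrightarrow> 0"
      by (rule Lim_null_comparison[rotated])
        (use F gD in \<open>auto simp: approx_solution_def intro!: always_eventually\<close>)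
    from LIMSEQ_unique[OF lim this] show "q_closed u v + of_real \<alpha> * cinner u v = cinner w v"
      by simp
  qed
  moreover have "sqrt \<alpha> * norm (u - f) \<le> \<epsilon>" if "0 \<le> \<epsilon>" and f: "approx_solution w \<epsilon> f" for f \<epsilon>
  proof (rule LIMSEQ_le)
    show "(\<lambda>n. sqrt \<alpha> * norm (F n - f)) \<longlonglongrightarrow> sqrt \<alpha> * norm (u - f)"
      by (intro tendsto_intros u)
    show "(\<lambda>n. \<delta> n + \<epsilon>) \<longlonglongrightarrow> \<epsilon>"
      using tendsto_add[OF \<delta>0 tendsto_const[of \<epsilon>]] by simp
    have "sqrt \<alpha> * norm (F n - f) \<le> \<delta> n + \<epsilon>" for n
    proof (rule order_trans[OF norm_le_energy])
      show "F n - f \<in> D" using FD f by (auto simp: approx_solution_def)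
      show "sh.energy (F n - f) \<le> \<delta> n + \<epsilon>"
        using \<delta>[of n] that by (intro approx_solution_close[OF F f]) simp
    qed
    then show "\<exists>N. \<forall>n\<ge>N. sqrt \<alpha> * norm (F n - f) \<le> \<delta> n + \<epsilon>" by blast
  qed
  ultimately show thesis by (rule that)
qed

definition resolvent :: "'a L2 \<Rightarrow> 'a L2" where
  "resolvent w = (THE u. solves w u)"

lemma solves_iff: "solves w u \<longleftrightarrow> u = resolvent w"
proof -
  obtain u0 where "solves w u0" by (rule solution_exists)
  then have "solves w (resolvent w)"
    unfolding resolvent_def by (rule theI) (rule solves_unique[OF _ \<open>solves w u0\<close>])
  then show ?thesis using solves_unique by blast
qed

lemma resolvent_mem: "resolvent w \<in> D_closed"
  and resolvent_eq: "v \<in> D_closed \<Longrightarrow>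
    q_closed (resolvent w) v + of_real \<alpha> * cinner (resolvent w) v = cinner w v"
  using solves_iff[of w "resolvent w"] by (auto simp: solves_def)

text \<open>This is how the resolvent is estimated later on: find a good approximate solution among the
  elements of the original domain.\<close>

lemma resolvent_approx:
  assumes "0 \<le> \<epsilon>" "approx_solution w \<epsilon> f"
  shows "sqrt \<alpha> * norm (resolvent w - f) \<le> \<epsilon>"
  using solution_exists[of w] assms solves_iff by metis

lemma resolvent_add: "resolvent (w + w') = resolvent w + resolvent w'"
proof -
  have "solves (w + w') (resolvent w + resolvent w')"
    unfolding solves_def
    using resolvent_mem[of w] resolvent_mem[of w'] resolvent_eq[of _ w] resolvent_eq[of _ w']
    by (auto simp: closed.add_left L2.add_left algebra_simps)
  then show ?thesis by (simp add: solves_iff)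
qed

lemma resolvent_cscale: "resolvent (cscale c w) = cscale c (resolvent w)"
proof -
  have "solves (cscale c w) (cscale c (resolvent w))"
    unfolding solves_def
  proof (intro conjI ballI)
    show "cscale c (resolvent w) \<in> D_closed" using resolvent_mem by blast
    fix v assume v: "v \<in> D_closed"
    then have "c * (q_closed (resolvent w) v + of_real \<alpha> * cinner (resolvent w) v) = c * cinner w v"
      by (simp only: resolvent_eq)
    then show "q_closed (cscale c (resolvent w)) v + of_real \<alpha> * cinner (cscale c (resolvent w)) v
        = cinner (cscale c w) v"
      using v by (simp add: closed.cscale_left resolvent_mem L2.cscale_left distrib_left mult.left_commute)
  qed
  then show ?thesis by (simp add: solves_iff)
qed

lemma norm_resolvent_le: "norm (resolvent w) \<le> norm w / \<alpha>"
proof -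
  let ?u = "resolvent w"
  have "\<alpha> * (norm ?u)\<^sup>2 \<le> Re (q_closed ?u ?u + of_real \<alpha> * cinner ?u ?u)"
    using closed.nonneg[OF resolvent_mem[of w]] by (simp add: cinner_self)
  also have "\<dots> = Re (cinner w ?u)"
    by (simp only: resolvent_eq[OF resolvent_mem])
  also have "\<dots> \<le> norm w * norm ?u"
    using cinner_Cauchy_Schwarz[of w ?u] complex_Re_le_cmod[of "cinner w ?u"] by linarith
  finally have "(\<alpha> * norm ?u) * norm ?u \<le> norm w * norm ?u"
    by (simp add: power2_eq_square mult.assoc)
  then have "\<alpha> * norm ?u \<le> norm w"
    by (cases "norm ?u = 0") auto
  then show ?thesis
    using \<alpha>_pos by (simp add: pos_le_divide_eq mult.commute)
qed

lemma bounded_op_resolvent: "bounded_op resolvent"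
  unfolding bounded_op_def
proof (intro conjI allI resolvent_cscale)
  show "bounded_linear resolvent"
  proof (rule bounded_linear_intro[where K = "1 / \<alpha>"])
    show "resolvent (r *\<^sub>R w) = r *\<^sub>R resolvent w" for r w
      by (simp add: resolvent_cscale flip: cscale_of_real)
  qed (use norm_resolvent_le resolvent_add in simp_all)
qed

lemma resolvent_symmetric: "cinner (resolvent w) w' = cinner w (resolvent w')"
proof -
  let ?u = "resolvent w" and ?v = "resolvent w'"
  have "cinner ?u w' = cnj (cinner w' ?u)" by (rule cinner_commute)
  also have "\<dots> = cnj (q_closed ?v ?u + of_real \<alpha> * cinner ?v ?u)"
    by (simp only: resolvent_eq resolvent_mem)
  also have "\<dots> = q_closed ?u ?v + of_real \<alpha> * cinner ?u ?v"
    by (simp add: closed.hermitian[OF resolvent_mem resolvent_mem, of w w'] cinner_commute[of ?v ?u])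
  also have "\<dots> = cinner w ?v"
    by (simp only: resolvent_eq resolvent_mem)
  finally show ?thesis .
qed

lemma is_bounded_inverse_resolvent:
  "is_bounded_inverse (plus_scalar (form_operator D_closed q_closed) (of_real \<alpha>)) resolvent"
proof -
  have "(u, w) \<in> plus_scalar (form_operator D_closed q_closed) (of_real \<alpha>) \<longleftrightarrow> u = resolvent w" for u w
  proof -
    have "(u, w) \<in> plus_scalar (form_operator D_closed q_closed) (of_real \<alpha>) \<longleftrightarrow>
        (u, w - cscale (of_real \<alpha>) u) \<in> form_operator D_closed q_closed"
      unfolding plus_scalar_def by (auto simp: algebra_simps intro!: exI[of _ "w - cscale (of_real \<alpha>) u"])
    also have "\<dots> \<longleftrightarrow> solves w u"
      unfolding form_operator_def solves_def
      by (auto simp: L2.diff_left L2.cscale_left algebra_simps)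
    finally show ?thesis by (simp add: solves_iff)
  qed
  then have "(plus_scalar (form_operator D_closed q_closed) (of_real \<alpha>))\<inverse> = {(w, resolvent w) |w. True}"
    by auto
  then show ?thesis
    by (simp add: is_bounded_inverse_def bounded_op_resolvent)
qed

end

lemma bounded_inverse_eq:
  assumes "is_bounded_inverse T R"
  shows "bounded_inverse T = R"
  unfolding bounded_inverse_def
proof (rule the_equality)
  fix S assume "is_bounded_inverse T S"
  then have "{(w, S w) |w. True} = {(w, R w) |w. True}"
    using assms by (simp add: is_bounded_inverse_def)
  then show "S = R"
    by (auto simp: set_eq_iff fun_eq_iff)
qed (rule assms)

section \<open>Smooth functions of compact support\<close>

lemma differentiable_imp_continuous_on_UNIV:
  "(\<And>x. f differentiable (at x)) \<Longrightarrow> continuous_on UNIV f"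
  by (simp add: continuous_on_eq_continuous_at differentiable_imp_continuous_within)

lemma partial_eq_derivative: "(f has_derivative f') (at x) \<Longrightarrow> partial b f x = f' b"
  unfolding partial_def by (metis frechet_derivative_at)

lemma C_k_Suc_imp: "C_k (Suc n) f \<Longrightarrow> C_k n f"
proof (induction n arbitrary: f)
  case 0
  then show ?case by (auto intro: differentiable_imp_continuous_on_UNIV)
qed auto

lemma C_k_const: "C_k n (\<lambda>x. c)"
proof (induction n arbitrary: c)
  case (Suc n)
  have "partial b (\<lambda>x. c) = (\<lambda>x. 0)" for b :: 'a
    by (rule ext, rule partial_eq_derivative[where f' = "\<lambda>_. 0"]) simp
  then show ?case using Suc.IH by simp
qed simp

lemma C_k_bounded_linear: "bounded_linear L \<Longrightarrow> C_k n f \<Longrightarrow> C_k n (\<lambda>x. L (f x))"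
proof (induction n arbitrary: f)
  case 0
  then show ?case by (simp add: bounded_linear.continuous_on)
next
  case (Suc n)
  then have "partial b (\<lambda>x. L (f x)) = (\<lambda>x. L (partial b f x))" for b
    by (intro ext partial_bounded_linear(1)) auto
  then show ?case
    using Suc by (auto intro: partial_bounded_linear(2))
qed

lemma partial_add:
  assumes "f differentiable (at x)" "g differentiable (at x)"
  shows "partial b (\<lambda>y. f y + g y) x = partial b f x + partial b g x"
proof -
  have "((\<lambda>y. f y + g y) has_derivative
      (\<lambda>h. frechet_derivative f (at x) h + frechet_derivative g (at x) h)) (at x)"
    using assms by (intro has_derivative_add) (simp_all add: frechet_derivative_works)
  from partial_eq_derivative[OF this] show ?thesis
    by (simp add: partial_def)
qed

lemma C_k_add: "C_k n f \<Longrightarrow> C_k n g \<Longrightarrow> C_k n (\<lambda>x. f x + g x)"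
proof (induction n arbitrary: f g)
  case (Suc n)
  then have "partial b (\<lambda>x. f x + g x) = (\<lambda>x. partial b f x + partial b g x)" for b
    by (intro ext partial_add) auto
  then show ?case
    using Suc by (auto intro: differentiable_add)
qed (simp add: continuous_on_add)

lemma C_k_mult:
  fixes f g :: "'a::euclidean_space \<Rightarrow> complex"
  shows "C_k n f \<Longrightarrow> C_k n g \<Longrightarrow> C_k n (\<lambda>x. f x * g x)"
proof (induction n arbitrary: f g)
  case (Suc n)
  then have "partial b (\<lambda>x. f x * g x) = (\<lambda>x. f x * partial b g x + partial b f x * g x)" for b
    by (intro ext partial_mult) auto
  then show ?case
    using Suc C_k_Suc_imp[OF Suc.prems(1)] C_k_Suc_imp[OF Suc.prems(2)]
    by (auto intro!: C_k_add differentiable_mult)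
qed (simp add: continuous_on_mult)

lemma partial_shift:
  assumes "\<And>x. f differentiable (at x)"
  shows "partial b (\<lambda>x. f (x + p)) = (\<lambda>x. partial b f (x + p))"
    and "(\<lambda>x. f (x + p)) differentiable (at x)"
proof -
  have "((\<lambda>x. f (x + p)) has_derivative frechet_derivative f (at (x + p))) (at x)" for x
  proof -
    have "((\<lambda>x. x + p) has_derivative (\<lambda>h. h)) (at x)"
      by (auto intro!: derivative_eq_intros)
    moreover have "(f has_derivative frechet_derivative f (at (x + p))) (at (x + p))"
      using assms by (simp flip: frechet_derivative_works)
    ultimately show ?thesis
      by (rule has_derivative_compose)
  qed
  then show "partial b (\<lambda>x. f (x + p)) = (\<lambda>x. partial b f (x + p))"
    "(\<lambda>x. f (x + p)) differentiable (at x)"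
    by (auto simp: partial_def[of b f] intro!: ext partial_eq_derivative differentiableI)
qed

lemma C_k_shift: "C_k n f \<Longrightarrow> C_k n (\<lambda>x. f (x + p))"
proof (induction n arbitrary: f)
  case 0
  then show ?case
    using continuous_on_compose2[of UNIV f UNIV "\<lambda>x. x + p"] by (simp add: continuous_on_add)
next
  case (Suc n)
  then show ?case by (auto simp: partial_shift)
qed

text \<open>Composition with a one-dimensional function that comes with the sequence \<open>\<psi>\<close> of its derivatives.
  Treating all members of the sequence simultaneously is what makes the induction on the order of
  differentiability work.\<close>

lemma C_k_compose:
  fixes \<psi> :: "nat \<Rightarrow> real \<Rightarrow> complex" and h :: "'a::euclidean_space \<Rightarrow> real"
  assumes der: "\<And>n t. (\<psi> n has_vector_derivative \<psi> (Suc n) t) (at t)" and h: "\<And>m. C_k m h"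
  shows "C_k m (\<lambda>x. \<psi> n (h x))"
proof (induction m arbitrary: n)
  case 0
  have "continuous_on UNIV (\<psi> n)"
    using der by (auto simp: continuous_on_eq_continuous_at intro: has_vector_derivative_continuous)
  then show ?case
    using h[of 0] continuous_on_compose2[of UNIV "\<psi> n" UNIV h] by simp
next
  case (Suc m)
  have hd: "h differentiable (at x)" for x using h[of 1] by simp
  have d: "((\<lambda>x. \<psi> n (h x)) has_derivative
      (\<lambda>y. frechet_derivative h (at x) y *\<^sub>R \<psi> (Suc n) (h x))) (at x)" for x
    using has_derivative_compose[OF hd[unfolded frechet_derivative_works, of x]
        der[unfolded has_vector_derivative_def]] .
  have "partial b (\<lambda>x. \<psi> n (h x)) = (\<lambda>x. of_real (partial b h x) * \<psi> (Suc n) (h x))" for b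
    using partial_eq_derivative[OF d] by (auto simp: partial_def scaleR_conv_of_real)
  moreover have "C_k m (\<lambda>x. complex_of_real (partial b h x))" if "b \<in> Basis" for b
    using h[of "Suc m"] that by (intro C_k_bounded_linear[OF bounded_linear_of_real]) auto
  ultimately show ?case
    using Suc.IH d by (auto intro!: C_k_mult differentiableI)
qed

lemma C_k_linear:
  assumes L: "bounded_linear L"
  shows "C_k m L"
proof (cases m)
  case 0
  then show ?thesis using L by (simp add: linear_continuous_on)
next
  case (Suc n)
  have "(L has_derivative L) (at x)" for x
    using L by (rule bounded_linear_imp_has_derivative)
  moreover from this have "partial b L = (\<lambda>x. L b)" for b
    by (intro ext partial_eq_derivative)
  ultimately show ?thesis
    by (auto simp: Suc C_k_const intro: differentiableI)
qed

lemma C_k_one_minus_norm_square: "C_k m (\<lambda>x::'a::euclidean_space. 1 - x \<bullet> x)"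
proof (cases m)
  case 0
  then show ?thesis by (auto intro!: continuous_intros)
next
  case (Suc n)
  have d: "((\<lambda>x::'a. 1 - x \<bullet> x) has_derivative (\<lambda>y. - 2 * (x \<bullet> y))) (at x)" for x
    by (auto intro!: derivative_eq_intros simp: inner_commute)
  have "partial b (\<lambda>x::'a. 1 - x \<bullet> x) = (\<lambda>x. - 2 * (x \<bullet> b))" for b
    using partial_eq_derivative[OF d] by auto
  moreover have "C_k n (\<lambda>x::'a. - 2 * (x \<bullet> b))" for b
    by (intro C_k_linear bounded_linear_intros)
  ultimately show ?thesis
    using d by (auto simp: Suc intro: differentiableI)
qed

text \<open>The functions \<open>P(1/t) exp(-1/t)\<close>, extended by 0, are closed under differentiation, so that all
  derivatives of the basic flat function \<open>exp(-1/t)\<close> are accessible at once.\<close>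

definition flat :: "real poly \<Rightarrow> real \<Rightarrow> real" where
  "flat P t = (if t > 0 then poly P (1 / t) * exp (- (1 / t)) else 0)"

lemma flat_tendsto_0: "(flat P \<longlongrightarrow> 0) (at_right 0)"
proof -
  have "((\<lambda>x. \<Sum>i\<le>degree P. coeff P i * (x ^ i / exp x)) \<longlongrightarrow> (\<Sum>i\<le>degree P. coeff P i * 0)) at_top"
    by (intro tendsto_intros tendsto_power_div_exp_0)
  moreover have "(\<Sum>i\<le>degree P. coeff P i * (x ^ i / exp x)) = poly P x * exp (- x)" for x
    by (simp add: poly_altdef sum_distrib_right exp_minus divide_inverse mult.assoc)
  ultimately have "((\<lambda>x. poly P x * exp (- x)) \<longlongrightarrow> 0) at_top" by simp
  from filterlim_compose[OF this filterlim_inverse_at_top_right]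
  have "((\<lambda>t. poly P (inverse t) * exp (- inverse t)) \<longlongrightarrow> 0) (at_right 0)" .
  then show ?thesis
    by (rule Lim_transform_eventually)
      (auto simp: eventually_at_filter flat_def inverse_eq_divide)
qed

text \<open>The only point at issue is 0, where the difference quotient is again a flat function and vanishes
  in the limit, since the exponential beats every power.\<close>

lemma flat_derivative:
  "(flat P has_real_derivative flat ([:0, 0, 1:] * (P - pderiv P)) t) (at t)"
proof -
  consider "t > 0" | "t < 0" | "t = 0" by linarith
  then show ?thesis
  proof cases
    case 1
    have "((\<lambda>t. poly P (1 / t) * exp (- (1 / t))) has_real_derivative
        flat ([:0, 0, 1:] * (P - pderiv P)) t) (at t)"
      using 1
      by (auto intro!: derivative_eq_intros DERIV_chain2[OF poly_DERIV]
          simp: flat_def power2_eq_square algebra_simps)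
    then show ?thesis
      by (rule has_field_derivative_transform_within_open[where S = "{0<..}"])
        (use 1 in \<open>auto simp: flat_def\<close>)
  next
    case 2
    have "((\<lambda>t. 0) has_real_derivative flat ([:0, 0, 1:] * (P - pderiv P)) t) (at t)"
      using 2 by (simp add: flat_def)
    then show ?thesis
      by (rule has_field_derivative_transform_within_open[where S = "{..<0}"])
        (use 2 in \<open>auto simp: flat_def\<close>)
  next
    case 3
    have "((\<lambda>y. (flat P y - flat P 0) / (y - 0)) \<longlongrightarrow> 0) (at 0)"
    proof (rule filterlim_split_at)
      show "((\<lambda>y. (flat P y - flat P 0) / (y - 0)) \<longlongrightarrow> 0) (at_right 0)"
        by (rule Lim_transform_eventually[OF flat_tendsto_0[of "[:0, 1:] * P"]])
          (auto simp: eventually_at_filter flat_def)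
      show "((\<lambda>y. (flat P y - flat P 0) / (y - 0)) \<longlongrightarrow> 0) (at_left 0)"
        by (rule Lim_transform_eventually[OF tendsto_const])
          (auto simp: eventually_at_filter flat_def)
    qed
    then show ?thesis
      using 3 by (simp add: has_field_derivative_iff flat_def)
  qed
qed

primrec flat_poly :: "nat \<Rightarrow> real poly" where
  "flat_poly 0 = 1"
| "flat_poly (Suc n) = [:0, 0, 1:] * (flat_poly n - pderiv (flat_poly n))"

text \<open>Positive in the open unit ball, zero outside.\<close>

definition bump :: "'a::euclidean_space \<Rightarrow> real" where
  "bump x = flat 1 (1 - x \<bullet> x)"

lemma bump_nonneg: "0 \<le> bump x"
  by (simp add: bump_def flat_def)

lemma compact_support_mono:
  assumes "\<And>x. f x = 0 \<Longrightarrow> g x = 0" "compact (closure {x. f x \<noteq> 0})"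
  shows "compact (closure {x. g x \<noteq> 0})"
proof -
  have "closure {x. g x \<noteq> 0} \<subseteq> closure {x. f x \<noteq> 0}"
    using assms(1) by (intro closure_mono) auto
  then show ?thesis
    using compact_Int_closed[OF assms(2) closed_closure[of "{x. g x \<noteq> 0}"]] by (simp only: Int_absorb1)
qed

lemma bump_Cc: "(\<lambda>x::'a::euclidean_space. complex_of_real (bump x)) \<in> Cc_infinity"
proof -
  let ?\<psi> = "\<lambda>n t. complex_of_real (flat (flat_poly n) t)"
  have "(?\<psi> n has_vector_derivative ?\<psi> (Suc n) t) (at t)" for n t
    using flat_derivative[of "flat_poly n" t]
    by (auto intro!: derivative_eq_intros simp: has_real_derivative_iff_has_vector_derivative)
  from C_k_compose[of ?\<psi>, OF this C_k_one_minus_norm_square, of _ 0]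
  have "C_k n (\<lambda>x::'a. complex_of_real (bump x))" for n
    by (simp add: bump_def)
  moreover have "compact (closure {x::'a. complex_of_real (bump x) \<noteq> 0})"
  proof -
    have "{x::'a. complex_of_real (bump x) \<noteq> 0} \<subseteq> cball 0 1"
      by (auto simp: bump_def flat_def norm_eq_sqrt_inner split: if_splits)
    then show ?thesis
      by (meson bounded_cball bounded_subset compact_closure)
  qed
  ultimately show ?thesis by (simp add: Cc_infinity_def)
qed

lemma Cc_zero: "(\<lambda>x. 0) \<in> Cc_infinity"
  by (auto simp: Cc_infinity_def C_k_const)

lemma Cc_add:
  assumes "f \<in> Cc_infinity" "g \<in> Cc_infinity"
  shows "(\<lambda>x. f x + g x) \<in> Cc_infinity"
proof -
  have "closure {x. f x + g x \<noteq> 0} \<subseteq> closure ({x. f x \<noteq> 0} \<union> {x. g x \<noteq> 0})"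
    by (rule closure_mono) auto
  moreover have "compact (closure ({x. f x \<noteq> 0} \<union> {x. g x \<noteq> 0}))"
    using assms by (auto simp: Cc_infinity_def closure_Un intro: compact_Un)
  ultimately have "compact (closure {x. f x + g x \<noteq> 0})"
    using compact_Int_closed[OF _ closed_closure[of "{x. f x + g x \<noteq> 0}"]] by (metis Int_absorb1)
  then show ?thesis using assms by (auto simp: Cc_infinity_def C_k_add)
qed

lemma Cc_mult:
  assumes "\<And>n. C_k n g" "f \<in> Cc_infinity"
  shows "(\<lambda>x. g x * f x) \<in> Cc_infinity"
  using assms compact_support_mono[of f "\<lambda>x. g x * f x"]
  by (auto simp: Cc_infinity_def C_k_mult)

lemma Cc_cmult: "f \<in> Cc_infinity \<Longrightarrow> (\<lambda>x. c * f x) \<in> Cc_infinity"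
  by (rule Cc_mult) (rule C_k_const)

lemma Cc_shift:
  assumes "f \<in> Cc_infinity"
  shows "(\<lambda>x. f (x + p)) \<in> Cc_infinity"
proof -
  have "{x. f (x + p) \<noteq> 0} = (\<lambda>x. - p + x) ` {x. f x \<noteq> 0}"
    by (auto simp: image_iff intro!: exI[of _ "_ + p"])
  then have "closure {x. f (x + p) \<noteq> 0} = (\<lambda>x. - p + x) ` closure {x. f x \<noteq> 0}"
    by (simp only: closure_translation)
  then have "compact (closure {x. f (x + p) \<noteq> 0})"
    using assms compact_translation[of "closure {x. f x \<noteq> 0}" "- p"] by (simp add: Cc_infinity_def)
  then show ?thesis using assms by (simp add: Cc_infinity_def C_k_shift)
qed

lemma exp_ii_vector_derivative:
  "((\<lambda>t. exp (\<i> * of_real t)) has_vector_derivative \<i> * exp (\<i> * of_real t)) (at t)"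
  by (rule has_vector_derivative_real_field) (auto intro!: derivative_eq_intros)

lemma exp_inner_derivative:
  "((\<lambda>x::'a::euclidean_space. exp (\<i> * of_real (k \<bullet> x))) has_derivative
    (\<lambda>y. (k \<bullet> y) *\<^sub>R (\<i> * exp (\<i> * of_real (k \<bullet> x))))) (at x)"
  by (rule has_derivative_compose[OF bounded_linear_imp_has_derivative[OF bounded_linear_inner_right]
      exp_ii_vector_derivative[unfolded has_vector_derivative_def]])

lemma C_k_exp_inner: "C_k n (\<lambda>x::'a::euclidean_space. exp (\<i> * of_real (k \<bullet> x)))"
proof -
  let ?\<psi> = "\<lambda>n t. \<i> ^ n * exp (\<i> * complex_of_real t)"
  have "(?\<psi> n has_vector_derivative ?\<psi> (Suc n) t) (at t)" for n t
    using has_vector_derivative_mult_right[OF exp_ii_vector_derivative, of "\<i> ^ n" t]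
    by (simp add: mult_ac)
  from C_k_compose[of ?\<psi>, OF this C_k_linear[OF bounded_linear_inner_right], of _ 0]
  show ?thesis by simp
qed

lemma Cc_exp_mult: "f \<in> Cc_infinity \<Longrightarrow> (\<lambda>x. exp (\<i> * of_real (k \<bullet> x)) * f x) \<in> Cc_infinity"
  by (rule Cc_mult) (rule C_k_exp_inner)

section \<open>Modulations and translations\<close>

lemma V_op_abs: "sq_integrable f \<Longrightarrow> V_op k (abs_L2 f) = abs_L2 (\<lambda>x. exp (\<i> * of_real (k \<bullet> x)) * f x)"
  by (rule V_op.abs_eq) auto

lemma sq_integrable_modulation: "sq_integrable f \<Longrightarrow> sq_integrable (\<lambda>x. exp (\<i> * of_real (k \<bullet> x)) * f x)"
  by (auto simp: sq_integrable_def norm_mult)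

lemma V_op_add: "V_op k (u + v) = V_op k u + V_op k v"
proof -
  obtain f where f: "sq_integrable f" "u = abs_L2 f" by (rule L2_cases)
  obtain g where g: "sq_integrable g" "v = abs_L2 g" by (rule L2_cases)
  show ?thesis
    using f g by (simp add: abs_L2_add V_op_abs sq_integrable_add sq_integrable_modulation distrib_left)
qed

lemma V_op_cscale: "V_op k (cscale c u) = cscale c (V_op k u)"
proof -
  obtain f where f: "sq_integrable f" "u = abs_L2 f" by (rule L2_cases)
  then show ?thesis
    by (simp add: cscale_abs_L2 V_op_abs sq_integrable_cmult sq_integrable_modulation mult.left_commute)
qed

lemma V_op_inverse: "V_op k (V_op (- k) u) = u"
proof -
  obtain f where f: "sq_integrable f" "u = abs_L2 f" by (rule L2_cases)
  have "exp (\<i> * of_real (k \<bullet> x)) * (exp (\<i> * of_real ((- k) \<bullet> x)) * f x) = f x" for x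
    by (simp add: mult.assoc[symmetric] exp_add[symmetric])
  then show ?thesis
    unfolding f(2) V_op_abs[OF f(1)] V_op_abs[OF sq_integrable_modulation[OF f(1)]] by (simp only:)
qed

lemma cinner_V_op: "cinner (V_op k u) v = cinner u (V_op (- k) v)"
  by transfer (simp add: exp_cnj mult_ac)

lemma norm_V_op: "norm (V_op k u) = norm u"
  by transfer (simp add: norm_mult)

lemma bounded_linear_V_op: "bounded_linear (V_op k)"
  by (rule bounded_linear_intro[where K = 1])
    (simp_all add: V_op_add V_op_cscale norm_V_op flip: cscale_of_real)

lemma U_op_abs: "sq_integrable f \<Longrightarrow> U_op s (abs_L2 f) = abs_L2 (\<lambda>x. f (x + s))"
  by (rule U_op.abs_eq) auto

lemma U_op_add: "U_op s (u + v) = U_op s u + U_op s v"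
proof -
  obtain f where f: "sq_integrable f" "u = abs_L2 f" by (rule L2_cases)
  obtain g where g: "sq_integrable g" "v = abs_L2 g" by (rule L2_cases)
  show ?thesis
    unfolding f(2) g(2) abs_L2_add[OF f(1) g(1)] U_op_abs[OF f(1)] U_op_abs[OF g(1)]
      U_op_abs[OF sq_integrable_add[OF f(1) g(1)]]
      abs_L2_add[OF sq_integrable_shift[OF f(1)] sq_integrable_shift[OF g(1)]] ..
qed

lemma U_op_cscale: "U_op s (cscale c u) = cscale c (U_op s u)"
proof -
  obtain f where f: "sq_integrable f" "u = abs_L2 f" by (rule L2_cases)
  show ?thesis
    unfolding f(2) cscale_abs_L2[OF f(1)] U_op_abs[OF f(1)] U_op_abs[OF sq_integrable_cmult[OF f(1)]]
      cscale_abs_L2[OF sq_integrable_shift[OF f(1)]] ..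
qed

lemma U_op_commute: "U_op s (U_op t u) = U_op t (U_op s u)"
proof -
  obtain f where f: "sq_integrable f" "u = abs_L2 f" by (rule L2_cases)
  show ?thesis
    unfolding f(2) U_op_abs[OF f(1)] U_op_abs[OF sq_integrable_shift[OF f(1)]]
    by (simp add: add_ac)
qed

lemma integral_shift:
  fixes f :: "'a::euclidean_space \<Rightarrow> 'b::{banach, second_countable_topology}"
  assumes [measurable]: "f \<in> borel_measurable borel"
  shows "(\<integral>x. f (x + s) \<partial>lborel) = (\<integral>x. f x \<partial>lborel)"
proof -
  have "(\<integral>x. f x \<partial>distr lborel borel ((+) s)) = (\<integral>x. f (x + s) \<partial>lborel)"
    by (subst integral_distr) (auto simp: add.commute)
  then show ?thesis
    by (subst (asm) lborel_distr_plus) simp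
qed

lemma norm_U_op: "norm (U_op s u) = norm u"
proof -
  obtain f where f: "sq_integrable f" "u = abs_L2 f" by (rule L2_cases)
  have [measurable]: "f \<in> borel_measurable borel"
    using f by (simp add: sq_integrable_def)
  have "(norm (U_op s u))\<^sup>2 = (norm u)\<^sup>2"
    unfolding f(2) U_op_abs[OF f(1)] norm_abs_L2[OF f(1)] norm_abs_L2[OF sq_integrable_shift[OF f(1)]]
    by (rule integral_shift) measurable
  then show ?thesis by simp
qed

lemma bounded_linear_U_op: "bounded_linear (U_op s)"
  by (rule bounded_linear_intro[where K = 1])
    (simp_all add: U_op_add U_op_cscale norm_U_op flip: cscale_of_real)

lemma test_spaceE:
  assumes "u \<in> test_space"
  obtains f where "f \<in> Cc_infinity" "u = abs_L2 f"
  using assms by (auto simp: test_space_def)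

lemma test_spaceI: "f \<in> Cc_infinity \<Longrightarrow> abs_L2 f \<in> test_space"
  by (simp add: test_space_def)

definition modulate :: "'a::euclidean_space \<Rightarrow> ('a \<Rightarrow> complex) \<Rightarrow> 'a \<Rightarrow> complex" where
  "modulate k f x = exp (\<i> * of_real (k \<bullet> x)) * f x"

lemma modulate_Cc: "f \<in> Cc_infinity \<Longrightarrow> modulate k f \<in> Cc_infinity"
  unfolding modulate_def[abs_def] by (rule Cc_exp_mult)

lemma V_op_Cc: "f \<in> Cc_infinity \<Longrightarrow> V_op k (abs_L2 f) = abs_L2 (modulate k f)"
  unfolding modulate_def[abs_def] by (rule V_op_abs[OF sq_integrable_Cc])

lemma V_op_test_space: "u \<in> test_space \<Longrightarrow> V_op k u \<in> test_space"
  by (erule test_spaceE) (simp add: V_op_Cc test_spaceI modulate_Cc)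

section \<open>The energy form\<close>

locale vanishing_coefficient =
  fixes a :: "'a::euclidean_space \<Rightarrow> real"
  assumes a_C1: "C_k 1 a" and a_pos: "\<And>x. 0 < a x" and a_vanishes: "(a \<longlongrightarrow> 0) at_infinity"
begin

lemma a_continuous: "continuous_on UNIV a"
  using a_C1 by (auto intro: differentiable_imp_continuous_on_UNIV)

lemma a_measurable [measurable]: "a \<in> borel_measurable borel"
  using a_continuous by (rule borel_measurable_continuous_onI)

lemma a_bounded: obtains B where "B > 0" "\<And>x. a x \<le> B"
proof -
  obtain r where r: "\<And>x. r \<le> norm x \<Longrightarrow> a x < 1"
    using order_tendstoD(2)[OF a_vanishes, of 1] by (auto simp: eventually_at_infinity)
  have "bounded (a ` cball 0 r)"
    by (intro compact_imp_bounded compact_continuous_image continuous_on_subset[OF a_continuous]) auto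
  then obtain B where "\<forall>y\<in>a ` cball 0 r. norm y \<le> B"
    unfolding bounded_iff by blast
  then have B: "\<bar>a x\<bar> \<le> B" if "norm x \<le> r" for x
    using that by simp
  have "a x \<le> max 1 B" for x
    using r[of x] B[of x] by (cases "norm x \<le> r") auto
  then show thesis by (intro that[of "max 1 B"]) auto
qed

text \<open>With the square root of \<open>a\<close> as a weight, \<open>Q0 a\<close> becomes a sum of inner products of square-integrable
  functions, and estimates of the form reduce to the Cauchy-Schwarz inequality.\<close>

definition wgrad :: "'a \<Rightarrow> ('a \<Rightarrow> complex) \<Rightarrow> 'a \<Rightarrow> complex" where
  "wgrad b f x = of_real (sqrt (a x)) * partial b f x"

definition wmult :: "('a \<Rightarrow> complex) \<Rightarrow> 'a \<Rightarrow> complex" where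
  "wmult f x = of_real (sqrt (a x)) * f x"

lemma sq_integrable_wgrad:
  assumes "f \<in> Cc_infinity" "b \<in> Basis"
  shows "sq_integrable (wgrad b f)"
  unfolding wgrad_def
  by (rule sq_integrable_compact_support[OF _ Cc_infinityD(3)[OF assms(1)]])
    (auto intro!: continuous_intros a_continuous Cc_infinityD(5) assms simp: partial_zero_outside)

lemma sq_integrable_wmult:
  assumes "f \<in> Cc_infinity"
  shows "sq_integrable (wmult f)"
proof (rule sq_integrable_compact_support[OF _ Cc_infinityD(3)[OF assms(1)]])
  show "continuous_on UNIV (wmult f)"
    unfolding wmult_def[abs_def] by (intro continuous_intros a_continuous Cc_infinityD(2) assms)
  show "wmult f x = 0" if "x \<notin> closure {x. f x \<noteq> 0}" for x
    unfolding wmult_def Cc_infinity_outside[OF that] by simp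
qed

lemma Q0_eq_sum:
  assumes "f \<in> Cc_infinity" "g \<in> Cc_infinity"
  shows "Q0 a (abs_L2 f) (abs_L2 g) = (\<Sum>b\<in>Basis. cinner (abs_L2 (wgrad b f)) (abs_L2 (wgrad b g)))"
proof -
  have "of_real (a x) * (\<Sum>b\<in>Basis. partial b f x * cnj (partial b g x))
      = (\<Sum>b\<in>Basis. wgrad b f x * cnj (wgrad b g x))" for x
  proof -
    have "complex_of_real (a x) = of_real (sqrt (a x)) * of_real (sqrt (a x))"
      using a_pos[of x] by (simp flip: of_real_mult)
    then show ?thesis by (simp add: wgrad_def sum_distrib_left mult_ac)
  qed
  then have "Q0 a (abs_L2 f) (abs_L2 g) = (\<integral>x. (\<Sum>b\<in>Basis. wgrad b f x * cnj (wgrad b g x)) \<partial>lborel)"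
    by (simp add: Q0_def assms)
  also have "\<dots> = (\<Sum>b\<in>Basis. \<integral>x. wgrad b f x * cnj (wgrad b g x) \<partial>lborel)"
    by (intro Bochner_Integration.integral_sum sq_integrable_mult_cnj sq_integrable_wgrad assms)
  also have "\<dots> = (\<Sum>b\<in>Basis. cinner (abs_L2 (wgrad b f)) (abs_L2 (wgrad b g)))"
    by (intro sum.cong refl cinner_abs_L2[symmetric] sq_integrable_wgrad assms)
  finally show ?thesis .
qed

lemma wgrad_add:
  assumes "f \<in> Cc_infinity" "g \<in> Cc_infinity" "b \<in> Basis"
  shows "abs_L2 (wgrad b (\<lambda>x. f x + g x)) = abs_L2 (wgrad b f) + abs_L2 (wgrad b g)"
proof -
  have "wgrad b (\<lambda>x. f x + g x) = (\<lambda>x. wgrad b f x + wgrad b g x)"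
    using assms by (auto simp: wgrad_def partial_add Cc_infinityD(1) distrib_left)
  then show ?thesis using assms by (simp add: abs_L2_add sq_integrable_wgrad)
qed

lemma wgrad_cmult:
  assumes "f \<in> Cc_infinity" "b \<in> Basis"
  shows "abs_L2 (wgrad b (\<lambda>x. c * f x)) = cscale c (abs_L2 (wgrad b f))"
proof -
  have "wgrad b (\<lambda>x. c * f x) = (\<lambda>x. c * wgrad b f x)"
    using assms partial_bounded_linear(1)[OF bounded_linear_mult_right Cc_infinityD(1)[OF assms(1)]]
    by (auto simp: wgrad_def mult_ac)
  then show ?thesis using assms by (simp add: cscale_abs_L2 sq_integrable_wgrad)
qed

sublocale positive_form test_space "Q0 a"
proof
  show "0 \<in> test_space"
    using test_spaceI[OF Cc_zero] by (simp add: zero_L2_def)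
  fix u v w :: "'a L2" and c
  assume "u \<in> test_space"
  then obtain f where f: "f \<in> Cc_infinity" "u = abs_L2 f" by (rule test_spaceE)
  have cu: "cscale c u = abs_L2 (\<lambda>x. c * f x)"
    using f by (simp add: cscale_abs_L2 sq_integrable_Cc)
  show "cscale c u \<in> test_space"
    unfolding cu using f by (intro test_spaceI Cc_cmult)
  show "0 \<le> Re (Q0 a u u)"
    using f by (simp add: Q0_eq_sum cinner_self sum_nonneg)
  {
    assume "w \<in> test_space"
    then obtain h where h: "h \<in> Cc_infinity" "w = abs_L2 h" by (rule test_spaceE)
    show "Q0 a (cscale c u) w = c * Q0 a u w"
      unfolding cu using f h
      by (simp add: Q0_eq_sum Cc_cmult wgrad_cmult cinner_cscale_left sum_distrib_left)
  }
  assume "v \<in> test_space"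
  then obtain g where g: "g \<in> Cc_infinity" "v = abs_L2 g" by (rule test_spaceE)
  have uv: "u + v = abs_L2 (\<lambda>x. f x + g x)"
    using f g by (simp add: abs_L2_add sq_integrable_Cc)
  show "u + v \<in> test_space"
    unfolding uv using f g by (intro test_spaceI Cc_add)
  show "Q0 a v u = cnj (Q0 a u v)"
    using f g by (simp add: Q0_eq_sum cinner_commute[of _ "abs_L2 (wgrad _ f)"])
  assume "w \<in> test_space"
  then obtain h where h: "h \<in> Cc_infinity" "w = abs_L2 h" by (rule test_spaceE)
  show "Q0 a (u + v) w = Q0 a u w + Q0 a v w"
    unfolding uv using f g h
    by (simp add: Q0_eq_sum Cc_add wgrad_add cinner_add_left sum.distrib)
qed

sublocale closable_form test_space "Q0 a"
proof
  fix f :: "nat \<Rightarrow> 'a L2" assume f: "form_converges test_space (Q0 a) f 0"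
  show "(\<lambda>n. energy (f n)) \<longlonglongrightarrow> 0"
  proof (rule operator_form_closable[OF _ f])
    fix u :: "'a L2" assume u: "u \<in> test_space"
    then obtain g where g: "g \<in> Cc_infinity" "u = abs_L2 g" by (rule test_spaceE)
    have "Q0 a v u = cinner v (abs_L2 (H0 a g))" if v: "v \<in> test_space" for v
    proof -
      obtain h where h: "h \<in> Cc_infinity" "v = abs_L2 h" using v by (rule test_spaceE)
      have "Q0 a v u = cnj (Q0 a u v)" by (rule hermitian[OF u v])
      also have "\<dots> = cnj (cinner (abs_L2 (H0 a g)) v)"
        using Q0_eq_H0(2)[OF a_C1 g(1) h(1)] g h by simp
      also have "\<dots> = cinner v (abs_L2 (H0 a g))"
        by (rule cinner_commute[symmetric])
      finally show ?thesis .
    qed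
    then show "\<exists>h. \<forall>v\<in>test_space. Q0 a v u = cinner v h" by blast
  qed
qed

lemma energy_square:
  assumes "f \<in> Cc_infinity"
  shows "(energy (abs_L2 f))\<^sup>2 = (\<Sum>b\<in>Basis. (norm (abs_L2 (wgrad b f)))\<^sup>2)"
proof -
  have "of_real ((energy (abs_L2 f))\<^sup>2) = Q0 a (abs_L2 f) (abs_L2 f)"
    using assms by (simp add: self_eq_energy test_spaceI)
  also have "\<dots> = of_real (\<Sum>b\<in>Basis. (norm (abs_L2 (wgrad b f)))\<^sup>2)"
    using assms by (simp add: Q0_eq_sum cinner_self)
  finally show ?thesis by (simp only: of_real_eq_iff)
qed

lemma norm_wgrad_le:
  assumes "f \<in> Cc_infinity" "b \<in> Basis"
  shows "norm (abs_L2 (wgrad b f)) \<le> energy (abs_L2 f)"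
proof (rule power2_le_imp_le)
  show "(norm (abs_L2 (wgrad b f)))\<^sup>2 \<le> (energy (abs_L2 f))\<^sup>2"
    unfolding energy_square[OF assms(1)] by (rule member_le_sum) (use assms in auto)
qed (use assms in \<open>simp add: energy_nonneg test_spaceI\<close>)

lemma norm_wmult_le:
  assumes f: "f \<in> Cc_infinity" and B: "\<And>x. a x \<le> B"
  shows "norm (abs_L2 (wmult f)) \<le> sqrt B * norm (abs_L2 f)"
proof (rule power2_le_imp_le)
  have "0 \<le> B" using a_pos[of 0] B[of 0] by simp
  then show "0 \<le> sqrt B * norm (abs_L2 f)" by simp
  have "(norm (abs_L2 (wmult f)))\<^sup>2 = (\<integral>x. (cmod (wmult f x))\<^sup>2 \<partial>lborel)"
    by (rule norm_abs_L2[OF sq_integrable_wmult[OF f]])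
  also have "\<dots> \<le> (\<integral>x. B * (cmod (f x))\<^sup>2 \<partial>lborel)"
  proof (rule integral_mono)
    show "integrable lborel (\<lambda>x. (cmod (wmult f x))\<^sup>2)"
      using sq_integrable_wmult[OF f] by (simp add: sq_integrable_def)
    show "integrable lborel (\<lambda>x. B * (cmod (f x))\<^sup>2)"
      using sq_integrable_Cc[OF f] by (simp add: sq_integrable_def)
    show "(cmod (wmult f x))\<^sup>2 \<le> B * (cmod (f x))\<^sup>2" for x
      using B[of x] a_pos[of x] by (simp add: wmult_def norm_mult power_mult_distrib mult_right_mono)
  qed
  also have "\<dots> = (sqrt B * norm (abs_L2 f))\<^sup>2"
    using \<open>0 \<le> B\<close> by (simp add: norm_abs_L2 sq_integrable_Cc f power_mult_distrib)
  finally show "(norm (abs_L2 (wmult f)))\<^sup>2 \<le> (sqrt B * norm (abs_L2 f))\<^sup>2" .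
qed

text \<open>The product rule: modulation adds \<open>i k f\<close> to the gradient, up to the common phase factor.\<close>

lemma wgrad_modulate:
  assumes f: "f \<in> Cc_infinity" and b: "b \<in> Basis"
  shows "abs_L2 (wgrad b (modulate k f))
    = V_op k (abs_L2 (wgrad b f) + cscale (\<i> * of_real (k \<bullet> b)) (abs_L2 (wmult f)))"
proof -
  define e where "e x = exp (\<i> * of_real (k \<bullet> x))" for x
  have e: "(e has_derivative (\<lambda>y. (k \<bullet> y) *\<^sub>R (\<i> * e x))) (at x)" for x
    unfolding e_def by (rule exp_inner_derivative)
  have mod: "modulate k f = (\<lambda>x. e x * f x)"
    by (simp add: fun_eq_iff modulate_def e_def)
  have "partial b (modulate k f) x = e x * partial b f x + ((k \<bullet> b) *\<^sub>R (\<i> * e x)) * f x" for x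
    unfolding mod partial_mult[OF differentiableI[OF e] Cc_infinityD(1)[OF f]]
      partial_eq_derivative[OF e] ..
  then have "wgrad b (modulate k f) x
      = e x * (wgrad b f x + (\<i> * of_real (k \<bullet> b)) * wmult f x)" for x
    by (simp add: wgrad_def wmult_def scaleR_conv_of_real algebra_simps)
  then have "wgrad b (modulate k f) = (\<lambda>x. exp (\<i> * of_real (k \<bullet> x)) *
      (wgrad b f x + (\<i> * of_real (k \<bullet> b)) * wmult f x))"
    by (simp add: fun_eq_iff e_def)
  then show ?thesis
    using sq_integrable_wgrad[OF f b] sq_integrable_wmult[OF f]
    by (simp add: V_op_abs abs_L2_add cscale_abs_L2 sq_integrable_add sq_integrable_cmult)
qed

end

section \<open>Modulations and the resolvent\<close>

lemma cinner_V_V: "cinner (V_op k u) (V_op k v) = cinner u v"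
  using V_op_inverse[of "- k" v] by (simp add: cinner_V_op)

text \<open>Used with \<open>x\<close>, \<open>y\<close> the weighted derivative and the weighted value of one test function, \<open>x'\<close>,
  \<open>y'\<close> those of another, \<open>X\<close>, \<open>X'\<close> their energies, and \<open>\<kappa>\<close> a component of \<open>i k\<close>.\<close>

lemma cinner_perturbation:
  assumes x: "norm x \<le> X" "norm x' \<le> X'" and y: "norm y \<le> c * X" "norm y' \<le> c * X'"
    and r: "cmod \<kappa> \<le> r" "r \<le> 1" and c: "0 \<le> c"
  shows "cmod (cinner (x + cscale \<kappa> y) (x' + cscale \<kappa> y') - cinner x x') \<le> r * (2 * c + c\<^sup>2) * (X * X')"
proof -
  have nn: "0 \<le> X" "0 \<le> X'" "0 \<le> r"
    using norm_ge_zero[of x] norm_ge_zero[of x'] norm_ge_zero[of \<kappa>] x r by linarith+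
  have bound: "cmod (cinner u v) \<le> s * t" if "norm u \<le> s" "norm v \<le> t" for u v :: "'a L2" and s t
    using cinner_Cauchy_Schwarz[of u v] mult_mono[OF that order_trans[OF norm_ge_zero that(1)] norm_ge_zero]
    by linarith
  have ky: "norm (cscale \<kappa> y) \<le> r * (c * X)" "norm (cscale \<kappa> y') \<le> r * (c * X')"
    unfolding norm_cscale using r y nn by (auto intro!: mult_mono)
  have "cinner (x + cscale \<kappa> y) (x' + cscale \<kappa> y') - cinner x x'
      = cinner x (cscale \<kappa> y') + cinner (cscale \<kappa> y) x' + cinner (cscale \<kappa> y) (cscale \<kappa> y')"
    by (simp add: L2.add_left L2.add_right)
  also have "cmod \<dots> \<le> X * (r * (c * X')) + (r * (c * X)) * X' + (r * (c * X)) * (r * (c * X'))"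
    by (intro order_trans[OF norm_triangle_ineq add_mono[OF order_trans[OF norm_triangle_ineq add_mono]]]
        bound x ky)
  also have "\<dots> = r * (2 * c + r * c\<^sup>2) * (X * X')"
    by (simp add: power2_eq_square algebra_simps)
  also have "\<dots> \<le> r * (2 * c + c\<^sup>2) * (X * X')"
    using nn c r by (intro mult_right_mono mult_left_mono add_left_mono) (auto intro: mult_left_le_one_le)
  finally show ?thesis .
qed

text \<open>Choose \<open>k\<close> with \<open>k \<bullet> s = \<pi>\<close> and modulate a non-negative bump function by \<open>k\<close>: the translate by \<open>s\<close>
  has the opposite phase, so that subtraction adds the absolute values.\<close>

lemma translation_separating:
  fixes s :: "'a::euclidean_space"
  assumes s: "s \<noteq> 0"
  obtains \<psi> where "\<psi> \<in> test_space" "\<psi> \<noteq> 0" "norm \<psi> \<le> norm (U_op s \<psi> - \<psi>)"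
proof -
  define k where "k = (pi / (s \<bullet> s)) *\<^sub>R s"
  have ks: "k \<bullet> s = pi" using s by (simp add: k_def)
  define \<beta> where "\<beta> x = complex_of_real (bump x)" for x :: 'a
  have \<beta>: "\<beta> \<in> Cc_infinity" unfolding \<beta>_def[abs_def] by (rule bump_Cc)
  define f where "f x = exp (\<i> * of_real (k \<bullet> x)) * \<beta> x" for x
  have f: "f \<in> Cc_infinity" unfolding f_def[abs_def] by (rule Cc_exp_mult[OF \<beta>])
  have sq: "sq_integrable f" "sq_integrable (\<lambda>x. f (x + s))"
    using sq_integrable_Cc[OF f] sq_integrable_Cc[OF Cc_shift[OF f]] by auto
  show thesis
  proof
    show "abs_L2 f \<in> test_space" using f by (simp add: test_space_def)
    show "abs_L2 f \<noteq> 0"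
    proof
      assume "abs_L2 f = 0"
      then have "AE x in lborel. f x = 0"
        unfolding zero_L2_def using abs_L2_eq_iff[OF sq(1) sq_integrable_zero] by simp
      then have "f = (\<lambda>x. 0)"
        by (intro continuous_AE_eq Cc_infinityD(2)[OF f]) auto
      then have "f 0 = 0" by simp
      then show False by (simp add: f_def \<beta>_def bump_def flat_def)
    qed
    have shift: "f (x + s) - f x = - exp (\<i> * of_real (k \<bullet> x)) * of_real (bump (x + s) + bump x)" for x
    proof -
      have "exp (\<i> * complex_of_real (k \<bullet> (x + s))) = - exp (\<i> * of_real (k \<bullet> x))"
        by (simp add: inner_add_right ks distrib_left exp_add mult.commute[of \<i> "of_real pi"])
      then show ?thesis by (simp add: f_def \<beta>_def algebra_simps)
    qed
    show "norm (abs_L2 f) \<le> norm (U_op s (abs_L2 f) - abs_L2 f)"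
    proof (rule power2_le_imp_le)
      have "(norm (abs_L2 f))\<^sup>2 = (\<integral>x. (cmod (f x))\<^sup>2 \<partial>lborel)"
        by (rule norm_abs_L2[OF sq(1)])
      also have "\<dots> \<le> (\<integral>x. (cmod (f (x + s) - f x))\<^sup>2 \<partial>lborel)"
      proof (rule integral_mono)
        show "integrable lborel (\<lambda>x. (cmod (f x))\<^sup>2)"
          using sq(1) by (simp add: sq_integrable_def)
        show "integrable lborel (\<lambda>x. (cmod (f (x + s) - f x))\<^sup>2)"
          using sq_integrable_diff[OF sq(2,1)] by (simp add: sq_integrable_def)
        fix x
        have "cmod (f x) = bump x"
          using bump_nonneg[of x] by (simp add: f_def \<beta>_def norm_mult)
        moreover have "cmod (f (x + s) - f x) = bump (x + s) + bump x"
          unfolding shift using bump_nonneg[of x] bump_nonneg[of "x + s"]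
          by (simp add: norm_mult del: of_real_add)
        ultimately show "(cmod (f x))\<^sup>2 \<le> (cmod (f (x + s) - f x))\<^sup>2"
          using bump_nonneg[of x] bump_nonneg[of "x + s"] by (simp add: power_mono)
      qed
      also have "\<dots> = (norm (U_op s (abs_L2 f) - abs_L2 f))\<^sup>2"
        unfolding U_op_abs[OF sq(1)] abs_L2_diff[OF sq(2,1)]
        by (rule norm_abs_L2[OF sq_integrable_diff[OF sq(2,1)], symmetric])
      finally show "(norm (abs_L2 f))\<^sup>2 \<le> (norm (U_op s (abs_L2 f) - abs_L2 f))\<^sup>2" .
    qed simp
  qed
qed

locale vanishing_coefficient_resolvent = vanishing_coefficient +
  fixes \<alpha> :: real
  assumes \<alpha>_pos: "0 < \<alpha>"
begin

sublocale shifted_form test_space "Q0 a" \<alpha>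
  by unfold_locales (rule \<alpha>_pos)

text \<open>The energy controls the weighted gradient directly, and the weighted value through
  \<open>a \<le> B\<close> and the term \<open>\<alpha> \<parallel>u\<parallel>\<^sup>2\<close>. This is where boundedness of \<open>a\<close> enters.\<close>

lemma form_modulation:
  obtains C where "0 \<le> C"
    "\<And>k u v. norm k \<le> 1 \<Longrightarrow> u \<in> test_space \<Longrightarrow> v \<in> test_space \<Longrightarrow>
      cmod (Q0 a (V_op k u) (V_op k v) - Q0 a u v) \<le> C * norm k * (sh.energy u * sh.energy v)"
proof -
  obtain B where B: "B > 0" "\<And>x. a x \<le> B" by (rule a_bounded) blast
  define c where "c = sqrt B / sqrt \<alpha>"
  have c: "0 \<le> c" using B \<alpha>_pos by (simp add: c_def)
  define C where "C = real DIM('a) * (2 * c + c\<^sup>2)"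
  have "cmod (Q0 a (V_op k u) (V_op k v) - Q0 a u v) \<le> C * norm k * (sh.energy u * sh.energy v)"
    if k: "norm k \<le> 1" and u: "u \<in> test_space" and v: "v \<in> test_space" for k u v
  proof -
    obtain f where f: "f \<in> Cc_infinity" "u = abs_L2 f" using u by (rule test_spaceE)
    obtain g where g: "g \<in> Cc_infinity" "v = abs_L2 g" using v by (rule test_spaceE)
    have wgrad: "norm (abs_L2 (wgrad b h)) \<le> sh.energy (abs_L2 h)"
      if "h \<in> Cc_infinity" "b \<in> Basis" for b h
      using norm_wgrad_le[OF that] energy_le_shifted[OF test_spaceI[OF that(1)]] by linarith
    have wmult: "norm (abs_L2 (wmult h)) \<le> c * sh.energy (abs_L2 h)" if "h \<in> Cc_infinity" for h
    proof -
      have "norm (abs_L2 (wmult h)) \<le> c * (sqrt \<alpha> * norm (abs_L2 h))"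
        using norm_wmult_le[OF that B(2)] \<alpha>_pos by (simp add: c_def)
      also have "\<dots> \<le> c * sh.energy (abs_L2 h)"
        by (intro mult_left_mono norm_le_energy test_spaceI that c)
      finally show ?thesis .
    qed
    let ?\<kappa> = "\<lambda>b. \<i> * complex_of_real (k \<bullet> b)"
    let ?T = "\<lambda>b. cinner (abs_L2 (wgrad b f) + cscale (?\<kappa> b) (abs_L2 (wmult f)))
        (abs_L2 (wgrad b g) + cscale (?\<kappa> b) (abs_L2 (wmult g)))
        - cinner (abs_L2 (wgrad b f)) (abs_L2 (wgrad b g))"
    have diff: "Q0 a (V_op k u) (V_op k v) - Q0 a u v = (\<Sum>b\<in>Basis. ?T b)"
      unfolding f(2) g(2) V_op_Cc[OF f(1)] V_op_Cc[OF g(1)] Q0_eq_sum[OF f(1) g(1)]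
        Q0_eq_sum[OF modulate_Cc[OF f(1)] modulate_Cc[OF g(1)]]
      by (simp add: wgrad_modulate f(1) g(1) cinner_V_V sum_subtractf)
    have "cmod (Q0 a (V_op k u) (V_op k v) - Q0 a u v)
        \<le> (\<Sum>b\<in>(Basis :: 'a set). norm k * (2 * c + c\<^sup>2) * (sh.energy u * sh.energy v))"
      unfolding diff
    proof (rule sum_norm_le)
      fix b :: 'a assume b: "b \<in> Basis"
      have "cmod (?\<kappa> b) \<le> norm k"
        using Basis_le_norm[OF b, of k] by (simp add: norm_mult)
      then show "cmod (?T b) \<le> norm k * (2 * c + c\<^sup>2) * (sh.energy u * sh.energy v)"
        unfolding f(2) g(2) using k b f(1) g(1) c
        by (intro cinner_perturbation wgrad wmult)
    qed
    also have "\<dots> = C * norm k * (sh.energy u * sh.energy v)"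
      unfolding C_def sum_constant by (simp only: mult_ac)
    finally show ?thesis .
  qed
  moreover have "0 \<le> C" using c by (simp add: C_def)
  ultimately show thesis using that by blast
qed

text \<open>If \<open>f\<close> solves the problem for \<open>V\<^sub>-\<^sub>k w\<close> up to \<open>\<epsilon>\<close>, then \<open>V\<^sub>k f\<close> solves it for \<open>w\<close> up to
  \<open>O(\<epsilon> + |k|)\<close>. Comparing both with the resolvent and letting \<open>\<epsilon>\<close> tend to 0 gives the estimate.\<close>

lemma resolvent_modulation:
  obtains K where "0 \<le> K"
    "\<And>k w. norm k \<le> 1 \<Longrightarrow> norm (V_op k (resolvent (V_op (- k) w)) - resolvent w) \<le> K * norm k * norm w"
proof -
  obtain C where C: "0 \<le> C"
    "\<And>k u v. norm k \<le> 1 \<Longrightarrow> u \<in> test_space \<Longrightarrow> v \<in> test_space \<Longrightarrow>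
      cmod (Q0 a (V_op k u) (V_op k v) - Q0 a u v) \<le> C * norm k * (sh.energy u * sh.energy v)"
    by (rule form_modulation) blast
  have energy_V: "sh.energy (V_op k u) \<le> (1 + C) * sh.energy u"
    if k: "norm k \<le> 1" and u: "u \<in> test_space" for k u
  proof (rule power2_le_imp_le)
    have E0: "0 \<le> sh.energy u" using u by (rule sh.energy_nonneg)
    then show "0 \<le> (1 + C) * sh.energy u" using C(1) by simp
    have "(sh.energy (V_op k u))\<^sup>2 = cmod (Q0 a (V_op k u) (V_op k u) + of_real \<alpha> * cinner u u)"
      using arg_cong[OF sh.self_eq_energy[OF V_op_test_space[OF u]], of cmod]
      by (simp add: cinner_V_V norm_power)
    also have "\<dots> = cmod ((Q0 a (V_op k u) (V_op k u) - Q0 a u u) + of_real ((sh.energy u)\<^sup>2))"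
      unfolding sh.self_eq_energy[OF u, symmetric] by (simp add: algebra_simps)
    also have "\<dots> \<le> C * norm k * (sh.energy u * sh.energy u) + (sh.energy u)\<^sup>2"
      by (intro order_trans[OF norm_triangle_ineq add_mono] C(2) k u) (simp add: norm_power)
    also have "\<dots> \<le> C * 1 * (sh.energy u * sh.energy u) + (sh.energy u)\<^sup>2"
      using C(1) k by (intro add_right_mono mult_right_mono mult_left_mono) auto
    also have "\<dots> = (1 + C) * (sh.energy u)\<^sup>2"
      by (simp add: power2_eq_square algebra_simps)
    also have "\<dots> \<le> (1 + C)\<^sup>2 * (sh.energy u)\<^sup>2"
      using C(1) by (intro mult_right_mono) (auto simp: power2_eq_square)
    finally show "(sh.energy (V_op k u))\<^sup>2 \<le> ((1 + C) * sh.energy u)\<^sup>2"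
      by (simp add: power_mult_distrib)
  qed
  define K where "K = C * (1 + C) / \<alpha>"
  have "norm (V_op k (resolvent (V_op (- k) w)) - resolvent w) \<le> K * norm k * norm w"
    if k: "norm k \<le> 1" for k w
  proof -
    \<comment> \<open>\<open>?A\<close> collects the contributions that survive \<open>\<epsilon> = 0\<close>, and \<open>?B\<close> the coefficient of \<open>\<epsilon>\<close>.\<close>
    let ?x = "sqrt \<alpha> * norm (V_op k (resolvent (V_op (- k) w)) - resolvent w)"
    let ?A = "C * (1 + C) * norm k * (norm w / sqrt \<alpha>)"
    let ?B = "(1 + C) * (C * norm k + 1) + 1"
    have le: "?x \<le> ?A + ?B * \<epsilon>" if \<epsilon>: "\<epsilon> > 0" for \<epsilon>
    proof -
      obtain f where f: "approx_solution (V_op (- k) w) \<epsilon> f"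
        using approx_solution_exists[OF \<epsilon>] by blast
      have fD: "f \<in> test_space" using f by (simp add: approx_solution_def)
      have Ef: "sh.energy f \<le> norm w / sqrt \<alpha> + \<epsilon>"
        using approx_solution_energy[OF f] \<epsilon> by (simp add: norm_V_op)
      define \<delta> where "\<delta> = (C * norm k * (norm w / sqrt \<alpha> + \<epsilon>) + \<epsilon>) * (1 + C)"
      have "approx_solution w \<delta> (V_op k f)"
        unfolding approx_solution_def
      proof (intro conjI ballI V_op_test_space fD)
        fix g :: "'a L2" assume g: "g \<in> test_space"
        \<comment> \<open>Writing \<open>g = V\<^sub>k g'\<close> splits the residual into the change of the form under modulation
          and the residual of \<open>f\<close> against \<open>g'\<close>.\<close>
        define g' where "g' = V_op (- k) g"
        have g': "g' \<in> test_space" "g = V_op k g'"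
          unfolding g'_def using g by (auto simp: V_op_test_space V_op_inverse)
        have Eg': "sh.energy g' \<le> (1 + C) * sh.energy g"
          unfolding g'_def using k by (intro energy_V g) simp
        have "Q0 a (V_op k f) g + of_real \<alpha> * cinner (V_op k f) g - cinner w g
            = (Q0 a (V_op k f) (V_op k g') - Q0 a f g')
              + (Q0 a f g' + of_real \<alpha> * cinner f g' - cinner (V_op (- k) w) g')"
          unfolding g'(2) cinner_V_V using cinner_V_op[of "- k" w g'] by simp
        also have "cmod \<dots> \<le> C * norm k * (sh.energy f * sh.energy g') + \<epsilon> * sh.energy g'"
          using f g'(1) by (intro order_trans[OF norm_triangle_ineq add_mono] C(2) k fD)
            (auto simp: approx_solution_def)
        also have "\<dots> = (C * norm k * sh.energy f + \<epsilon>) * sh.energy g'"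
          by (simp add: algebra_simps)
        also have "\<dots> \<le> (C * norm k * (norm w / sqrt \<alpha> + \<epsilon>) + \<epsilon>) * ((1 + C) * sh.energy g)"
          using C(1) Ef \<epsilon> \<alpha>_pos
          by (intro mult_mono Eg' add_right_mono mult_left_mono sh.energy_nonneg g'(1)) auto
        finally show "cmod (Q0 a (V_op k f) g + of_real \<alpha> * cinner (V_op k f) g - cinner w g)
            \<le> \<delta> * sh.energy g"
          by (simp add: \<delta>_def mult.assoc)
      qed
      moreover have "0 \<le> \<delta>" using C(1) \<epsilon> \<alpha>_pos by (simp add: \<delta>_def)
      ultimately have 1: "sqrt \<alpha> * norm (resolvent w - V_op k f) \<le> \<delta>"
        by (intro resolvent_approx)
      have "norm (V_op k (resolvent (V_op (- k) w)) - V_op k f) = norm (resolvent (V_op (- k) w) - f)"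
        by (simp add: norm_V_op flip: linear_diff[OF bounded_linear.linear[OF bounded_linear_V_op]])
      then have 2: "sqrt \<alpha> * norm (V_op k (resolvent (V_op (- k) w)) - V_op k f) \<le> \<epsilon>"
        using resolvent_approx[OF _ f] \<epsilon> by simp
      have "norm (V_op k (resolvent (V_op (- k) w)) - resolvent w)
          \<le> norm (V_op k (resolvent (V_op (- k) w)) - V_op k f) + norm (resolvent w - V_op k f)"
        using dist_triangle2[of "V_op k (resolvent (V_op (- k) w))" "resolvent w" "V_op k f"]
        by (simp add: dist_norm)
      then have "?x \<le> sqrt \<alpha> * (norm (V_op k (resolvent (V_op (- k) w)) - V_op k f) + norm (resolvent w - V_op k f))"
        using \<alpha>_pos by (intro mult_left_mono) auto
      also have "\<dots> \<le> \<epsilon> + \<delta>"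
        using 1 2 by (simp add: distrib_left)
      also have "\<dots> = ?A + ?B * \<epsilon>"
        by (simp add: \<delta>_def algebra_simps add_divide_distrib)
      finally show ?thesis .
    qed
    have "?x \<le> ?A"
    proof (rule field_le_epsilon)
      fix e :: real assume e: "e > 0"
      have B: "?B > 0" using C(1) by (intro add_nonneg_pos mult_nonneg_nonneg add_nonneg_nonneg) auto
      show "?x \<le> ?A + e"
        using le[of "e / ?B"] B e by simp
    qed
    then have "norm (V_op k (resolvent (V_op (- k) w)) - resolvent w) * sqrt \<alpha> \<le> ?A"
      by (simp only: mult.commute)
    then have "norm (V_op k (resolvent (V_op (- k) w)) - resolvent w) \<le> ?A / sqrt \<alpha>"
      by (rule mult_imp_le_div_pos[rotated]) (use \<alpha>_pos in simp)
    also have "\<dots> = K * norm k * norm w"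
      using \<alpha>_pos by (simp add: K_def)
    finally show ?thesis .
  qed
  moreover have "0 \<le> K" using C(1) \<alpha>_pos by (simp add: K_def)
  ultimately show thesis using that by blast
qed

lemma resolvent_modulation_tendsto:
  "((\<lambda>k. onorm (\<lambda>u. V_op k (resolvent (V_op (- k) u)) - resolvent u)) \<longlongrightarrow> 0) (at 0)"
proof -
  obtain K where K: "0 \<le> K"
    "\<And>k w. norm k \<le> 1 \<Longrightarrow> norm (V_op k (resolvent (V_op (- k) w)) - resolvent w) \<le> K * norm k * norm w"
    by (rule resolvent_modulation) blast
  have R: "bounded_linear resolvent"
    using bounded_op_resolvent by (simp add: bounded_op_def)
  have bl: "bounded_linear (\<lambda>u. V_op k (resolvent (V_op (- k) u)) - resolvent u)" for k
    by (intro bounded_linear_sub R bounded_linear_compose[OF bounded_linear_V_op]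
        bounded_linear_compose[OF R] bounded_linear_V_op)
  show ?thesis
  proof (rule tendsto_sandwich[where f = "\<lambda>_. 0" and h = "\<lambda>k. K * norm k"])
    show "\<forall>\<^sub>F k in at 0. 0 \<le> onorm (\<lambda>u. V_op k (resolvent (V_op (- k) u)) - resolvent u)"
      by (intro always_eventually allI onorm_pos_le bl)
    have "\<forall>\<^sub>F k in at (0::'a). norm k \<le> 1"
      by (auto simp: eventually_at dist_norm intro!: exI[of _ 1])
    then show "\<forall>\<^sub>F k in at 0. onorm (\<lambda>u. V_op k (resolvent (V_op (- k) u)) - resolvent u) \<le> K * norm k"
      by (rule eventually_mono) (rule onorm_bound, use K in auto)
    show "((\<lambda>k::'a. K * norm k) \<longlongrightarrow> 0) (at 0)"
      by (auto intro!: tendsto_eq_intros)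
  qed auto
qed

section \<open>Translations and the resolvent\<close>

text \<open>After a change of variables the weight \<open>a\<close> is translated instead of the function, and it
  tends to 0 pointwise while staying bounded, so dominated convergence applies.\<close>

lemma energy_translate_tendsto:
  assumes u: "u \<in> test_space" and p: "filterlim p at_infinity sequentially"
  shows "(\<lambda>n. energy (U_op (p n) u)) \<longlonglongrightarrow> 0"
proof -
  obtain f where f: "f \<in> Cc_infinity" "u = abs_L2 f" using u by (rule test_spaceE)
  obtain B where B: "B > 0" "\<And>x. a x \<le> B" by (rule a_bounded) blast
  have lim: "(\<lambda>n. \<integral>x. a (x - p n) * (cmod (partial b f x))\<^sup>2 \<partial>lborel) \<longlonglongrightarrow> integral\<^sup>L lborel (\<lambda>x::'a. 0::real)"
    if b: "b \<in> Basis" for b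
  proof (rule integral_dominated_convergence[where w = "\<lambda>x. B * (cmod (partial b f x))\<^sup>2"])
    have [measurable]: "partial b f \<in> borel_measurable borel"
      by (rule borel_measurable_continuous_onI) (rule Cc_infinityD(5)[OF f(1) b])
    show "(\<lambda>x. a (x - p n) * (cmod (partial b f x))\<^sup>2) \<in> borel_measurable lborel" for n
      by measurable
    have "sq_integrable (partial b f)"
      by (rule sq_integrable_compact_support[OF Cc_infinityD(5)[OF f(1) b] Cc_infinityD(3)[OF f(1)]
            partial_zero_outside])
    then show "integrable lborel (\<lambda>x. B * (cmod (partial b f x))\<^sup>2)"
      by (simp add: sq_integrable_def)
    show "AE x in lborel. (\<lambda>n. a (x - p n) * (cmod (partial b f x))\<^sup>2) \<longlonglongrightarrow> 0"
    proof (rule AE_I2)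
      fix x
      have "filterlim (\<lambda>n. x - p n) at_infinity sequentially"
        using p by (intro tendsto_add_filterlim_at_infinity[OF tendsto_const, of "\<lambda>n. - p n", simplified])
          (simp add: filterlim_at_infinity_conv_norm_at_top)
      from tendsto_mult[OF filterlim_compose[OF a_vanishes this] tendsto_const[of "(cmod (partial b f x))\<^sup>2"]]
      show "(\<lambda>n. a (x - p n) * (cmod (partial b f x))\<^sup>2) \<longlonglongrightarrow> 0" by simp
    qed
    show "AE x in lborel. norm (a (x - p n) * (cmod (partial b f x))\<^sup>2) \<le> B * (cmod (partial b f x))\<^sup>2" for n
      using B(2) a_pos by (intro AE_I2) (simp add: abs_mult abs_of_pos mult_right_mono)
  qed simp
  have eq: "(energy (U_op (p n) u))\<^sup>2
      = (\<Sum>b\<in>Basis. \<integral>x. a (x - p n) * (cmod (partial b f x))\<^sup>2 \<partial>lborel)" for n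
  proof -
    have U: "U_op (p n) u = abs_L2 (\<lambda>x. f (x + p n))"
      using f by (simp add: U_op_abs sq_integrable_Cc)
    have "(norm (abs_L2 (wgrad b (\<lambda>x. f (x + p n)))))\<^sup>2
        = (\<integral>x. a (x - p n) * (cmod (partial b f x))\<^sup>2 \<partial>lborel)" if b: "b \<in> Basis" for b
    proof -
      have [measurable]: "partial b f \<in> borel_measurable borel"
        by (rule borel_measurable_continuous_onI) (rule Cc_infinityD(5)[OF f(1) b])
      have "(cmod (wgrad b (\<lambda>x. f (x + p n)) x))\<^sup>2 = a ((x + p n) - p n) * (cmod (partial b f (x + p n)))\<^sup>2" for x
        using a_pos[of x] by (simp add: wgrad_def partial_shift(1)[OF Cc_infinityD(1)[OF f(1)]]
            norm_mult power_mult_distrib)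
      then have "(norm (abs_L2 (wgrad b (\<lambda>x. f (x + p n)))))\<^sup>2
          = (\<integral>x. a ((x + p n) - p n) * (cmod (partial b f (x + p n)))\<^sup>2 \<partial>lborel)"
        by (subst norm_abs_L2[OF sq_integrable_wgrad[OF Cc_shift[OF f(1)] b]]) (simp only:)
      also have "\<dots> = (\<integral>x. a (x - p n) * (cmod (partial b f x))\<^sup>2 \<partial>lborel)"
        by (rule integral_shift[where f = "\<lambda>x. a (x - p n) * (cmod (partial b f x))\<^sup>2"]) measurable
      finally show ?thesis .
    qed
    then show ?thesis
      unfolding U energy_square[OF Cc_shift[OF f(1)]] by simp
  qed
  have "(\<lambda>n. (energy (U_op (p n) u))\<^sup>2) \<longlonglongrightarrow> (\<Sum>b\<in>(Basis::'a set). 0)"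
    unfolding eq using lim by (intro tendsto_sum) simp
  from tendsto_real_sqrt[OF this] show ?thesis
    using u f by (simp add: energy_nonneg U_op_abs sq_integrable_Cc test_spaceI Cc_shift)
qed

text \<open>The resolvent differs little from \<open>1/\<alpha>\<close> on a separating function that has been moved far away,
  and translations commute with each other, so the separation from its translate by \<open>s\<close> persists.\<close>

lemma onorm_translation_ge:
  assumes "s \<noteq> 0"
  shows "1 / \<alpha> \<le> onorm (\<lambda>u. U_op s (resolvent u) - resolvent u)"
proof -
  obtain \<psi> where \<psi>: "\<psi> \<in> test_space" "\<psi> \<noteq> 0" "norm \<psi> \<le> norm (U_op s \<psi> - \<psi>)"
    by (rule translation_separating[OF assms])
  have R: "bounded_linear resolvent"
    using bounded_op_resolvent by (simp add: bounded_op_def)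
  let ?T = "\<lambda>u. U_op s (resolvent u) - resolvent u"
  have bl: "bounded_linear ?T"
    by (intro bounded_linear_sub R bounded_linear_compose[OF bounded_linear_U_op])
  define p where "p n = real n *\<^sub>R s" for n
  have p: "filterlim p at_infinity sequentially"
  proof -
    have "filterlim (\<lambda>n. real n * norm s) at_top sequentially"
      using assms by (intro filterlim_at_top_mult_tendsto_pos[OF tendsto_const _ filterlim_real_sequentially]) simp
    then show ?thesis
      by (simp add: filterlim_at_infinity_conv_norm_at_top p_def)
  qed
  define e where "e n = energy (U_op (p n) \<psi>) / \<alpha> / sqrt \<alpha>" for n
  have "norm \<psi> / \<alpha> - 2 * e n \<le> onorm ?T * norm \<psi>" for n
  proof -
    let ?u = "U_op (p n) \<psi>"
    have uD: "?u \<in> test_space"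
      using \<psi>(1) by (auto elim!: test_spaceE simp: U_op_abs sq_integrable_Cc intro!: test_spaceI Cc_shift)
    define d where "d = resolvent ?u - cscale (of_real (1 / \<alpha>)) ?u"
    have d: "norm d \<le> e n"
    proof -
      have "sqrt \<alpha> * norm d \<le> energy ?u / \<alpha>"
        unfolding d_def using \<alpha>_pos uD
        by (intro resolvent_approx approx_solution_rescaled) (auto intro!: divide_nonneg_pos energy_nonneg)
      then have "norm d * sqrt \<alpha> \<le> energy ?u / \<alpha>"
        by (simp only: mult.commute)
      then show ?thesis
        unfolding e_def by (rule mult_imp_le_div_pos[rotated]) (use \<alpha>_pos in simp)
    qed
    have "?T ?u = cscale (of_real (1 / \<alpha>)) (U_op (p n) (U_op s \<psi> - \<psi>)) + (U_op s d - d)"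
    proof -
      have Ru: "resolvent ?u = cscale (of_real (1 / \<alpha>)) ?u + d" by (simp add: d_def)
      show ?thesis
        unfolding Ru U_op_add U_op_cscale U_op_commute[of s "p n"]
          linear_diff[OF bounded_linear.linear[OF bounded_linear_U_op]]
          linear_diff[OF bounded_linear.linear[OF bounded_linear_cscale]]
        by simp
    qed
    moreover have "norm (U_op s d - d) \<le> 2 * e n"
      using norm_triangle_ineq4[of "U_op s d" d] d by (simp add: norm_U_op)
    moreover have "norm (cscale (of_real (1 / \<alpha>)) (U_op (p n) (U_op s \<psi> - \<psi>))) \<ge> norm \<psi> / \<alpha>"
      using \<psi>(3) \<alpha>_pos by (simp add: norm_cscale norm_U_op norm_divide divide_right_mono)
    moreover have "norm (x + y) \<ge> norm x - norm y" for x y :: "'a L2"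
      using norm_diff_ineq[of x y] .
    ultimately have "norm \<psi> / \<alpha> - 2 * e n \<le> norm (?T ?u)"
      by (smt (verit))
    also have "\<dots> \<le> onorm ?T * norm ?u"
      by (rule onorm[OF bl])
    finally show ?thesis by (simp add: norm_U_op)
  qed
  moreover have "(\<lambda>n. norm \<psi> / \<alpha> - 2 * e n) \<longlonglongrightarrow> norm \<psi> / \<alpha> - 2 * (0 / \<alpha> / sqrt \<alpha>)"
    unfolding e_def using \<alpha>_pos
    by (intro tendsto_intros energy_translate_tendsto \<psi> p) auto
  ultimately have "norm \<psi> / \<alpha> \<le> onorm ?T * norm \<psi>"
    using LIMSEQ_le_const2 by fastforce
  then have "1 / \<alpha> * norm \<psi> \<le> onorm ?T * norm \<psi>" by simp
  then show ?thesis
    by (rule mult_right_le_imp_le) (use \<psi>(2) in simp)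
qed

end

section \<open>Affiliation\<close>

lemma adj_symmetric:
  assumes "bounded_op A" "\<And>u v. cinner (A u) v = cinner u (A v)"
  shows "adj A = A"
  unfolding adj_def
proof (rule the_equality)
  fix B assume B: "bounded_op B \<and> (\<forall>u v. cinner (A u) v = cinner u (B v))"
  have "cinner (B v) u = cinner (A v) u" for u v
  proof -
    have "cinner u (B v) = cinner u (A v)" using B assms(2) by metis
    then show ?thesis using cinner_commute by metis
  qed
  then show "B = A" by (intro ext cinner_eq_zero_cancel)
qed (use assms in blast)

text \<open>The resolvent identity, in the form \<open>A = R (1 + (z - w) A)\<close>.\<close>

lemma resolvent_factorization:
  assumes R: "is_bounded_inverse (plus_scalar T z) R"
    and A: "is_bounded_inverse (plus_scalar T w) A"
  shows "A u = R (u + cscale (z - w) (A u))"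
proof -
  have "(u, A u) \<in> (plus_scalar T w)\<inverse>"
    using A by (auto simp: is_bounded_inverse_def)
  then obtain v where v: "(A u, v) \<in> T" "u = v + cscale w (A u)"
    by (auto simp: plus_scalar_def)
  have "u + cscale (z - w) (A u) = v + cscale z (A u)"
  proof -
    have "cscale z (A u) = cscale (z - w) (A u) + cscale w (A u)"
      by (simp flip: cscale_add_left)
    then show ?thesis by (subst v(2)) (simp add: add_ac)
  qed
  then have "(u + cscale (z - w) (A u), A u) \<in> (plus_scalar T z)\<inverse>"
    using v(1) by (auto simp: plus_scalar_def)
  then show ?thesis
    using R by (auto simp: is_bounded_inverse_def)
qed

text \<open>Translation continuity concerns only the outermost factor of a product, and so is inherited by
  right multiples.\<close>

lemma translation_continuity_transfer:
  assumes R: "bounded_op R" and B: "bounded_linear B" and A: "\<And>u. A u = R (B u)"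
    and lim: "((\<lambda>s. onorm (\<lambda>u. U_op s (R u) - R u)) \<longlongrightarrow> 0) (at 0)"
  shows "((\<lambda>s. onorm (\<lambda>u. U_op s (A u) - A u)) \<longlongrightarrow> 0) (at 0)"
proof -
  have Rl: "bounded_linear R" using R by (simp add: bounded_op_def)
  have bl: "bounded_linear (\<lambda>u. U_op s (R u) - R u)" for s
    by (intro bounded_linear_sub Rl bounded_linear_compose[OF bounded_linear_U_op])
  have eq: "(\<lambda>u. U_op s (A u) - A u) = (\<lambda>u. U_op s (R u) - R u) \<circ> B" for s
    by (simp add: A fun_eq_iff)
  have "((\<lambda>s. onorm (\<lambda>u. U_op s (R u) - R u) * onorm B) \<longlongrightarrow> 0) (at 0)"
    using tendsto_mult[OF lim tendsto_const[of "onorm B"]] by simp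
  then show ?thesis
  proof (rule tendsto_sandwich[OF _ _ tendsto_const, rotated 2])
    show "\<forall>\<^sub>F s in at 0. 0 \<le> onorm (\<lambda>u. U_op s (A u) - A u)"
      unfolding eq o_def by (intro always_eventually allI onorm_pos_le bounded_linear_compose[OF bl B])
    show "\<forall>\<^sub>F s in at 0. onorm (\<lambda>u. U_op s (A u) - A u) \<le> onorm (\<lambda>u. U_op s (R u) - R u) * onorm B"
      unfolding eq by (intro always_eventually allI onorm_compose bl B)
  qed
qed

context vanishing_coefficient_resolvent
begin

lemma friedrichs_resolvent:
  "is_bounded_inverse (plus_scalar (friedrichs a) (of_real \<alpha>)) resolvent"
  unfolding friedrichs_def by (rule is_bounded_inverse_resolvent)

lemma friedrichs_not_in_spectrum: "- of_real \<alpha> \<notin> spectrum (friedrichs a)"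
  unfolding spectrum_def using friedrichs_resolvent by auto

lemma bounded_inverse_friedrichs: "bounded_inverse (plus_scalar (friedrichs a) (of_real \<alpha>)) = resolvent"
  by (rule bounded_inverse_eq[OF friedrichs_resolvent])

lemma not_translation_continuous:
  "\<not> ((\<lambda>s. onorm (\<lambda>u. U_op s (resolvent u) - resolvent u)) \<longlongrightarrow> 0) (at 0)"
proof
  assume "((\<lambda>s. onorm (\<lambda>u. U_op s (resolvent u) - resolvent u)) \<longlongrightarrow> 0) (at 0)"
  moreover have "\<forall>\<^sub>F s in at 0. 1 / \<alpha> \<le> onorm (\<lambda>u. U_op s (resolvent u) - resolvent u)"
    using onorm_translation_ge by (simp add: eventually_at_filter)
  ultimately have "1 / \<alpha> \<le> 0"
    by (intro tendsto_lowerbound) auto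
  then show False using \<alpha>_pos by simp
qed

lemma adj_resolvent: "adj resolvent = resolvent"
  by (rule adj_symmetric[OF bounded_op_resolvent resolvent_symmetric])

end

text \<open>Affiliation asks for a single resolvent in the algebra, at an arbitrary complex point; the
  failure at one point rules out all others by the resolvent identity.\<close>

lemma not_affiliated_algebra_E:
  assumes A: "is_bounded_inverse (plus_scalar T w) A"
    and not_cont: "\<not> ((\<lambda>s. onorm (\<lambda>u. U_op s (A u) - A u)) \<longlongrightarrow> 0) (at 0)"
  shows "\<not> affiliated T algebra_E"
proof
  assume "affiliated T algebra_E"
  then obtain z R where R: "is_bounded_inverse (plus_scalar T (- z)) R" and E: "R \<in> algebra_E"
    unfolding affiliated_def spectrum_def using bounded_inverse_eq by auto
  have "bounded_linear A"
    using A by (simp add: is_bounded_inverse_def bounded_op_def)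
  then have B: "bounded_linear (\<lambda>u. u + cscale (- z - w) (A u))"
    by (intro bounded_linear_add bounded_linear_ident bounded_linear_compose[OF bounded_linear_cscale])
  have "((\<lambda>s. onorm (\<lambda>u. U_op s (A u) - A u)) \<longlongrightarrow> 0) (at 0)"
  proof (rule translation_continuity_transfer[OF _ B])
    show "bounded_op R" using R by (simp add: is_bounded_inverse_def)
    show "A u = R (u + cscale (- z - w) (A u))" for u
      by (rule resolvent_factorization[OF R A])
    show "((\<lambda>s. onorm (\<lambda>u. U_op s (R u) - R u)) \<longlongrightarrow> 0) (at 0)"
      using E by (simp add: algebra_E_def)
  qed
  with not_cont show False ..
qed

theorem theorem3:
  fixes a :: "real^'n \<Rightarrow> real"
    and H :: "((real^'n) L2 \<times> (real^'n) L2) set"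
  assumes "C_k 1 a"
    and "\<And>x. 0 < a x"
    and "H = friedrichs a"
    and "(a \<longlongrightarrow> 0) at_infinity"
  shows "(\<forall>\<alpha>>0. - complex_of_real \<alpha> \<notin> spectrum H \<and>
            (let A = bounded_inverse (plus_scalar H (complex_of_real \<alpha>)) in
               ((\<lambda>k. onorm (\<lambda>u. V_op k (A (V_op (- k) u)) - A u)) \<longlongrightarrow> 0) (at 0) \<and>
               \<not> ((\<lambda>s. onorm (\<lambda>u. U_op s (A u) - A u)) \<longlongrightarrow> 0) (at 0) \<and>
               \<not> ((\<lambda>s. onorm (\<lambda>u. U_op s (adj A u) - adj A u)) \<longlongrightarrow> 0) (at 0))) \<and>
         affiliated H algebra_D \<and>
         \<not> affiliated H algebra_E"
proof (intro conjI allI impI)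
  fix \<alpha> :: real assume "\<alpha> > 0"
  then interpret vanishing_coefficient_resolvent a \<alpha>
    using assms(1,2,4) by unfold_locales
  show "- complex_of_real \<alpha> \<notin> spectrum H"
    unfolding assms(3) by (rule friedrichs_not_in_spectrum)
  show "let A = bounded_inverse (plus_scalar H (complex_of_real \<alpha>)) in
      ((\<lambda>k. onorm (\<lambda>u. V_op k (A (V_op (- k) u)) - A u)) \<longlongrightarrow> 0) (at 0) \<and>
      \<not> ((\<lambda>s. onorm (\<lambda>u. U_op s (A u) - A u)) \<longlongrightarrow> 0) (at 0) \<and>
      \<not> ((\<lambda>s. onorm (\<lambda>u. U_op s (adj A u) - adj A u)) \<longlongrightarrow> 0) (at 0)"
    unfolding assms(3) bounded_inverse_friedrichs Let_def adj_resolvent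
    by (intro conjI resolvent_modulation_tendsto not_translation_continuous)
next
  interpret vanishing_coefficient_resolvent a 1
    using assms(1,2,4) by unfold_locales simp_all
  have "resolvent \<in> algebra_D"
    by (simp add: algebra_D_def bounded_op_resolvent resolvent_modulation_tendsto)
  then show "affiliated H algebra_D"
    unfolding affiliated_def assms(3)
    using friedrichs_not_in_spectrum bounded_inverse_friedrichs by (intro exI[of _ "- 1"]) simp
  show "\<not> affiliated H algebra_E"
    unfolding assms(3)
    by (rule not_affiliated_algebra_E[OF friedrichs_resolvent not_translation_continuous])
qed

end
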